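(* If $d\ge3$, then the Quantum Graph Expansion Tester (the algorithm written out in the context, with inputs $N$, $d$, quantum query access to an $N$-node graph $G$ with degree bound $d$, expansion parameter $\Upsilon$, accuracy parameter $\epsilon$ and running time parameter $\mu<1/4$) is an $(\Upsilon,\epsilon,\mu)$-expansion tester. The runtime and number of queries of the algorithm are bounded by $$O\big(N^{1/2+\mu}\,d^{3/2}\,\Upsilon^{-1}\,\epsilon^{-1}\,\log(\epsilon^{-1})\,\log N\big).$$
   Context: Graphs are finite, simple and undirected. Query access to an $N$-node graph with degree bound $d$: a query is a pair $(v,i)\in[N]\times[d]$, answered by the $i$-th neighbor $w\in[N]$ of $v$, or by a special symbol if $v$ has fewer than $i$ neighbors; in the quantum setting queries may be made in superposition. Uniformly random nodes can be generated, and one step of the quantum walk $W$ below can be implemented with $O(\sqrt d)$ queries. Expansion testers. The (vertex) expansion of $G=(\mathcal V,\mathcal E)$ is $\min_{|\mathcal S|\le|\mathcal V|/2}|\partial\mathcal S^c|/|\mathcal S|$ over nonempty $\mathcal S\subset\mathcal V$, where $\partial\mathcal S^c$ is the set of nodes in $\mathcal V\setminus\mathcal S$ having an edge to $\mathcal S$. Two $N$-node graphs with degree bound $d$ and edge sets $\mathcal E,\mathcal E'$ are $\epsilon$-far from each other if $|\mathcal E\triangle\mathcal E'|\ge\epsilon Nd$. An algorithm is an $(\Upsilon,\epsilon,\mu)$-expansion tester if there exists a constant $c>0$, possibly dependent on $d$, such that, given parameters $N$, $d$ and query access to an $N$-node graph with degree bound $d$: (i) if the graph has expansion $\ge\Upsilon$,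 then the algorithm outputs "accept" with probability at least $2/3$; (ii) if the graph is $\epsilon$-far from any graph having expansion $\ge c\mu\Upsilon^2$, then the algorithm outputs "reject" with probability at least $2/3$. Random and quantum walk. $P$ is the lazy symmetric walk on $G$: $P(u,v)=1/(2d)$ if $(v,u)\in\mathcal E$, $P(v,v)=1-d_v/(2d)$ with $d_v$ the degree of $v$, and $0$ otherwise. $|s\rangle$ is the basis vector of node $s$ and $\|\cdot\|$ the Euclidean norm. On $\mathrm{span}\{|i,j\rangle:i\in\mathcal V,j\in\mathcal V\cup\{\flat\}\}$, with $\flat$ an extra symbol, let $V=\sum_i|i\rangle\langle i|\otimes V_i$ be a unitary with $V|i,\flat\rangle=\sum_j\sqrt{P(j,i)}|i,j\rangle$, let $S$ swap $|i,j\rangle\leftrightarrow|j,i\rangle$ for edges $(i,j)$ and fix all other basis states, and let $W=(2\,I\otimes|\flat\rangle\langle\flat|-I)V^\dagger SV$. For integers $t,\tau\ge0$, let $p_l=\mathbb P(|X_t|=l)$ with $X_t$ the position after $t$ steps of a simple symmetric random walk on $\mathbb Z$ started at $0$, and $q_l=p_l/\sum_{k=0}^{\tau}p_k$. Add a third register with basis $|0\rangle=|\flat\rangle,|1\rangle,\dots,|\tau\rangle$, let $V_q$ be a unitary on it with $V_q|\psi,\flat\rangle=\sum_{l=0}^\tau\sqrt{q_l}|\psi,l\rangle$, and set $W_\tau=V_q^\dagger\big(\sum_{l=0}^\tau W^l\otimes|l\rangle\langle l|\big)V_q$ and $\Pi_{\flat\flat}=I\otimes|\flat\flat\rangle\langle\flat\flat|$.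 Quantum 2-norm Estimator (inputs $s,t$, accuracy $\eta$, confidence $\delta$): set $\tau\in O(\sqrt{t\log(N/\eta)})$ (specifically $\tau=\lceil\sqrt{2t\ln(8\sqrt N/\eta)}\rceil$); apply $W_\tau$ to $|s,\flat\flat\rangle$; use quantum amplitude estimation to create an estimate $a$ of $\|\Pi_{\flat\flat}W_\tau|s,\flat\flat\rangle\|$ to error $\eta/2$ with probability $1-\delta$; output $a$. Here quantum amplitude estimation, for a state $|\psi\rangle$ and projector $\Pi$, outputs an estimate of $\|\Pi|\psi\rangle\|$ to error $\epsilon_0$ with probability at least $1-\delta$ using $O(\log(1/\delta)/\epsilon_0)$ reflections around $|\psi\rangle$ and around the image of $\Pi$. Quantum Graph Expansion Tester: 1. Set $t\in O(d^2\Upsilon^{-2}\log N)$, $M\in O(N^{-1/2})$, $\epsilon'\in O(N^{-1/2-\mu})$, $\delta\in O(\epsilon)$ (suitably chosen values of these orders). 2. Repeat $T\in O(\epsilon^{-1})$ times: (a) select a uniformly random starting node $s$; (b) use the Quantum 2-norm Estimator to create an estimate $a$ of $\|P^t|s\rangle\|$ to precision $\epsilon'$, with probability $1-\delta$; (c) if $a>M+\epsilon'$, abort and output "reject". 3. If there was no "reject", output "accept". *)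

theory Defs
  imports "HOL-Probability.Probability"
begin

section \<open>Graphs, expansion, query access\<close>

text \<open>Finite simple undirected graphs on the node set \<open>{..<N}\<close>: edges are two-element sets of nodes.\<close>

definition neighbors :: "nat set set \<Rightarrow> nat \<Rightarrow> nat set" where
  "neighbors E v = {w. {v, w} \<in> E}"

definition node_degree :: "nat set set \<Rightarrow> nat \<Rightarrow> nat" where
  "node_degree E v = card (neighbors E v)"

definition bounded_graph :: "nat \<Rightarrow> nat \<Rightarrow> nat set set \<Rightarrow> bool" where
  "bounded_graph N d E \<longleftrightarrow>
     (\<forall>e\<in>E. e \<subseteq> {..<N} \<and> card e = 2) \<and> (\<forall>v<N. node_degree E v \<le> d)"

definition boundary :: "nat \<Rightarrow> nat set set \<Rightarrow> nat set \<Rightarrow> nat set" where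
  "boundary N E S = {v \<in> {..<N} - S. \<exists>u\<in>S. {u, v} \<in> E}"

text \<open>The infimum is over finitely many sets, hence a minimum, except for \<open>N = 1\<close>, where no set
  is admissible and the expansion is \<open>\<infinity>\<close>.\<close>

definition expansion :: "nat \<Rightarrow> nat set set \<Rightarrow> ereal" where
  "expansion N E =
     (INF S \<in> {S. S \<subseteq> {..<N} \<and> S \<noteq> {} \<and> real (card S) \<le> real N / 2}.
        ereal (real (card (boundary N E S)) / real (card S)))"

definition far :: "nat \<Rightarrow> nat \<Rightarrow> real \<Rightarrow> nat set set \<Rightarrow> nat set set \<Rightarrow> bool" where
  "far N d \<epsilon> E E' \<longleftrightarrow> real (card ((E - E') \<union> (E' - E))) \<ge> \<epsilon> * real N * real d"

text \<open>Query access: the query \<open>(v, i)\<close> is answered by \<open>nb v i\<close>, where \<open>None\<close> is the special symbol.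
  Neighbor indices start at 0.\<close>

type_synonym access = "nat \<Rightarrow> nat \<Rightarrow> nat option"

definition adjacency_lists :: "nat \<Rightarrow> nat \<Rightarrow> nat set set \<Rightarrow> access \<Rightarrow> bool" where
  "adjacency_lists N d E nb \<longleftrightarrow>
     (\<forall>v<N. bij_betw (nb v) {..<node_degree E v} (Some ` neighbors E v) \<and>
            (\<forall>i. node_degree E v \<le> i \<and> i < d \<longrightarrow> nb v i = None))"

definition edges_of :: "nat \<Rightarrow> nat \<Rightarrow> access \<Rightarrow> nat set set" where
  "edges_of N d nb = {{v, w} | v w. v < N \<and> (\<exists>i<d. nb v i = Some w)}"

text \<open>A tester \<open>A\<close> for degree bound \<open>d\<close> maps \<open>N\<close> and the query access to the distribution of its
  output, \<open>True\<close> standing for ``accept''; \<open>c\<close> is the constant of the soundness condition.\<close>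

definition expansion_tester ::
  "real \<Rightarrow> nat \<Rightarrow> (nat \<Rightarrow> access \<Rightarrow> bool pmf) \<Rightarrow> real \<Rightarrow> real \<Rightarrow> real \<Rightarrow> bool" where
  "expansion_tester c d A \<Upsilon> \<epsilon> \<mu> \<longleftrightarrow>
     (\<forall>N E nb. 1 \<le> N \<and> bounded_graph N d E \<and> adjacency_lists N d E nb \<longrightarrow>
        (expansion N E \<ge> ereal \<Upsilon> \<longrightarrow> pmf (A N nb) True \<ge> 2 / 3) \<and>
        ((\<forall>E'. bounded_graph N d E' \<and> expansion N E' \<ge> ereal (c * \<mu> * \<Upsilon>\<^sup>2) \<longrightarrow> far N d \<epsilon> E E')
           \<longrightarrow> pmf (A N nb) False \<ge> 2 / 3))"


section \<open>Vectors and operators on a finite orthonormal basis\<close>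

text \<open>A vector is given by its coordinates, an operator by its matrix, \<open>X x y\<close> being the entry
  \<open>\<langle>x|X|y\<rangle>\<close>.  Only indices in the explicitly given finite basis set \<open>B\<close> matter.\<close>

type_synonym 'b ket = "'b \<Rightarrow> complex"
type_synonym 'b oper = "'b \<Rightarrow> 'b \<Rightarrow> complex"

definition ket :: "'b \<Rightarrow> 'b ket" where
  "ket x = (\<lambda>y. if y = x then 1 else 0)"

definition ket_norm :: "'b set \<Rightarrow> 'b ket \<Rightarrow> real" where
  "ket_norm B \<psi> = L2_set (\<lambda>x. cmod (\<psi> x)) B"

definition op_id :: "'b oper" where
  "op_id = (\<lambda>x y. if x = y then 1 else 0)"

definition op_mult :: "'b set \<Rightarrow> 'b oper \<Rightarrow> 'b oper \<Rightarrow> 'b oper" where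
  "op_mult B X Y = (\<lambda>x y. \<Sum>z\<in>B. X x z * Y z y)"

primrec op_power :: "'b set \<Rightarrow> 'b oper \<Rightarrow> nat \<Rightarrow> 'b oper" where
  "op_power B X 0 = op_id"
| "op_power B X (Suc n) = op_mult B X (op_power B X n)"

definition op_app :: "'b set \<Rightarrow> 'b oper \<Rightarrow> 'b ket \<Rightarrow> 'b ket" where
  "op_app B X \<psi> = (\<lambda>x. \<Sum>y\<in>B. X x y * \<psi> y)"

definition op_adj :: "'b oper \<Rightarrow> 'b oper" where
  "op_adj X = (\<lambda>x y. cnj (X y x))"

definition op_tensor :: "'a oper \<Rightarrow> 'b oper \<Rightarrow> ('a \<times> 'b) oper" where
  "op_tensor X Y = (\<lambda>(x, x') (y, y'). X x y * Y x' y')"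

definition unitary_on :: "'b set \<Rightarrow> 'b oper \<Rightarrow> bool" where
  "unitary_on B U \<longleftrightarrow> (\<forall>x\<in>B. \<forall>y\<in>B. op_mult B (op_adj U) U x y = op_id x y \<and>
                                  op_mult B U (op_adj U) x y = op_id x y)"

definition projector_on :: "'b set \<Rightarrow> 'b oper \<Rightarrow> bool" where
  "projector_on B R \<longleftrightarrow>
     (\<forall>x\<in>B. \<forall>y\<in>B. op_adj R x y = R x y \<and> op_mult B R R x y = R x y)"


section \<open>Random walk and quantum walk\<close>

definition lazy_walk :: "nat \<Rightarrow> nat set set \<Rightarrow> nat \<Rightarrow> nat \<Rightarrow> real" where
  "lazy_walk d E u v =
     (if u = v then 1 - real (node_degree E v) / (2 * real d)
      else if {v, u} \<in> E then 1 / (2 * real d) else 0)"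

text \<open>Basis of the walk space: \<open>(i, Some j)\<close> is \<open>|i,j\<rangle>\<close>, and \<open>(i, None)\<close> is \<open>|i,\<flat>\<rangle>\<close>.\<close>

type_synonym wbasis = "nat \<times> nat option"

definition coin_basis :: "nat \<Rightarrow> nat option set" where
  "coin_basis N = insert None (Some ` {..<N})"

definition walk_basis :: "nat \<Rightarrow> wbasis set" where
  "walk_basis N = {..<N} \<times> coin_basis N"

text \<open>\<open>coin i\<close> is the unitary \<open>V\<^sub>i\<close>; only its column at \<open>\<flat>\<close> is prescribed.\<close>

definition valid_coin :: "nat \<Rightarrow> nat \<Rightarrow> nat set set \<Rightarrow> (nat \<Rightarrow> nat option oper) \<Rightarrow> bool" where
  "valid_coin N d E coin \<longleftrightarrow>
     (\<forall>i<N. unitary_on (coin_basis N) (coin i) \<and>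
            coin i None None = 0 \<and>
            (\<forall>j<N. coin i (Some j) None = complex_of_real (sqrt (lazy_walk d E j i))))"

definition V_op :: "(nat \<Rightarrow> nat option oper) \<Rightarrow> wbasis oper" where
  "V_op coin = (\<lambda>(i, a) (i', b). if i = i' then coin i a b else 0)"

fun swap_edge :: "nat set set \<Rightarrow> wbasis \<Rightarrow> wbasis" where
  "swap_edge E (i, Some j) = (if {i, j} \<in> E then (j, Some i) else (i, Some j))"
| "swap_edge E (i, None) = (i, None)"

definition S_op :: "nat set set \<Rightarrow> wbasis oper" where
  "S_op E = (\<lambda>x y. ket (swap_edge E y) x)"

definition flat_reflection :: "wbasis oper" where
  "flat_reflection = (\<lambda>x y. 2 * (if x = y \<and> snd y = None then 1 else 0) - op_id x y)"

definition W_op :: "nat \<Rightarrow> nat set set \<Rightarrow> (nat \<Rightarrow> nat option oper) \<Rightarrow> wbasis oper" where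
  "W_op N E coin =
     op_mult (walk_basis N) flat_reflection
       (op_mult (walk_basis N) (op_adj (V_op coin))
         (op_mult (walk_basis N) (S_op E) (V_op coin)))"

primrec srw :: "nat \<Rightarrow> int pmf" where
  "srw 0 = return_pmf 0"
| "srw (Suc t) = bind_pmf (srw t) (\<lambda>x. pmf_of_set {x - 1, x + 1})"

definition srw_abs :: "nat \<Rightarrow> nat \<Rightarrow> real" where
  "srw_abs t l = measure_pmf.prob (srw t) {x. \<bar>x\<bar> = int l}"

definition qff_weight :: "nat \<Rightarrow> nat \<Rightarrow> nat \<Rightarrow> real" where
  "qff_weight t \<tau> l = srw_abs t l / (\<Sum>k\<le>\<tau>. srw_abs t k)"

text \<open>\<open>prep t \<tau>\<close> is the unitary \<open>V\<^sub>q\<close> on the third register, whose basis is \<open>{..\<tau>}\<close> with \<open>\<flat> = 0\<close>.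
  For odd \<open>t\<close> and \<open>\<tau> = 0\<close> the weights are not defined, and nothing is required.\<close>

definition valid_prep :: "(nat \<Rightarrow> nat \<Rightarrow> nat oper) \<Rightarrow> bool" where
  "valid_prep prep \<longleftrightarrow>
     (\<forall>t \<tau>. (\<Sum>k\<le>\<tau>. srw_abs t k) \<noteq> 0 \<longrightarrow>
        unitary_on {..\<tau>} (prep t \<tau>) \<and>
        (\<forall>l\<le>\<tau>. prep t \<tau> l 0 = complex_of_real (sqrt (qff_weight t \<tau> l))))"

type_synonym fbasis = "wbasis \<times> nat"

definition full_basis :: "nat \<Rightarrow> nat \<Rightarrow> fbasis set" where
  "full_basis N \<tau> = walk_basis N \<times> {..\<tau>}"

definition controlled_powers :: "nat \<Rightarrow> wbasis oper \<Rightarrow> fbasis oper" where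
  "controlled_powers N W =
     (\<lambda>(x, l) (y, m). if l = m then op_power (walk_basis N) W l x y else 0)"

definition W_tau :: "nat \<Rightarrow> nat \<Rightarrow> wbasis oper \<Rightarrow> nat oper \<Rightarrow> fbasis oper" where
  "W_tau N \<tau> W Vq =
     op_mult (full_basis N \<tau>) (op_adj (op_tensor op_id Vq))
       (op_mult (full_basis N \<tau>) (controlled_powers N W) (op_tensor op_id Vq))"

definition Pi_flat :: "fbasis oper" where
  "Pi_flat = (\<lambda>x y. if x = y \<and> snd (fst y) = None \<and> snd y = 0 then 1 else 0)"


section \<open>Query implementation of one walk step\<close>

text \<open>A query circuit has registers for the node \<open>v\<close>, the index \<open>i\<close>, an answer of \<open>m\<close> bits and a
  \<open>z\<close>-dimensional work space.  A query in superposition is the unitary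
  \<open>|v,i,x,w\<rangle> \<mapsto> |v,i,x XOR (code of nb v i),w\<rangle>\<close>, with the special symbol coded as 0 and a
  node \<open>u\<close> as \<open>u + 1\<close>.\<close>

type_synonym qbasis = "nat \<times> nat \<times> nat \<times> nat"

definition query_basis :: "nat \<Rightarrow> nat \<Rightarrow> nat \<Rightarrow> nat \<Rightarrow> qbasis set" where
  "query_basis N d m z = {..<N} \<times> {..<d} \<times> {..<2 ^ m} \<times> {..<z}"

definition answer_code :: "nat option \<Rightarrow> nat" where
  "answer_code a = (case a of None \<Rightarrow> 0 | Some u \<Rightarrow> Suc u)"

definition query_op :: "access \<Rightarrow> qbasis oper" where
  "query_op nb = (\<lambda>p (v, i, x, w). ket (v, i, semiring_bit_operations_class.xor x (answer_code (nb v i)), w) p)"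

primrec query_circuit ::
  "qbasis set \<Rightarrow> access \<Rightarrow> (nat \<Rightarrow> qbasis oper) \<Rightarrow> nat \<Rightarrow> qbasis oper" where
  "query_circuit Q nb U 0 = U 0"
| "query_circuit Q nb U (Suc k) =
     op_mult Q (U (Suc k)) (op_mult Q (query_op nb) (query_circuit Q nb U k))"

text \<open>\<open>k\<close> queries suffice to implement \<open>W\<close>: the input-independent unitaries \<open>U 0, \<dots>, U k\<close>,
  interleaved with \<open>k\<close> queries, act as \<open>W\<close> on the walk space, embedded by means of basis states
  (ancillas start in and return to fixed states).  Queries are self-inverse and act trivially on the
  uniform superposition of answers, so the adjoint and the controlled version of \<open>W\<close> need no more
  queries.\<close>

definition walk_implementable ::
  "nat \<Rightarrow> nat \<Rightarrow> (access \<Rightarrow> nat \<Rightarrow> nat option oper) \<Rightarrow> nat \<Rightarrow> bool" where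
  "walk_implementable N d coin k \<longleftrightarrow>
     (\<exists>m z U enc. N < 2 ^ m \<and>
        (\<forall>j\<le>k. unitary_on (query_basis N d m z) (U j)) \<and>
        inj_on enc (walk_basis N) \<and> enc ` walk_basis N \<subseteq> query_basis N d m z \<and>
        (\<forall>E nb. bounded_graph N d E \<and> adjacency_lists N d E nb \<longrightarrow>
           (\<forall>x\<in>walk_basis N. \<forall>y\<in>walk_basis N.
              query_circuit (query_basis N d m z) nb U k (enc x) (enc y) =
              W_op N E (coin nb) x y)))"


section \<open>The algorithm\<close>

text \<open>The primitives the algorithm is built from.  \<open>ampl_est B \<psi> R \<epsilon>\<^sub>0 \<delta>\<close> is the joint distribution of
  the estimate, the number of reflections around \<open>\<psi>\<close> and the number of reflections around the image
  of \<open>R\<close>.  \<open>walk_queries N d\<close> and \<open>walk_time N d\<close> are the queries and the elementary steps spent on one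
  (controlled, possibly inverted) walk step.\<close>

record primitives =
  ampl_est :: "fbasis set \<Rightarrow> fbasis ket \<Rightarrow> fbasis oper \<Rightarrow> real \<Rightarrow> real \<Rightarrow> (real \<times> nat \<times> nat) pmf"
  coin_op :: "nat \<Rightarrow> nat \<Rightarrow> access \<Rightarrow> nat \<Rightarrow> nat option oper"
  prep_op :: "nat \<Rightarrow> nat \<Rightarrow> nat oper"
  walk_queries :: "nat \<Rightarrow> nat \<Rightarrow> nat"
  walk_time :: "nat \<Rightarrow> nat \<Rightarrow> nat"

text \<open>The ranges \<open>\<epsilon>\<^sub>0 \<le> 1\<close> and \<open>\<delta> \<le> 1 / 2\<close> keep the bound \<open>O(log (1 / \<delta>) / \<epsilon>\<^sub>0)\<close> on the number of
  reflections from degenerating to 0; outside them nothing is known about the estimate.\<close>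

definition amplitude_estimation ::
  "('b set \<Rightarrow> 'b ket \<Rightarrow> 'b oper \<Rightarrow> real \<Rightarrow> real \<Rightarrow> (real \<times> nat \<times> nat) pmf) \<Rightarrow> bool" where
  "amplitude_estimation ae \<longleftrightarrow>
     (\<exists>C. \<forall>B \<psi> R \<epsilon>\<^sub>0 \<delta>.
        finite B \<and> ket_norm B \<psi> = 1 \<and> projector_on B R \<and>
        0 < \<epsilon>\<^sub>0 \<and> \<epsilon>\<^sub>0 \<le> 1 \<and> 0 < \<delta> \<and> \<delta> \<le> 1 / 2 \<longrightarrow>
          measure_pmf.prob (ae B \<psi> R \<epsilon>\<^sub>0 \<delta>)
            {(a, r, r'). \<bar>a - ket_norm B (op_app B R \<psi>)\<bar> \<le> \<epsilon>\<^sub>0} \<ge> 1 - \<delta> \<and>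
          (\<forall>(a, r, r') \<in> set_pmf (ae B \<psi> R \<epsilon>\<^sub>0 \<delta>). real (r + r') \<le> C * ln (1 / \<delta>) / \<epsilon>\<^sub>0))"

definition valid_primitives :: "primitives \<Rightarrow> bool" where
  "valid_primitives X \<longleftrightarrow>
     amplitude_estimation (ampl_est X) \<and>
     (\<forall>N d E nb. 1 \<le> N \<and> 1 \<le> d \<and> bounded_graph N d E \<and> adjacency_lists N d E nb \<longrightarrow>
        valid_coin N d E (coin_op X N d nb)) \<and>
     valid_prep (prep_op X) \<and>
     (\<exists>C. \<forall>N d. 1 \<le> N \<and> 1 \<le> d \<longrightarrow>
        walk_implementable N d (coin_op X N d) (walk_queries X N d) \<and>
        real (walk_queries X N d) \<le> C * sqrt (real d) \<and>
        real (walk_time X N d) \<le> C * sqrt (real d))"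

definition qff_length :: "nat \<Rightarrow> nat \<Rightarrow> real \<Rightarrow> nat" where
  "qff_length N t \<eta> = nat \<lceil>sqrt (2 * real t * ln (8 * sqrt (real N) / \<eta>))\<rceil>"

text \<open>One application of \<open>W\<^sub>\<tau>\<close> (or its adjoint) takes \<open>\<tau>\<close> controlled walk steps and two applications of
  \<open>V\<^sub>q\<close> or its adjoint, each of which is charged \<open>\<tau> + 1\<close> time units.\<close>

definition W_tau_queries :: "primitives \<Rightarrow> nat \<Rightarrow> nat \<Rightarrow> nat \<Rightarrow> nat" where
  "W_tau_queries X N d \<tau> = \<tau> * walk_queries X N d"

definition W_tau_time :: "primitives \<Rightarrow> nat \<Rightarrow> nat \<Rightarrow> nat \<Rightarrow> nat" where
  "W_tau_time X N d \<tau> = 2 * (\<tau> + 1) + \<tau> * walk_time X N d"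

text \<open>Result: estimate, number of queries, running time.  \<open>W\<^sub>\<tau>\<close> is applied once to create \<open>|\<psi>\<rangle>\<close>.  A
  reflection around \<open>|\<psi>\<rangle> = W\<^sub>\<tau>|s,\<flat>\<flat>\<rangle>\<close> is a reflection around \<open>|s,\<flat>\<flat>\<rangle>\<close> conjugated by \<open>W\<^sub>\<tau>\<close>.
  Reflections around \<open>|s,\<flat>\<flat>\<rangle>\<close> and around the image of \<open>\<Pi>\<^sub>\<flat>\<^sub>\<flat>\<close> take no query and unit time.\<close>

definition norm_estimator ::
  "primitives \<Rightarrow> nat \<Rightarrow> nat \<Rightarrow> access \<Rightarrow> nat \<Rightarrow> nat \<Rightarrow> real \<Rightarrow> real \<Rightarrow> (real \<times> nat \<times> nat) pmf" where
  "norm_estimator X N d nb s t \<eta> \<delta> =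
     (let \<tau> = qff_length N t \<eta>;
          B = full_basis N \<tau>;
          W = W_op N (edges_of N d nb) (coin_op X N d nb);
          \<psi> = op_app B (W_tau N \<tau> W (prep_op X t \<tau>)) (ket ((s, None), 0));
          q = W_tau_queries X N d \<tau>;
          h = W_tau_time X N d \<tau>
      in map_pmf (\<lambda>(a, r, r'). (a, q + r * (2 * q), h + r * (2 * h + 1) + r'))
           (ampl_est X B \<psi> Pi_flat (\<eta> / 2) \<delta>))"

record tester_params =
  walk_steps :: nat
  threshold :: real
  precision :: real
  confidence :: real
  repetitions :: nat

text \<open>Result: output (\<open>True\<close> is ``accept''), number of queries, running time.  Sampling \<open>s\<close>, comparing
  \<open>a\<close> with the threshold, and writing the output take one time unit each.\<close>

primrec tester_loop ::
  "primitives \<Rightarrow> nat \<Rightarrow> nat \<Rightarrow> access \<Rightarrow> tester_params \<Rightarrow> nat \<Rightarrow> (bool \<times> nat \<times> nat) pmf" where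
  "tester_loop X N d nb p 0 = return_pmf (True, 0, 1)"
| "tester_loop X N d nb p (Suc n) =
     bind_pmf (pmf_of_set {..<N}) (\<lambda>s.
     bind_pmf (norm_estimator X N d nb s (walk_steps p) (precision p) (confidence p))
       (\<lambda>(a, q, h).
          if a > threshold p + precision p then return_pmf (False, q, h + 3)
          else map_pmf (\<lambda>(b, q', h'). (b, q + q', h + 2 + h')) (tester_loop X N d nb p n)))"

definition expansion_test ::
  "primitives \<Rightarrow> tester_params \<Rightarrow> nat \<Rightarrow> nat \<Rightarrow> access \<Rightarrow> (bool \<times> nat \<times> nat) pmf" where
  "expansion_test X p N d nb = tester_loop X N d nb p (repetitions p)"

text \<open>The orders of the parameters, as functions of \<open>N\<close>, \<open>d\<close>, \<open>\<Upsilon>\<close>, \<open>\<epsilon>\<close>, \<open>\<mu>\<close>, with an absolute constant.\<close>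

definition params_of_order ::
  "(nat \<Rightarrow> nat \<Rightarrow> real \<Rightarrow> real \<Rightarrow> real \<Rightarrow> tester_params) \<Rightarrow> bool" where
  "params_of_order P \<longleftrightarrow>
     (\<exists>C. \<forall>N d \<Upsilon> \<epsilon> \<mu>. 1 \<le> N \<and> 3 \<le> d \<and> 0 < \<Upsilon> \<and> 0 < \<epsilon> \<and> \<epsilon> < 1 \<and> 0 < \<mu> \<and> \<mu> < 1 / 4 \<longrightarrow>
        (let p = P N d \<Upsilon> \<epsilon> \<mu> in
           real (walk_steps p) \<le> C * ((real d)\<^sup>2 / \<Upsilon>\<^sup>2 * ln (real N)) \<and>
           0 \<le> threshold p \<and> threshold p \<le> C * real N powr (- 1 / 2) \<and>
           0 < precision p \<and> precision p \<le> C * real N powr (- 1 / 2 - \<mu>) \<and>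
           0 < confidence p \<and> confidence p < 1 \<and> confidence p \<le> C * \<epsilon> \<and>
           real (repetitions p) \<le> C / \<epsilon>))"

end

theory Submission
  imports Defs
begin

text \<open>Soundness: if a set \<open>A\<close> has a sparse cut, then the walks of length \<open>t\<close> from most of its nodes
  have not mixed, because \<open>\<parallel>P\<^sup>k v\<parallel>\<close> is log-convex in \<open>k\<close>: if it decreases by the factor
  \<open>N\<^sup>-\<^sup>\<mu>\<close> during \<open>t\<close> steps, then it already decreases by a constant factor during the first
  \<open>t / (\<mu> log N)\<close> steps. So if few starting nodes are rejected, all sparse sets are small. Cutting off
  a maximal one leaves an edge expander, and subdividing some of its edges by the nodes that were cut
  off gives a nearby expander on all nodes. Completeness is Cheeger's inequality. The flat block of
  \<open>W\<^sup>l\<close> is a Chebyshev polynomial of \<open>P\<close>, and \<open>P\<^sup>t\<close> is the average of these polynomials over the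
  position of a simple random walk; cutting off its Gaussian tail gives the norm estimator.\<close>

section \<open>Positive contractions\<close>

text \<open>The scales explain why the reject bound is \<mu> * \<Upsilon>^2 without log N. Precision
  N^(-1/2-\<mu>) bounds the squared norm of a walk distribution only up to a relative excess
  \<theta> of order N^(-\<mu>) over 1/N. Choosing k so that (1/64)^(k+1) is about \<theta>, that is
  k of order \<mu> * ln N, interpolation yields a constant contraction already after C = t / (k + 1)
  steps. As t is proportional to ln N, the logarithms cancel, and C is of order d^2 / (\<Upsilon>^2
  * \<mu>). Large sets with fewer than a constant times d / C cut edges per node are then
  impossible. The distance \<epsilon> is spent as follows: if fewer than \<epsilon> N / 8 starting
  nodes have not mixed, they cover at most half of any set of size \<epsilon> N / 4, so sparse sets
  are smaller than that; reinserting fewer than \<epsilon> N / 4 nodes at 2 d edge changes each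
  stays below \<epsilon> N d. No diagonalization is used: all estimates for the walk matrix P come
  from 0 \<le> P \<le> 1 as quadratic forms.\<close>

definition inner_on :: "'a set \<Rightarrow> ('a \<Rightarrow> real) \<Rightarrow> ('a \<Rightarrow> real) \<Rightarrow> real" where
  "inner_on I f g = (\<Sum>x\<in>I. f x * g x)"

lemma inner_on_commute: "inner_on I f g = inner_on I g f"
  by (simp add: inner_on_def mult.commute)

lemma inner_on_diff_left: "inner_on I (\<lambda>x. f x - g x) h = inner_on I f h - inner_on I g h"
  by (simp add: inner_on_def left_diff_distrib sum_subtractf)

lemma inner_on_diff_right: "inner_on I h (\<lambda>x. f x - g x) = inner_on I h f - inner_on I h g"
  by (simp add: inner_on_def right_diff_distrib sum_subtractf)

lemma L2_set_power2: "(L2_set f I)\<^sup>2 = inner_on I f f"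
  by (simp add: L2_set_def inner_on_def sum_nonneg power2_eq_square)

lemma inner_on_self_nonneg: "0 \<le> inner_on I f f"
  by (simp add: inner_on_def sum_nonneg)

text \<open>Cauchy-Schwarz.\<close>

lemma inner_on_le_L2_set: "inner_on I f g \<le> L2_set f I * L2_set g I"
proof -
  have "inner_on I f g \<le> (\<Sum>x\<in>I. \<bar>f x\<bar> * \<bar>g x\<bar>)"
    unfolding inner_on_def by (intro sum_mono) (metis abs_ge_self abs_mult)
  also have "\<dots> \<le> L2_set f I * L2_set g I"
    by (rule L2_set_mult_ineq)
  finally show ?thesis .
qed

text \<open>A self-adjoint p with 0 \<le> p \<le> 1, expressed through quadratic forms. The lower
  bound is what laziness of the walk provides.\<close>

locale positive_contraction =
  fixes I :: "'a set" and p :: "('a \<Rightarrow> real) \<Rightarrow> 'a \<Rightarrow> real"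
  assumes diff: "p (\<lambda>x. f x - g x) = (\<lambda>x. p f x - p g x)"
    and symmetric: "inner_on I (p f) g = inner_on I f (p g)"
    and nonneg: "0 \<le> inner_on I f (p f)"
    and le_id: "inner_on I f (p f) \<le> inner_on I f f"
begin

text \<open>\<open>p - p\<^sup>2 = p (1 - p) p + (1 - p) p (1 - p)\<close>.\<close>

lemma square_le: "inner_on I (p f) (p f) \<le> inner_on I f (p f)"
proof -
  let ?g = "\<lambda>x. f x - p f x"
  have "0 \<le> inner_on I ?g (p ?g)" by (rule nonneg)
  also have "inner_on I ?g (p ?g) = inner_on I f (p f) - inner_on I f (p (p f))
      - inner_on I (p f) (p f) + inner_on I (p f) (p (p f))"
    by (simp add: diff inner_on_diff_left inner_on_diff_right)
  finally show ?thesis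
    using le_id[of "p f"] symmetric[of f "p f"] by linarith
qed

lemma L2_le: "L2_set (p f) I \<le> L2_set f I"
proof -
  have "(L2_set (p f) I)\<^sup>2 \<le> (L2_set f I)\<^sup>2"
    unfolding L2_set_power2 using square_le le_id order_trans by blast
  then show ?thesis by (rule power2_le_imp_le) simp
qed

lemma funpow_L2_antimono: "m \<le> n \<Longrightarrow> L2_set ((p ^^ n) f) I \<le> L2_set ((p ^^ m) f) I"
  by (induction n rule: dec_induct) (auto intro: order_trans[OF L2_le])

lemma funpow_diff: "(p ^^ k) (\<lambda>x. f x - g x) = (\<lambda>x. (p ^^ k) f x - (p ^^ k) g x)"
  by (induction k) (auto simp: diff)

lemma funpow_symmetric: "inner_on I ((p ^^ k) f) g = inner_on I f ((p ^^ k) g)"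
  by (induction k arbitrary: g) (simp_all add: symmetric flip: funpow_swap1)

text \<open>An even power 2 j gives the squared norm of p^j f, an odd power 2 j + 1 the form of p at
  p^j f.\<close>

lemma funpow_nonneg: "0 \<le> inner_on I f ((p ^^ k) f)"
proof (cases "even k")
  case True
  then obtain j where "k = 2 * j" by (rule evenE)
  then have k: "k = j + j" by simp
  have "inner_on I f ((p ^^ k) f) = inner_on I ((p ^^ j) f) ((p ^^ j) f)"
    by (simp add: k funpow_add funpow_symmetric)
  then show ?thesis by (simp add: inner_on_self_nonneg)
next
  case False
  then obtain j where "k = 2 * j + 1" by (rule oddE)
  then have k: "k = j + Suc j" by simp
  have "inner_on I f ((p ^^ k) f) = inner_on I ((p ^^ j) f) ((p ^^ Suc j) f)"
    unfolding k by (subst funpow_add) (simp only: o_apply funpow_symmetric)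
  then show ?thesis by (simp add: nonneg)
qed

text \<open>Makes the one-step estimates available when a block of k steps is treated as a single
  step.\<close>

lemma positive_contraction_funpow: "positive_contraction I (p ^^ k)"
proof
  show "inner_on I f ((p ^^ k) f) \<le> inner_on I f f" for f
  proof -
    have "inner_on I f ((p ^^ k) f) \<le> L2_set f I * L2_set ((p ^^ k) f) I"
      by (rule inner_on_le_L2_set)
    also have "\<dots> \<le> L2_set f I * L2_set f I"
      using funpow_L2_antimono[of 0 k f] by (intro mult_left_mono) auto
    finally show ?thesis by (simp add: L2_set_power2[symmetric] power2_eq_square)
  qed
qed (simp_all add: funpow_diff funpow_symmetric funpow_nonneg)

text \<open>The decrements D j of the form of p^j telescope, and they do not increase: D j - D (j +
  1) is the form of p^j at f - p f, hence nonnegative.\<close>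

lemma form_diff_funpow_le:
  "inner_on I f f - inner_on I f ((p ^^ k) f) \<le> real k * (inner_on I f f - inner_on I f (p f))"
proof -
  define D where "D j = inner_on I f ((p ^^ j) f) - inner_on I f ((p ^^ Suc j) f)" for j
  have "D (Suc j) \<le> D j" for j
  proof -
    let ?g = "\<lambda>x. f x - p f x"
    have "0 \<le> inner_on I ?g ((p ^^ j) ?g)" by (rule funpow_nonneg)
    also have "\<dots> = inner_on I f ((p ^^ j) f) - inner_on I f ((p ^^ j) (p f))
        - inner_on I (p f) ((p ^^ j) f) + inner_on I (p f) ((p ^^ j) (p f))"
      by (simp add: funpow_diff inner_on_diff_left inner_on_diff_right)
    also have "\<dots> = D j - D (Suc j)"
      by (simp add: D_def symmetric flip: funpow_swap1)
    finally show ?thesis by simp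
  qed
  then have D: "D j \<le> D 0" for j by (induction j) (auto intro: order_trans)
  have "inner_on I f f - inner_on I f ((p ^^ k) f) = (\<Sum>j<k. D j)"
    by (induction k) (auto simp: D_def)
  also have "\<dots> \<le> (\<Sum>j<k. D 0)" using D by (intro sum_mono)
  finally show ?thesis by (simp add: D_def)
qed

text \<open>For q = p^k, q^2 \<le> q gives (1 - q)^2 = 1 - 2 q + q^2 \<le> 1 - q. Thus a function of
  small energy is almost fixed by k steps.\<close>

lemma L2_diff_funpow_le:
  "(L2_set (\<lambda>x. f x - (p ^^ k) f x) I)\<^sup>2 \<le> real k * (inner_on I f f - inner_on I f (p f))"
proof -
  interpret k: positive_contraction I "p ^^ k" by (rule positive_contraction_funpow)
  have "(L2_set (\<lambda>x. f x - (p ^^ k) f x) I)\<^sup>2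
      = inner_on I f f - 2 * inner_on I f ((p ^^ k) f) + inner_on I ((p ^^ k) f) ((p ^^ k) f)"
    unfolding L2_set_power2
    using inner_on_commute[of I "(p ^^ k) f" f] by (simp add: inner_on_diff_left inner_on_diff_right)
  also have "\<dots> \<le> inner_on I f f - inner_on I f ((p ^^ k) f)"
    using k.square_le[of f] by simp
  finally show ?thesis using form_diff_funpow_le[of f k] by linarith
qed

text \<open>The norms \<open>\<parallel>p\<^sup>k f\<parallel>\<close> are log-convex in \<open>k\<close>, since \<open>\<parallel>p\<^sup>k\<^sup>+\<^sup>1 f\<parallel>\<^sup>2 = \<langle>p\<^sup>k f, p\<^sup>k\<^sup>+\<^sup>2 f\<rangle>\<close>.\<close>

lemma L2_power_le: "L2_set (p f) I ^ Suc k \<le> L2_set f I ^ k * L2_set ((p ^^ Suc k) f) I"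
proof -
  define n where "n j = L2_set ((p ^^ j) f) I" for j
  have n0: "0 \<le> n j" for j by (simp add: n_def)
  have convex: "n (Suc j) ^ 2 \<le> n j * n (Suc (Suc j))" for j
  proof -
    have "n (Suc j) ^ 2 = inner_on I ((p ^^ j) f) ((p ^^ Suc (Suc j)) f)"
      by (simp add: n_def L2_set_power2 symmetric)
    also have "\<dots> \<le> n j * n (Suc (Suc j))"
      unfolding n_def by (rule inner_on_le_L2_set)
    finally show ?thesis .
  qed
  \<comment> \<open>The first ratio n 1 / n 0 is the smallest of all consecutive ratios; the
    multiplied form also covers vanishing norms.\<close>
  have ratio: "n 1 * n j \<le> n 0 * n (Suc j)" for j
  proof (induction j)
    case (Suc j)
    show ?case
    proof (cases "n (Suc j) = 0")
      case True then show ?thesis by (simp add: n0)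
    next
      case False
      then have pos: "0 < n (Suc j)" using n0[of "Suc j"] by linarith
      have "(n 1 * n (Suc j)) * n (Suc j) \<le> n 1 * (n j * n (Suc (Suc j)))"
        using mult_left_mono[OF convex[of j] n0[of 1]] by (simp add: power2_eq_square mult.assoc)
      also have "\<dots> \<le> (n 0 * n (Suc (Suc j))) * n (Suc j)"
        using mult_right_mono[OF Suc n0[of "Suc (Suc j)"]] by (simp add: mult_ac)
      finally show ?thesis using pos by simp
    qed
  qed simp
  have "n 1 ^ Suc k \<le> n 0 ^ k * n (Suc k)"
  proof (induction k)
    case (Suc k)
    have "n 1 ^ Suc (Suc k) \<le> n 1 * (n 0 ^ k * n (Suc k))"
      using mult_left_mono[OF Suc n0[of 1]] by simp
    also have "\<dots> \<le> n 0 ^ Suc k * n (Suc (Suc k))"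
      using mult_left_mono[OF ratio[of "Suc k"], of "n 0 ^ k"] n0[of 0] by (simp add: mult_ac)
    finally show ?case .
  qed simp
  then show ?thesis by (simp add: n_def)
qed

lemma L2_funpow_power_le:
  "L2_set ((p ^^ m) f) I ^ Suc k \<le> L2_set f I ^ k * L2_set ((p ^^ (m * Suc k)) f) I"
proof -
  interpret m: positive_contraction I "p ^^ m" by (rule positive_contraction_funpow)
  show ?thesis using m.L2_power_le[of f k] unfolding funpow_mult .
qed

end

section \<open>The lazy walk and its spectral gap\<close>

definition adj :: "nat set set \<Rightarrow> nat \<Rightarrow> nat \<Rightarrow> real" where
  "adj E u v = of_bool ({u, v} \<in> E)"

text \<open>Pairs are ordered from inside to outside, so each cut edge counts once.\<close>

definition cut :: "nat \<Rightarrow> nat set set \<Rightarrow> nat set \<Rightarrow> (nat \<times> nat) set" where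
  "cut N E S = {(u, v). u \<in> S \<and> v \<in> {..<N} - S \<and> {u, v} \<in> E}"

definition walk_step :: "nat \<Rightarrow> nat \<Rightarrow> nat set set \<Rightarrow> (nat \<Rightarrow> real) \<Rightarrow> nat \<Rightarrow> real" where
  "walk_step N d E f = (\<lambda>x. \<Sum>y<N. lazy_walk d E x y * f y)"

definition walk_dist :: "nat \<Rightarrow> nat \<Rightarrow> nat set set \<Rightarrow> nat \<Rightarrow> nat \<Rightarrow> nat \<Rightarrow> real" where
  "walk_dist N d E t s = (walk_step N d E ^^ t) (\<lambda>x. of_bool (x = s))"

lemma adj_commute: "adj E u v = adj E v u"
  by (simp add: adj_def insert_commute)

lemma adj_nonneg [simp]: "0 \<le> adj E u v"
  by (simp add: adj_def)

lemma card_cut_eq_sum: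
  assumes "S \<subseteq> {..<N}"
  shows "real (card (cut N E S)) = (\<Sum>u\<in>S. \<Sum>v\<in>{..<N} - S. adj E u v)"
proof -
  have fin: "finite S" using assms finite_subset by blast
  have "cut N E S = {x \<in> S \<times> ({..<N} - S). {fst x, snd x} \<in> E}"
    by (auto simp: cut_def)
  then have "real (card (cut N E S)) = (\<Sum>x\<in>S \<times> ({..<N} - S). adj E (fst x) (snd x))"
    using fin by (simp add: adj_def Int_def)
  also have "\<dots> = (\<Sum>u\<in>S. \<Sum>v\<in>{..<N} - S. adj E u v)"
    by (simp add: sum.cartesian_product case_prod_beta)
  finally show ?thesis .
qed

text \<open>A discrete co-area formula: subtracting from \<open>h\<close> its minimum on the support \<open>S\<close> lowers the
  right-hand side by exactly this minimum times the size of the cut of \<open>S\<close>.\<close>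

lemma sum_le_sum_positive_differences:
  fixes h :: "nat \<Rightarrow> real"
  assumes expand: "\<And>S. S \<subseteq> {..<N} \<Longrightarrow> real (card S) \<le> real N / 2 \<Longrightarrow>
      \<gamma> * real (card S) \<le> real (card (cut N E S))"
    and "\<And>x. x < N \<Longrightarrow> 0 \<le> h x"
    and "real (card {x\<in>{..<N}. h x \<noteq> 0}) \<le> real N / 2"
  shows "\<gamma> * (\<Sum>x<N. h x) \<le> (\<Sum>u<N. \<Sum>v<N. adj E u v * max 0 (h u - h v))"
  using assms(2,3)
proof (induction "card {x\<in>{..<N}. h x \<noteq> 0}" arbitrary: h rule: less_induct)
  case less
  define S where "S = {x\<in>{..<N}. h x \<noteq> 0}"
  have S: "S \<subseteq> {..<N}" "finite S" by (auto simp: S_def)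
  show ?case
  proof (cases "S = {}")
    case True
    then have "h x = 0" if "x < N" for x using that by (auto simp: S_def)
    then show ?thesis by (simp add: sum_nonneg)
  next
    case False
    define m where "m = Min (h ` S)"
    define h' where "h' x = h x - (if x \<in> S then m else 0)" for x
    have m_in: "m \<in> h ` S" unfolding m_def using False S by (intro Min_in) auto
    have m_le: "m \<le> h x" if "x \<in> S" for x unfolding m_def using that S by auto
    have m0: "0 \<le> m" using m_in less.prems(1) S by auto
    have h0: "h x = 0" if "x < N" "x \<notin> S" for x using that by (auto simp: S_def)
    have h'_nonneg: "0 \<le> h' x" if "x < N" for x
      using m_le less.prems(1)[OF that] by (auto simp: h'_def)
    obtain y where y: "y \<in> S" "h y = m" using m_in by auto
    have sub: "{x\<in>{..<N}. h' x \<noteq> 0} \<subset> S"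
    proof -
      have "{x\<in>{..<N}. h' x \<noteq> 0} \<subseteq> S" by (auto simp: h'_def S_def split: if_splits)
      moreover have "y \<notin> {x\<in>{..<N}. h' x \<noteq> 0}" using y by (auto simp: h'_def)
      ultimately show ?thesis using y by blast
    qed
    then have smaller: "card {x\<in>{..<N}. h' x \<noteq> 0} < card S" using S(2) by (rule psubset_card_mono[rotated])
    have IH: "\<gamma> * (\<Sum>x<N. h' x) \<le> (\<Sum>u<N. \<Sum>v<N. adj E u v * max 0 (h' u - h' v))"
      using less.hyps[of h'] smaller h'_nonneg less.prems(2) unfolding S_def by simp
    have sum_h: "(\<Sum>x<N. h x) = (\<Sum>x<N. h' x) + m * real (card S)"
    proof -
      have "(\<Sum>x<N. h x) = (\<Sum>x<N. h' x + (if x \<in> S then m else 0))" by (simp add: h'_def)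
      also have "\<dots> = (\<Sum>x<N. h' x) + (\<Sum>x<N. if x \<in> S then m else 0)" by (rule sum.distrib)
      also have "(\<Sum>x<N. if x \<in> S then m else 0) = m * real (card S)"
        using S by (simp add: sum.If_cases Int_absorb1)
      finally show ?thesis .
    qed
    \<comment> \<open>Only pairs leaving S change: there h v = 0 and h u \<ge> m, so the positive
      part drops by exactly m. Inside S both values drop by m, and for u outside S both positive
      parts vanish.\<close>
    have pos_part: "adj E u v * max 0 (h u - h v)
        = adj E u v * max 0 (h' u - h' v) + (if u \<in> S \<and> v \<in> {..<N} - S then m * adj E u v else 0)"
      if "u < N" "v < N" for u v
      using that h0[of u] h0[of v] m_le[of u] m_le[of v] m0
      by (auto simp: h'_def max_def algebra_simps)
    have "(\<Sum>u<N. \<Sum>v<N. adj E u v * max 0 (h u - h v))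
       = (\<Sum>u<N. \<Sum>v<N. adj E u v * max 0 (h' u - h' v)) +
         (\<Sum>u<N. \<Sum>v<N. if u \<in> S \<and> v \<in> {..<N} - S then m * adj E u v else 0)"
      by (simp add: pos_part sum.distrib)
    also have "(\<Sum>u<N. \<Sum>v<N. if u \<in> S \<and> v \<in> {..<N} - S then m * adj E u v else 0)
        = (\<Sum>u<N. if u \<in> S then (\<Sum>v<N. if v \<in> {..<N} - S then m * adj E u v else 0) else 0)"
      by (intro sum.cong refl) auto
    also have "\<dots> = (\<Sum>u\<in>S. \<Sum>v\<in>{..<N} - S. m * adj E u v)"
      using S by (simp add: Int_absorb1 sum.If_cases Diff_eq Compl_eq)
    also have "\<dots> = m * real (card (cut N E S))"
      by (simp add: card_cut_eq_sum[OF S(1)] sum_distrib_left)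
    finally have sums: "(\<Sum>u<N. \<Sum>v<N. adj E u v * max 0 (h u - h v))
       = (\<Sum>u<N. \<Sum>v<N. adj E u v * max 0 (h' u - h' v)) + m * real (card (cut N E S))" .
    have "m * (\<gamma> * real (card S)) \<le> m * real (card (cut N E S))"
      using expand[OF S(1)] less.prems(2) m0 unfolding S_def[symmetric] by (intro mult_left_mono) auto
    then show ?thesis using IH by (simp add: sum_h sums algebra_simps)
  qed
qed

text \<open>c is the least attained value exceeded on at most half of the nodes. The next smaller
  attained value b is exceeded on more than half of them, and these nodes are disjoint from those
  with value below c.\<close>

lemma median_exists:
  fixes f :: "nat \<Rightarrow> real"
  assumes "0 < N"
  obtains c where "real (card {x\<in>{..<N}. f x > c}) \<le> real N / 2"
    "real (card {x\<in>{..<N}. f x < c}) \<le> real N / 2"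
proof -
  define C where "C = {c \<in> f ` {..<N}. real (card {x\<in>{..<N}. f x > c}) \<le> real N / 2}"
  define c where "c = Min C"
  have "finite C" by (simp add: C_def)
  have "Max (f ` {..<N}) \<in> f ` {..<N}" using assms by (intro Max_in) auto
  moreover have none: "{x\<in>{..<N}. f x > Max (f ` {..<N})} = {}"
    by (auto simp: not_less intro!: Max_ge)
  ultimately have "Max (f ` {..<N}) \<in> C" unfolding C_def mem_Collect_eq none by simp
  then have cC: "c \<in> C" unfolding c_def using \<open>finite C\<close> by (intro Min_in) auto
  have "real (card {x\<in>{..<N}. f x < c}) \<le> real N / 2"
  proof (cases "{x\<in>{..<N}. f x < c} = {}")
    case True then show ?thesis unfolding True by simp
  next
    case False
    define b where "b = Max (f ` {x\<in>{..<N}. f x < c})"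
    have b_in: "b \<in> f ` {x\<in>{..<N}. f x < c}" unfolding b_def using False by (intro Max_in) auto
    have "b < c" using b_in by auto
    then have "b \<notin> C" using Min_le[OF \<open>finite C\<close>, of b] unfolding c_def by force
    then have big: "real (card {x\<in>{..<N}. f x > b}) > real N / 2"
      using b_in by (auto simp: C_def)
    have "{x\<in>{..<N}. f x < c} \<inter> {x\<in>{..<N}. f x > b} = {}"
    proof -
      have "f x \<le> b" if "x < N" "f x < c" for x
        unfolding b_def using that by (intro Max_ge) auto
      then show ?thesis by force
    qed
    then have "card {x\<in>{..<N}. f x < c} + card {x\<in>{..<N}. f x > b}
       = card ({x\<in>{..<N}. f x < c} \<union> {x\<in>{..<N}. f x > b})"
      by (intro card_Un_disjoint[symmetric]) auto
    also have "\<dots> \<le> card {..<N}" by (intro card_mono) auto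
    finally show ?thesis using big by simp
  qed
  then show ?thesis using cC that unfolding C_def by blast
qed

section \<open>The walk operator, its Dirichlet form and Cheeger's inequality\<close>

locale bounded_degree_graph =
  fixes N d :: nat and E :: "nat set set"
  assumes graph: "bounded_graph N d E" and d_pos: "0 < d"
begin

lemma edgeD: "{u, v} \<in> E \<Longrightarrow> u < N \<and> v < N \<and> u \<noteq> v"
  using graph unfolding bounded_graph_def by (force simp: card_insert_if split: if_splits)

lemma no_loop [simp]: "{v} \<notin> E"
  using edgeD[of v v] by auto

lemma neighbors_subset: "neighbors E v \<subseteq> {..<N}"
  using edgeD by (auto simp: neighbors_def)

lemma sum_adj: "(\<Sum>w<N. adj E v w) = real (node_degree E v)"
proof -
  have "{..<N} \<inter> {w. {v, w} \<in> E} = neighbors E v"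
    using edgeD by (auto simp: neighbors_def)
  then show ?thesis by (simp add: adj_def node_degree_def)
qed

lemma degree_le: "node_degree E v \<le> d"
proof (cases "v < N")
  case True then show ?thesis using graph by (simp add: bounded_graph_def)
next
  case False
  then have "neighbors E v = {}" using edgeD by (auto simp: neighbors_def)
  then show ?thesis by (simp add: node_degree_def)
qed

lemma lazy_walk_eq:
  "lazy_walk d E u v = of_bool (u = v) * (1 - real (node_degree E v) / (2 * real d)) + adj E u v / (2 * real d)"
  by (auto simp: lazy_walk_def adj_def insert_commute)

lemma lazy_walk_nonneg: "0 \<le> lazy_walk d E u v"
proof -
  have "real (node_degree E v) \<le> 2 * real d" using degree_le[of v] by simp
  then show ?thesis using d_pos by (auto simp: lazy_walk_def field_simps)
qed

lemma lazy_walk_commute: "lazy_walk d E u v = lazy_walk d E v u"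
  by (auto simp: lazy_walk_def insert_commute)

text \<open>The identity minus the graph Laplacian divided by 2 d.\<close>

lemma walk_step_eq:
  assumes "x < N"
  shows "walk_step N d E f x
    = f x - (real (node_degree E x) * f x - (\<Sum>y<N. adj E x y * f y)) / (2 * real d)"
proof -
  have "walk_step N d E f x = (\<Sum>y<N. of_bool (y = x) * ((1 - real (node_degree E y) / (2 * real d)) * f y))
      + (\<Sum>y<N. adj E x y * f y / (2 * real d))"
    unfolding walk_step_def lazy_walk_eq sum.distrib[symmetric]
    by (intro sum.cong) (auto simp: algebra_simps)
  also have "(\<Sum>y<N. of_bool (y = x) * ((1 - real (node_degree E y) / (2 * real d)) * f y))
      = (1 - real (node_degree E x) / (2 * real d)) * f x"
  proof -
    have "{..<N} \<inter> {y. y = x} = {x}" using assms by auto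
    then show ?thesis by (simp add: sum_of_bool_mult_eq)
  qed
  finally show ?thesis by (simp add: sum_divide_distrib[symmetric] algebra_simps diff_divide_distrib)
qed

lemma walk_step_symmetric:
  "inner_on {..<N} (walk_step N d E f) g = inner_on {..<N} f (walk_step N d E g)"
proof -
  have "inner_on {..<N} (walk_step N d E f) g = (\<Sum>x<N. \<Sum>y<N. lazy_walk d E x y * f y * g x)"
    by (simp add: inner_on_def walk_step_def sum_distrib_right)
  also have "\<dots> = (\<Sum>y<N. \<Sum>x<N. lazy_walk d E x y * f y * g x)" by (rule sum.swap)
  also have "\<dots> = inner_on {..<N} f (walk_step N d E g)"
    by (simp add: inner_on_def walk_step_def sum_distrib_left mult_ac lazy_walk_commute)
  finally show ?thesis .
qed

lemma sum_degree_squares: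
  "(\<Sum>u<N. \<Sum>v<N. adj E u v * ((f u)\<^sup>2 + (f v)\<^sup>2)) = 2 * (\<Sum>u<N. real (node_degree E u) * (f u)\<^sup>2)"
proof -
  have "(\<Sum>u<N. \<Sum>v<N. adj E u v * (f v)\<^sup>2) = (\<Sum>v<N. \<Sum>u<N. adj E v u * (f v)\<^sup>2)"
    by (subst sum.swap) (simp add: adj_commute)
  then show ?thesis
    by (simp add: distrib_left sum.distrib sum_distrib_right[symmetric] sum_adj)
qed

lemma sum_degree_squares_le:
  "(\<Sum>u<N. \<Sum>v<N. adj E u v * ((f u)\<^sup>2 + (f v)\<^sup>2)) \<le> 2 * real d * inner_on {..<N} f f"
proof -
  have "(\<Sum>u<N. real (node_degree E u) * (f u)\<^sup>2) \<le> (\<Sum>u<N. real d * (f u)\<^sup>2)"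
    using degree_le by (intro sum_mono mult_right_mono) auto
  also have "\<dots> = real d * inner_on {..<N} f f"
    by (simp add: inner_on_def power2_eq_square sum_distrib_left)
  finally show ?thesis unfolding sum_degree_squares by simp
qed

text \<open>The Dirichlet form of the walk. The sum runs over ordered pairs and counts each edge
  twice, which turns 2 d into 4 d.\<close>

lemma walk_energy:
  "inner_on {..<N} f f - inner_on {..<N} f (walk_step N d E f)
    = (\<Sum>u<N. \<Sum>v<N. adj E u v * (f u - f v)\<^sup>2) / (4 * real d)"
proof -
  have "inner_on {..<N} f f - inner_on {..<N} f (walk_step N d E f)
      = (\<Sum>x<N. f x * (f x - walk_step N d E f x))"
    by (simp add: inner_on_def right_diff_distrib sum_subtractf)
  also have "\<dots> = (\<Sum>x<N. (real (node_degree E x) * (f x)\<^sup>2 - (\<Sum>y<N. adj E x y * (f x * f y))) / (2 * real d))"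
    by (intro sum.cong refl)
      (simp add: walk_step_eq power2_eq_square sum_distrib_left right_diff_distrib mult_ac)
  also have "\<dots> = ((\<Sum>x<N. real (node_degree E x) * (f x)\<^sup>2)
      - (\<Sum>x<N. \<Sum>y<N. adj E x y * (f x * f y))) / (2 * real d)"
    by (simp add: sum_divide_distrib sum_subtractf diff_divide_distrib)
  also have "\<dots> = (\<Sum>u<N. \<Sum>v<N. adj E u v * ((f u)\<^sup>2 + (f v)\<^sup>2) - 2 * (adj E u v * (f u * f v))) / (4 * real d)"
    using d_pos unfolding sum_subtractf sum_distrib_left[symmetric] sum_degree_squares
    by (simp add: field_simps)
  also have "\<dots> = (\<Sum>u<N. \<Sum>v<N. adj E u v * (f u - f v)\<^sup>2) / (4 * real d)"
    by (simp add: power2_eq_square algebra_simps)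
  finally show ?thesis .
qed

text \<open>The energy is nonnegative, and (a - b)^2 \<le> 2 (a^2 + b^2) with degrees at most d
  bounds it by the squared norm of f. The latter is positivity, and it relies on the holding
  probability of at least 1/2.\<close>

sublocale walk: positive_contraction "{..<N}" "walk_step N d E"
proof
  show "walk_step N d E (\<lambda>x. f x - g x) = (\<lambda>x. walk_step N d E f x - walk_step N d E g x)" for f g
    by (simp add: walk_step_def right_diff_distrib sum_subtractf)
  show "inner_on {..<N} (walk_step N d E f) g = inner_on {..<N} f (walk_step N d E g)" for f g
    by (rule walk_step_symmetric)
  have energy_nonneg: "0 \<le> (\<Sum>u<N. \<Sum>v<N. adj E u v * (f u - f v)\<^sup>2)" for f
    by (intro sum_nonneg) simp
  show "inner_on {..<N} f (walk_step N d E f) \<le> inner_on {..<N} f f" for f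
    using walk_energy[of f] energy_nonneg[of f] d_pos
    by (smt (verit) divide_nonneg_nonneg of_nat_0_le_iff)
  show "0 \<le> inner_on {..<N} f (walk_step N d E f)" for f
  proof -
    have "(\<Sum>u<N. \<Sum>v<N. adj E u v * (f u - f v)\<^sup>2)
        \<le> (\<Sum>u<N. \<Sum>v<N. 2 * (adj E u v * ((f u)\<^sup>2 + (f v)\<^sup>2)))"
    proof (intro sum_mono)
      fix u v
      have "(f u - f v)\<^sup>2 \<le> 2 * ((f u)\<^sup>2 + (f v)\<^sup>2)"
        using zero_le_power2[of "f u + f v"] by (simp add: power2_eq_square algebra_simps)
      then show "adj E u v * (f u - f v)\<^sup>2 \<le> 2 * (adj E u v * ((f u)\<^sup>2 + (f v)\<^sup>2))"
        by (metis mult.left_commute mult_left_mono adj_nonneg)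
    qed
    also have "\<dots> \<le> 4 * real d * inner_on {..<N} f f"
      using sum_degree_squares_le[of f] by (simp add: sum_distrib_left[symmetric])
    finally have "(\<Sum>u<N. \<Sum>v<N. adj E u v * (f u - f v)\<^sup>2) / (4 * real d) \<le> inner_on {..<N} f f"
      using d_pos by (simp add: divide_le_eq mult_ac)
    then show ?thesis using walk_energy[of f] by linarith
  qed
qed

lemma walk_step_const: "x < N \<Longrightarrow> walk_step N d E (\<lambda>_. c) x = c"
  by (simp add: walk_step_eq sum_distrib_right[symmetric] sum_adj)

lemma walk_step_cong: "(\<And>y. y < N \<Longrightarrow> f y = g y) \<Longrightarrow> walk_step N d E f = walk_step N d E g"
  by (simp add: walk_step_def)

lemma walk_funpow_const: "x < N \<Longrightarrow> (walk_step N d E ^^ t) (\<lambda>_. c) x = c"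
proof (induction t arbitrary: x)
  case (Suc t)
  then show ?case
    using walk_step_cong[of "(walk_step N d E ^^ t) (\<lambda>_. c)" "\<lambda>_. c"] walk_step_const by simp
qed simp

lemma sum_walk_funpow: "(\<Sum>x<N. (walk_step N d E ^^ t) f x) = (\<Sum>x<N. f x)"
  using walk.funpow_symmetric[of t f "\<lambda>_. 1"] by (simp add: inner_on_def walk_funpow_const)

text \<open>Subtracting a median splits f into two nonnegative parts with supports of size at most N
  / 2. The co-area inequality is applied to the square of each part g, and |g u^2 - g v^2| = |g u -
  g v| * (g u + g v) is bounded by Cauchy-Schwarz over all ordered pairs. The factor with the sums
  costs 4 d times the squared norm, which gives \<gamma>^2 ||g||^2 \<le> d *
  \<open>en g\<close>.\<close>

lemma cheeger:
  assumes expand: "\<And>S. S \<subseteq> {..<N} \<Longrightarrow> real (card S) \<le> real N / 2 \<Longrightarrow>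
      \<gamma> * real (card S) \<le> real (card (cut N E S))"
    and \<gamma>: "0 \<le> \<gamma>" and f: "(\<Sum>x<N. f x) = 0"
  shows "inner_on {..<N} f (walk_step N d E f) \<le> (1 - \<gamma>\<^sup>2 / (4 * (real d)\<^sup>2)) * inner_on {..<N} f f"
proof (cases "N = 0")
  case True then show ?thesis by (simp add: inner_on_def)
next
  case False
  define en where "en g = (\<Sum>u<N. \<Sum>v<N. adj E u v * (g u - g v)\<^sup>2)" for g
  have part: "\<gamma>\<^sup>2 * inner_on {..<N} g g \<le> real d * en g"
    if g: "\<And>x. 0 \<le> g x" "real (card {x\<in>{..<N}. g x \<noteq> 0}) \<le> real N / 2" for g
  proof -
    define A where "A = {..<N} \<times> {..<N}"
    define a where "a x = sqrt (adj E (fst x) (snd x)) * \<bar>g (fst x) - g (snd x)\<bar>" for x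
    define b where "b x = sqrt (adj E (fst x) (snd x)) * (g (fst x) + g (snd x))" for x
    define T where "T = (\<Sum>u<N. \<Sum>v<N. adj E u v * max 0 ((g u)\<^sup>2 - (g v)\<^sup>2))"
    have "\<gamma> * inner_on {..<N} g g \<le> T"
      using sum_le_sum_positive_differences[OF expand, of "\<lambda>x. (g x)\<^sup>2"] g(2)
      by (simp add: T_def inner_on_def power2_eq_square)
    also have "T = inner_on A a b / 2"
    proof -
      \<comment> \<open>Adding the sum with u and v exchanged turns positive parts into absolute
        values.\<close>
      have "T = (\<Sum>u<N. \<Sum>v<N. adj E u v * max 0 ((g v)\<^sup>2 - (g u)\<^sup>2))"
        unfolding T_def by (subst sum.swap) (simp add: adj_commute)
      then have "2 * T = (\<Sum>u<N. \<Sum>v<N. adj E u v * max 0 ((g u)\<^sup>2 - (g v)\<^sup>2)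
          + adj E u v * max 0 ((g v)\<^sup>2 - (g u)\<^sup>2))"
        unfolding sum.distrib by (simp add: T_def)
      also have "\<dots> = (\<Sum>u<N. \<Sum>v<N. a (u, v) * b (u, v))"
      proof (intro sum.cong refl)
        fix u v
        have "max 0 ((g u)\<^sup>2 - (g v)\<^sup>2) + max 0 ((g v)\<^sup>2 - (g u)\<^sup>2) = \<bar>(g u)\<^sup>2 - (g v)\<^sup>2\<bar>"
          by simp
        also have "\<dots> = \<bar>g u - g v\<bar> * (g u + g v)"
          using g(1)[of u] g(1)[of v] by (simp add: power2_eq_square square_diff_square_factored abs_mult mult.commute)
        finally show "adj E u v * max 0 ((g u)\<^sup>2 - (g v)\<^sup>2) + adj E u v * max 0 ((g v)\<^sup>2 - (g u)\<^sup>2)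
            = a (u, v) * b (u, v)"
          by (simp add: a_def b_def adj_def flip: distrib_left)
      qed
      also have "\<dots> = inner_on A a b"
        by (simp add: inner_on_def A_def sum.cartesian_product case_prod_beta)
      finally show ?thesis by simp
    qed
    finally have "2 * (\<gamma> * inner_on {..<N} g g) \<le> L2_set a A * L2_set b A"
      using inner_on_le_L2_set[of A a b] by simp
    then have "(2 * (\<gamma> * inner_on {..<N} g g))\<^sup>2 \<le> (L2_set a A * L2_set b A)\<^sup>2"
      by (intro power_mono) (auto simp: \<gamma> inner_on_self_nonneg)
    also have "\<dots> = inner_on A a a * inner_on A b b"
      by (simp add: power_mult_distrib L2_set_power2)
    also have "inner_on A a a = en g"
    proof -
      have "a x * a x = adj E (fst x) (snd x) * (g (fst x) - g (snd x))\<^sup>2" for x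
        by (simp add: a_def adj_def power2_eq_square)
      then show ?thesis by (simp add: inner_on_def A_def en_def sum.cartesian_product case_prod_beta)
    qed
    also have "inner_on A b b = (\<Sum>u<N. \<Sum>v<N. adj E u v * (g u + g v)\<^sup>2)"
      by (simp add: inner_on_def A_def b_def sum.cartesian_product case_prod_beta power2_eq_square mult_ac
          adj_def)
    also have "en g * (\<Sum>u<N. \<Sum>v<N. adj E u v * (g u + g v)\<^sup>2) \<le> en g * (4 * real d * inner_on {..<N} g g)"
    proof (intro mult_left_mono)
      have "(\<Sum>u<N. \<Sum>v<N. adj E u v * (g u + g v)\<^sup>2) \<le> (\<Sum>u<N. \<Sum>v<N. 2 * (adj E u v * ((g u)\<^sup>2 + (g v)\<^sup>2)))"
      proof (intro sum_mono)
        fix u v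
        have "(g u + g v)\<^sup>2 \<le> 2 * ((g u)\<^sup>2 + (g v)\<^sup>2)"
          using zero_le_power2[of "g u - g v"] by (simp add: power2_eq_square algebra_simps)
        then show "adj E u v * (g u + g v)\<^sup>2 \<le> 2 * (adj E u v * ((g u)\<^sup>2 + (g v)\<^sup>2))"
          by (metis mult.left_commute mult_left_mono adj_nonneg)
      qed
      then show "(\<Sum>u<N. \<Sum>v<N. adj E u v * (g u + g v)\<^sup>2) \<le> 4 * real d * inner_on {..<N} g g"
        using sum_degree_squares_le[of g] by (simp add: sum_distrib_left[symmetric])
    qed (simp add: en_def sum_nonneg)
    finally have *: "4 * (\<gamma>\<^sup>2 * inner_on {..<N} g g) * inner_on {..<N} g g
        \<le> 4 * (real d * en g) * inner_on {..<N} g g"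
      by (simp add: power2_eq_square mult_ac)
    show ?thesis
    proof (cases "inner_on {..<N} g g = 0")
      case True then show ?thesis by (simp add: en_def sum_nonneg)
    next
      case False
      then have "0 < inner_on {..<N} g g" using inner_on_self_nonneg[of "{..<N}" g] by linarith
      then show ?thesis using * by simp
    qed
  qed
  obtain c where c: "real (card {x\<in>{..<N}. f x > c}) \<le> real N / 2"
      "real (card {x\<in>{..<N}. f x < c}) \<le> real N / 2"
    using median_exists False by blast
  define g1 where "g1 x = max 0 (f x - c)" for x
  define g2 where "g2 x = max 0 (c - f x)" for x
  have supp: "{x\<in>{..<N}. g1 x \<noteq> 0} = {x\<in>{..<N}. f x > c}" "{x\<in>{..<N}. g2 x \<noteq> 0} = {x\<in>{..<N}. f x < c}"
    by (auto simp: g1_def g2_def max_def)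
  \<comment> \<open>Since f sums to zero, subtracting the constant c can only increase its
    norm.\<close>
  have "inner_on {..<N} f f \<le> inner_on {..<N} f f + real N * c\<^sup>2" by simp
  also have "\<dots> = (\<Sum>x<N. f x * f x - 2 * c * f x + c\<^sup>2)"
    using f by (simp add: inner_on_def sum.distrib sum_subtractf sum_distrib_left[symmetric])
  also have "\<dots> = inner_on {..<N} g1 g1 + inner_on {..<N} g2 g2"
    unfolding inner_on_def sum.distrib[symmetric]
    by (intro sum.cong refl) (auto simp: g1_def g2_def max_def power2_eq_square algebra_simps)
  finally have "\<gamma>\<^sup>2 * inner_on {..<N} f f \<le> \<gamma>\<^sup>2 * inner_on {..<N} g1 g1 + \<gamma>\<^sup>2 * inner_on {..<N} g2 g2"
    by (metis distrib_left mult_left_mono zero_le_power2)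
  also have "\<dots> \<le> real d * (en g1 + en g2)"
  proof -
    have "0 \<le> g1 x" "0 \<le> g2 x" for x by (simp_all add: g1_def g2_def)
    then show ?thesis using part[of g1] part[of g2] c unfolding supp by (simp add: distrib_left)
  qed
  also have "\<dots> \<le> real d * en f"
  proof (rule mult_left_mono)
    have "en g1 + en g2 = (\<Sum>u<N. \<Sum>v<N. adj E u v * ((g1 u - g1 v)\<^sup>2 + (g2 u - g2 v)\<^sup>2))"
      by (simp add: en_def sum.distrib distrib_left)
    also have "\<dots> \<le> en f"
      unfolding en_def
    proof (intro sum_mono mult_left_mono)
      fix u v
      \<comment> \<open>\<open>g1\<close> increases and \<open>g2\<close> decreases with the value
        of f, so their differences have opposite signs, and the cross term in the square of f u - f
        v is nonnegative.\<close>
      have "(g1 u - g1 v) * (g2 u - g2 v) \<le> 0"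
        by (cases "f u \<le> c"; cases "f v \<le> c")
          (auto simp: g1_def g2_def max_def mult_nonneg_nonpos mult_nonpos_nonneg)
      moreover have "f u - f v = (g1 u - g1 v) - (g2 u - g2 v)"
        by (auto simp: g1_def g2_def max_def)
      ultimately show "(g1 u - g1 v)\<^sup>2 + (g2 u - g2 v)\<^sup>2 \<le> (f u - f v)\<^sup>2"
        by (simp only: power2_diff)
    qed simp
    finally show "en g1 + en g2 \<le> en f" .
  qed simp
  finally have "\<gamma>\<^sup>2 / (4 * (real d)\<^sup>2) * inner_on {..<N} f f \<le> en f / (4 * real d)"
    using d_pos by (simp add: field_simps power2_eq_square)
  then show ?thesis using walk_energy[of f] by (simp add: en_def left_diff_distrib)
qed

text \<open>Pythagoras: the walk fixes the uniform distribution and keeps the centered part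
  orthogonal to constants.\<close>

lemma walk_dist_norm:
  assumes "s < N"
  shows "(L2_set (walk_dist N d E t s) {..<N})\<^sup>2
    = (L2_set ((walk_step N d E ^^ t) (\<lambda>x. of_bool (x = s) - 1 / real N)) {..<N})\<^sup>2 + 1 / real N"
proof -
  define g where "g = (walk_step N d E ^^ t) (\<lambda>x. of_bool (x = s) - 1 / real N)"
  have [simp]: "{..<N} \<inter> {x. x = s} = {s}" using assms by auto
  have eq: "walk_dist N d E t s x = g x + 1 / real N" if "x < N" for x
    using that by (simp add: walk_dist_def g_def walk.funpow_diff walk_funpow_const)
  have "(\<Sum>x<N. g x) = 0"
    using assms by (simp add: g_def sum_walk_funpow sum_subtractf)
  have "inner_on {..<N} (\<lambda>x. g x + 1 / real N) (\<lambda>x. g x + 1 / real N)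
      = (\<Sum>x<N. g x * g x + 2 / real N * g x + 1 / real N * (1 / real N))"
    unfolding inner_on_def by (intro sum.cong refl) (simp add: algebra_simps)
  also have "\<dots> = inner_on {..<N} g g + 1 / real N"
    using assms \<open>(\<Sum>x<N. g x) = 0\<close>
    unfolding sum.distrib sum_distrib_left[symmetric] by (simp add: inner_on_def)
  finally have "inner_on {..<N} (\<lambda>x. g x + 1 / real N) (\<lambda>x. g x + 1 / real N) = inner_on {..<N} g g + 1 / real N" .
  moreover have "inner_on {..<N} (walk_dist N d E t s) (walk_dist N d E t s)
      = inner_on {..<N} (\<lambda>x. g x + 1 / real N) (\<lambda>x. g x + 1 / real N)"
    unfolding inner_on_def using eq by (intro sum.cong) auto
  ultimately show ?thesis by (simp add: L2_set_power2 g_def)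
qed

text \<open>By p^2 \<le> p, the squared norm of p g is at most the form of p at g, so each step
  gains a factor \<rho> on the squared norm.\<close>

lemma L2_funpow_le_of_gap:
  assumes gap: "\<And>f. (\<Sum>x<N. f x) = 0 \<Longrightarrow>
      inner_on {..<N} f (walk_step N d E f) \<le> \<rho> * inner_on {..<N} f f"
    and "0 \<le> \<rho>" "(\<Sum>x<N. f x) = 0"
  shows "(L2_set ((walk_step N d E ^^ t) f) {..<N})\<^sup>2 \<le> \<rho> ^ t * (L2_set f {..<N})\<^sup>2"
proof (induction t)
  case (Suc t)
  let ?g = "(walk_step N d E ^^ t) f"
  have "(L2_set (walk_step N d E ?g) {..<N})\<^sup>2 \<le> inner_on {..<N} ?g (walk_step N d E ?g)"
    unfolding L2_set_power2 by (rule walk.square_le)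
  also have "\<dots> \<le> \<rho> * (L2_set ?g {..<N})\<^sup>2"
    unfolding L2_set_power2 using assms by (intro gap) (simp add: sum_walk_funpow)
  also have "\<dots> \<le> \<rho> * (\<rho> ^ t * (L2_set f {..<N})\<^sup>2)"
    using Suc assms by (intro mult_left_mono) auto
  finally show ?case by (simp add: mult_ac)
qed simp

text \<open>Each boundary node is the outer end of some cut pair, so vertex expansion bounds edge
  cuts from below.\<close>

lemma expansion_cut:
  assumes "ereal \<gamma> \<le> expansion N E" "S \<subseteq> {..<N}" "real (card S) \<le> real N / 2"
  shows "\<gamma> * real (card S) \<le> real (card (cut N E S))"
proof (cases "S = {}")
  case False
  have fin: "finite S" using assms finite_subset by blast
  have "ereal \<gamma> \<le> ereal (real (card (boundary N E S)) / real (card S))"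
    using assms False unfolding expansion_def le_INF_iff by blast
  then have "\<gamma> * real (card S) \<le> real (card (boundary N E S))"
    using False fin by (simp add: pos_le_divide_eq card_gt_0_iff)
  also have "card (boundary N E S) \<le> card (cut N E S)"
  proof -
    have "boundary N E S \<subseteq> snd ` cut N E S" by (force simp: boundary_def cut_def)
    moreover have "cut N E S \<subseteq> S \<times> {..<N}" by (auto simp: cut_def)
    then have "finite (cut N E S)" using fin finite_subset by blast
    ultimately show ?thesis by (meson card_image_le card_mono finite_imageI order_trans)
  qed
  finally show ?thesis by simp
qed simp

lemma expander_walk_dist_norm:
  assumes "ereal \<gamma> \<le> expansion N E" "0 \<le> \<gamma>" "\<gamma> \<le> 2 * real d" "s < N"
  shows "(L2_set (walk_dist N d E t s) {..<N})\<^sup>2 \<le> 1 / real N + (1 - \<gamma>\<^sup>2 / (4 * (real d)\<^sup>2)) ^ t"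
proof -
  define \<rho> where "\<rho> = 1 - \<gamma>\<^sup>2 / (4 * (real d)\<^sup>2)"
  define f where "f x = of_bool (x = s) - 1 / real N" for x
  have [simp]: "{..<N} \<inter> {x. x = s} = {s}" using assms by auto
  have "\<gamma>\<^sup>2 \<le> (2 * real d)\<^sup>2" using assms by (intro power_mono) auto
  then have \<rho>: "0 \<le> \<rho>" using d_pos by (simp add: \<rho>_def power_mult_distrib)
  have "(L2_set ((walk_step N d E ^^ t) f) {..<N})\<^sup>2 \<le> \<rho> ^ t * (L2_set f {..<N})\<^sup>2"
  proof (rule L2_funpow_le_of_gap)
    show "(\<Sum>x<N. f x) = 0" using assms by (simp add: f_def sum_subtractf)
    show "inner_on {..<N} g (walk_step N d E g) \<le> \<rho> * inner_on {..<N} g g" if "(\<Sum>x<N. g x) = 0" for g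
      unfolding \<rho>_def by (rule cheeger[OF expansion_cut[OF assms(1)] assms(2) that])
  qed (rule \<rho>)
  also have "\<dots> \<le> \<rho> ^ t * 1"
  proof (rule mult_left_mono)
    have "1 = (L2_set f {..<N})\<^sup>2 + 1 / real N"
      using walk_dist_norm[OF assms(4), of 0] assms(4)
      by (simp add: walk_dist_def f_def[abs_def] L2_set_power2 inner_on_def Int_absorb1)
    then show "(L2_set f {..<N})\<^sup>2 \<le> 1" by (smt (verit) divide_nonneg_nonneg of_nat_0_le_iff)
  qed (simp add: \<rho>)
  finally show ?thesis using walk_dist_norm[OF assms(4), of t] by (simp add: f_def[abs_def] \<rho>_def)
qed

end

section \<open>Mixing walks exclude sparse cuts\<close>

lemma L2_set_sum_le: "L2_set (\<lambda>x. \<Sum>s\<in>B. g s x) I \<le> (\<Sum>s\<in>B. L2_set (g s) I)"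
proof (induction B rule: infinite_finite_induct)
  case (insert s B)
  then show ?case
    using L2_set_triangle_ineq[of "g s" "\<lambda>x. \<Sum>s\<in>B. g s x" I] by simp
qed (simp_all add: L2_set_def)

context bounded_degree_graph
begin

lemma walk_step_sum: "walk_step N d E (\<lambda>x. \<Sum>s\<in>B. g s x) = (\<lambda>x. \<Sum>s\<in>B. walk_step N d E (g s) x)"
proof
  fix x
  have "walk_step N d E (\<lambda>x. \<Sum>s\<in>B. g s x) x = (\<Sum>y<N. \<Sum>s\<in>B. lazy_walk d E x y * g s y)"
    by (simp add: walk_step_def sum_distrib_left)
  also have "\<dots> = (\<Sum>s\<in>B. walk_step N d E (g s) x)"
    by (subst sum.swap) (simp add: walk_step_def)
  finally show "walk_step N d E (\<lambda>x. \<Sum>s\<in>B. g s x) x = (\<Sum>s\<in>B. walk_step N d E (g s) x)" .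
qed

lemma walk_funpow_sum:
  "(walk_step N d E ^^ t) (\<lambda>x. \<Sum>s\<in>B. g s x) = (\<lambda>x. \<Sum>s\<in>B. (walk_step N d E ^^ t) (g s) x)"
  by (induction t) (simp_all add: walk_step_sum)

lemma inner_on_centered_indicator:
  assumes "A \<subseteq> {..<N}"
  shows "inner_on {..<N} (\<lambda>x. of_bool (x \<in> A)) (\<lambda>x. of_bool (x \<in> B) - c) = real (card (A \<inter> B)) - c * real (card A)"
proof -
  have fin: "finite A" using assms finite_subset by blast
  have [simp]: "{..<N} \<inter> {x. x \<in> A} = A" "{..<N} \<inter> A = A" using assms by auto
  have "inner_on {..<N} (\<lambda>x. of_bool (x \<in> A)) (\<lambda>x. of_bool (x \<in> B) - c) = (\<Sum>x\<in>A. of_bool (x \<in> B) - c)"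
    by (simp add: inner_on_def sum_of_bool_mult_eq)
  also have "\<dots> = real (card (A \<inter> B)) - c * real (card A)"
    using fin by (simp add: sum_subtractf)
  finally show ?thesis .
qed

text \<open>The shift c cancels in differences, and each cut edge contributes 1 in both
  orders.\<close>

lemma indicator_energy:
  fixes c :: real
  assumes "A \<subseteq> {..<N}"
  defines "f \<equiv> \<lambda>x. of_bool (x \<in> A) - c"
  shows "inner_on {..<N} f f - inner_on {..<N} f (walk_step N d E f) = real (card (cut N E A)) / (2 * real d)"
proof -
  define T where "T = (\<Sum>u<N. \<Sum>v<N. adj E u v * of_bool (u \<in> A \<and> v \<notin> A))"
  have [simp]: "{..<N} \<inter> {x. x \<in> A} = A" "{..<N} \<inter> A = A" using assms by auto
  have [simp]: "{..<N} \<inter> {x. x \<notin> A} = {..<N} - A" by auto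
  have "(\<Sum>u<N. \<Sum>v<N. adj E u v * (f u - f v)\<^sup>2)
     = (\<Sum>u<N. \<Sum>v<N. adj E u v * of_bool (u \<in> A \<and> v \<notin> A) + adj E v u * of_bool (v \<in> A \<and> u \<notin> A))"
    by (intro sum.cong refl) (auto simp: f_def adj_commute)
  also have "\<dots> = T + (\<Sum>u<N. \<Sum>v<N. adj E v u * of_bool (v \<in> A \<and> u \<notin> A))"
    unfolding sum.distrib T_def ..
  also have "\<dots> = 2 * T"
    by (subst sum.swap) (simp add: T_def)
  also have "T = (\<Sum>u<N. of_bool (u \<in> A) * (\<Sum>v<N. of_bool (v \<notin> A) * adj E u v))"
    unfolding T_def by (intro sum.cong refl) (simp add: sum_distrib_left of_bool_conj mult_ac)
  also have "\<dots> = real (card (cut N E A))"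
    by (simp add: sum_of_bool_mult_eq card_cut_eq_sum[OF assms(1)])
  finally show ?thesis by (simp add: walk_energy)
qed

text \<open>If a set \<open>A\<close> has a sparse cut, then \<open>p\<^sup>C\<close> almost fixes its centered indicator. If the walks from
  a large part \<open>B\<close> of \<open>A\<close> mix well, then \<open>p\<^sup>C\<close> almost annihilates the centered indicator of \<open>B\<close>, by
  interpolation between the exponents \<open>0\<close> and \<open>C (k + 1)\<close>. As the two indicators overlap, both cannot
  happen.\<close>

lemma cut_large_if_walks_mix:
  assumes A: "A \<subseteq> {..<N}" "A \<noteq> {}" "real (card A) \<le> real N / 2"
    and B: "B \<subseteq> A" "card A \<le> 2 * card B"
    and mix: "\<And>s. s \<in> B \<Longrightarrow> (L2_set (walk_dist N d E t s) {..<N})\<^sup>2 \<le> 1 / real N + \<theta> / real N"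
    and \<theta>: "0 \<le> \<theta>" "\<theta> \<le> (1 / 64) ^ Suc k" and t: "t \<le> C * Suc k"
  shows "real d * real (card A) < 16 * real C * real (card (cut N E A))"
proof (rule ccontr)
  let ?P = "walk_step N d E" and ?I = "{..<N}"
  assume "\<not> real d * real (card A) < 16 * real C * real (card (cut N E A))"
  then have sparse: "16 * real C * real (card (cut N E A)) \<le> real d * real (card A)" by simp
  have finA: "finite A" using finite_subset[OF A(1)] by simp
  have finB: "finite B" using finite_subset[OF B(1) finA] .
  have "0 < card A" using A finA by (simp add: card_gt_0_iff)
  then have cB: "0 < real (card B)" using B by simp
  have BN: "B \<subseteq> ?I" using A B by auto
  have N: "0 < real N" using A by auto
  have card_BN: "real (card B) \<le> real N" using card_mono[OF _ BN] by simp
  define f where "f x = of_bool (x \<in> A) - real (card A) / real N" for x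
  define v where "v x = of_bool (x \<in> B) - real (card B) / real N" for x
  define w where "w x = (of_bool (x \<in> B) :: real)" for x :: nat
  have [simp]: "?I \<inter> {x. x \<in> A} = A" "?I \<inter> {x. x \<in> B} = B" "?I \<inter> A = A" "?I \<inter> B = B"
    using A BN by auto
  have sum_f: "(\<Sum>x<N. f x) = 0" using N by (simp add: f_def sum_subtractf)
  have norm_le: "(L2_set g ?I)\<^sup>2 \<le> real (card S)"
    if "S \<subseteq> ?I" "g = (\<lambda>x. of_bool (x \<in> S) - real (card S) / real N)" for g S
  proof -
    have [simp]: "?I \<inter> {x. x \<in> S} = S" "?I \<inter> S = S" using that by auto
    have sum_g: "(\<Sum>x<N. g x) = 0" using N by (simp add: that(2) sum_subtractf)
    have "inner_on ?I g g = inner_on ?I (\<lambda>x. of_bool (x \<in> S)) g - real (card S) / real N * (\<Sum>x<N. g x)"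
      unfolding inner_on_def sum_distrib_left sum_subtractf[symmetric]
      by (intro sum.cong refl) (simp add: that(2) left_diff_distrib)
    also have "\<dots> = inner_on ?I (\<lambda>x. of_bool (x \<in> S)) g" by (simp add: sum_g)
    also have "\<dots> \<le> real (card S)"
      unfolding that(2) inner_on_centered_indicator[OF that(1)] using N by simp
    finally show ?thesis by (simp add: L2_set_power2)
  qed
  have norm_f: "L2_set f ?I \<le> sqrt (real (card A))"
    using norm_le[OF A(1), of f] by (intro real_le_rsqrt) (simp add: f_def[abs_def])
  have norm_v: "L2_set v ?I \<le> sqrt (real (card B))"
    using norm_le[OF BN, of v] by (intro real_le_rsqrt) (simp add: v_def[abs_def])
  have norm_w: "L2_set w ?I = sqrt (real (card B))"
    by (simp add: L2_set_def w_def sum.If_cases power2_eq_square)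
  \<comment> \<open>2 \<le> (3 / 2)^2.\<close>
  have root2: "sqrt (real (card A)) \<le> 3 / 2 * sqrt (real (card B))"
    using B by (intro real_le_lsqrt) (auto simp: power_mult_distrib power2_eq_square)
  \<comment> \<open>v is the sum over s in B of the centered point masses, each of norm at most sqrt
    (\<theta> / N) after t steps. The triangle inequality gives |B| sqrt (\<theta> / N), which is at
    most sqrt |B| * sqrt \<theta> because |B| \<le> N.\<close>
  have "L2_set ((?P ^^ t) v) ?I \<le> (\<Sum>s\<in>B. L2_set ((?P ^^ t) (\<lambda>x. of_bool (x = s) - 1 / real N)) ?I)"
  proof -
    have "v = (\<lambda>x. \<Sum>s\<in>B. of_bool (x = s) - 1 / real N)"
    proof
      fix x
      have "B \<inter> {s. x = s} = (if x \<in> B then {x} else {})" by auto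
      then show "v x = (\<Sum>s\<in>B. of_bool (x = s) - 1 / real N)"
        using finB by (simp add: v_def sum_subtractf)
    qed
    then show ?thesis by (simp only: walk_funpow_sum) (rule L2_set_sum_le)
  qed
  also have "\<dots> \<le> (\<Sum>s\<in>B. sqrt (\<theta> / real N))"
  proof (rule sum_mono)
    fix s assume s: "s \<in> B"
    then show "L2_set ((?P ^^ t) (\<lambda>x. of_bool (x = s) - 1 / real N)) ?I \<le> sqrt (\<theta> / real N)"
      using mix[OF s] walk_dist_norm[of s t] BN by (intro real_le_rsqrt) auto
  qed
  also have "\<dots> = real (card B) * sqrt (\<theta> / real N)" by simp

  also have "real (card B) * sqrt (\<theta> / real N) = sqrt (real (card B)) * sqrt (real (card B) / real N) * sqrt \<theta>"
    using cB by (simp add: real_sqrt_divide real_sqrt_mult flip: real_sqrt_mult_self[of "real (card B)"])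
  also have "\<dots> \<le> sqrt (real (card B)) * 1 * sqrt ((1 / 64) ^ Suc k)"
    using \<theta> N card_BN by (intro mult_mono real_sqrt_le_mono) (auto simp: divide_le_eq)
  also have "sqrt ((1 / 64 :: real) ^ Suc k) = (1 / 8) ^ Suc k"
    by (simp add: real_sqrt_power real_sqrt_divide)
  finally have norm_Ptv: "L2_set ((?P ^^ t) v) ?I \<le> sqrt (real (card B)) * (1 / 8) ^ Suc k" by simp
  \<comment> \<open>Log-convexity with blocks of C steps: a decay by (1/8)^(k+1) over k + 1 blocks
    forces a decay by 1/8 over the first one.\<close>
  have "L2_set ((?P ^^ C) v) ?I ^ Suc k \<le> L2_set v ?I ^ k * L2_set ((?P ^^ (C * Suc k)) v) ?I"
    by (rule walk.L2_funpow_power_le)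
  also have "\<dots> \<le> sqrt (real (card B)) ^ k * (sqrt (real (card B)) * (1 / 8) ^ Suc k)"
    using norm_v order_trans[OF walk.funpow_L2_antimono[OF t] norm_Ptv]
    by (intro mult_mono power_mono) auto
  also have "\<dots> = (sqrt (real (card B)) / 8) ^ Suc k"
    by (simp add: power_divide)
  finally have "L2_set ((?P ^^ C) v) ?I ^ Suc k \<le> (sqrt (real (card B)) / 8) ^ Suc k" .
  then have norm_PCv: "L2_set ((?P ^^ C) v) ?I \<le> sqrt (real (card B)) / 8"
    by (rule power_le_imp_le_base) simp
  \<comment> \<open>P^C f sums to zero, so the indicator w may be replaced by its centered version
    v; symmetry then moves P^C to v.\<close>
  have "inner_on ?I w ((?P ^^ C) f) = inner_on ?I v ((?P ^^ C) f) + real (card B) / real N * (\<Sum>x<N. (?P ^^ C) f x)"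
    unfolding inner_on_def sum_distrib_left sum.distrib[symmetric]
    by (intro sum.cong refl) (simp add: w_def v_def left_diff_distrib)
  also have "\<dots> = inner_on ?I ((?P ^^ C) v) f"
    by (simp add: sum_walk_funpow sum_f walk.funpow_symmetric)
  also have "\<dots> \<le> sqrt (real (card B)) / 8 * (3 / 2 * sqrt (real (card B)))"
    using norm_PCv order_trans[OF norm_f root2]
    by (intro order_trans[OF inner_on_le_L2_set] mult_mono) auto
  also have "\<dots> = 3 / 16 * real (card B)" by simp
  finally have part1: "inner_on ?I w ((?P ^^ C) f) \<le> 3 / 16 * real (card B)" .
  \<comment> \<open>The factor 16 in the sparsity assumption makes this at most |A| / 32, hence at
    most |B| / 16.\<close>
  have "(L2_set (\<lambda>x. f x - (?P ^^ C) f x) ?I)\<^sup>2 \<le> real C * (real (card (cut N E A)) / (2 * real d))"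
    using walk.L2_diff_funpow_le[of f C] indicator_energy[OF A(1), of "real (card A) / real N"]
    by (simp add: f_def[abs_def])
  also have "\<dots> \<le> real (card A) / 32"
    using sparse d_pos by (simp add: field_simps)
  also have "\<dots> \<le> real (card B) / 16" using B by simp
  finally have "L2_set (\<lambda>x. f x - (?P ^^ C) f x) ?I \<le> sqrt (real (card B) / 16)"
    by (rule real_le_rsqrt)
  then have diff_le: "L2_set (\<lambda>x. f x - (?P ^^ C) f x) ?I \<le> sqrt (real (card B)) / 4"
    by (simp add: real_sqrt_divide)
  have "inner_on ?I w (\<lambda>x. f x - (?P ^^ C) f x) \<le> sqrt (real (card B)) * (sqrt (real (card B)) / 4)"
    using diff_le norm_w by (intro order_trans[OF inner_on_le_L2_set] mult_mono) auto
  then have part2: "inner_on ?I w (\<lambda>x. f x - (?P ^^ C) f x) \<le> real (card B) / 4" by simp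
  have "inner_on ?I w f = real (card B) - real (card A) / real N * real (card B)"
    using B unfolding w_def f_def inner_on_centered_indicator[OF BN] by (simp add: Int_absorb2)
  also have "\<dots> \<ge> real (card B) - 1 / 2 * real (card B)"
    using A N by (intro diff_left_mono mult_right_mono) (auto simp: divide_le_eq)
  finally have "real (card B) / 2 \<le> inner_on ?I w f" by simp
  \<comment> \<open>The contradiction is 1/2 \<le> 3/16 + 1/4, up to the common positive factor
    |B|.\<close>
  moreover have "inner_on ?I w f = inner_on ?I w ((?P ^^ C) f) + inner_on ?I w (\<lambda>x. f x - (?P ^^ C) f x)"
    by (simp add: inner_on_diff_right)
  ultimately show False using part1 part2 cB by linarith
qed

end

section \<open>Repairing a graph\<close>

lemma edge_other_endpoint:
  assumes "bounded_graph N d E" "e \<in> E" "x \<in> e"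
  obtains y where "e = {x, y}" "x \<noteq> y" "y < N"
proof -
  have e: "e \<subseteq> {..<N}" "card e = 2" using assms by (auto simp: bounded_graph_def)
  then obtain a b where "e = {a, b}" "a \<noteq> b" by (auto simp: card_2_iff)
  then show ?thesis using assms(3) e that[of a] that[of b] by (auto simp: insert_commute)
qed

lemma bounded_graph_finite: "bounded_graph N d E \<Longrightarrow> finite E"
  by (rule finite_subset[of _ "Pow {..<N}"]) (auto simp: bounded_graph_def)

lemma incident_edges_eq:
  assumes "bounded_graph N d E"
  shows "{e \<in> E. x \<in> e} = (\<lambda>w. {x, w}) ` neighbors E x"
proof
  show "{e \<in> E. x \<in> e} \<subseteq> (\<lambda>w. {x, w}) ` neighbors E x"
  proof
    fix e assume e: "e \<in> {e \<in> E. x \<in> e}"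
    then obtain y where "e = {x, y}" using edge_other_endpoint[OF assms, of e x] by blast
    then show "e \<in> (\<lambda>w. {x, w}) ` neighbors E x" using e by (auto simp: neighbors_def)
  qed
qed (auto simp: neighbors_def)

context bounded_degree_graph
begin

lemma finite_E: "finite E"
  using graph by (rule bounded_graph_finite)

lemma finite_neighbors: "finite (neighbors E x)"
  using neighbors_subset finite_subset by blast

lemma card_incident_edges_le: "card {e \<in> E. x \<in> e} \<le> d"
  unfolding incident_edges_eq[OF graph]
  using card_image_le[OF finite_neighbors, of "\<lambda>w. {x, w}" x] degree_le[of x]
  by (simp add: node_degree_def)

lemma card_UN_incident_le:
  assumes "finite X" "F \<subseteq> (\<Union>x\<in>X. {e \<in> E. x \<in> e})"
  shows "card F \<le> d * card X"
proof -
  have "card F \<le> card (\<Union>x\<in>X. {e \<in> E. x \<in> e})"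
    using assms finite_E by (intro card_mono) auto
  also have "\<dots> \<le> (\<Sum>x\<in>X. card {e \<in> E. x \<in> e})" using assms by (intro card_UN_le)
  also have "\<dots> \<le> (\<Sum>x\<in>X. d)" by (intro sum_mono card_incident_edges_le)
  finally show ?thesis by (simp add: mult.commute)
qed

lemma finite_cut: "finite (cut N E S)"
  by (rule finite_subset[of _ "{..<N} \<times> {..<N}"]) (auto simp: cut_def dest: edgeD)

lemma card_cut_complement:
  assumes "S \<subseteq> {..<N}"
  shows "card (cut N E ({..<N} - S)) = card (cut N E S)"
proof -
  have "cut N E ({..<N} - S) = prod.swap ` cut N E S"
    using assms by (force simp: cut_def insert_commute)
  then show ?thesis by (simp add: card_image)
qed

text \<open>\<open>A\<close> is a largest set with a sparse cut.\<close>

lemma edge_expanding_part: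
  assumes \<alpha>: "0 < \<alpha>" and N: "0 < N"
    and small: "\<And>S. S \<subseteq> {..<N} \<Longrightarrow> S \<noteq> {} \<Longrightarrow> real (card S) \<le> real N / 2 \<Longrightarrow>
      real (card (cut N E S)) \<le> \<alpha> * real (card S) \<Longrightarrow> real (card S) < b"
    and b: "0 < b" "b \<le> real N / 4"
  obtains A where "A \<subseteq> {..<N}" "real (card A) < b"
    "\<And>S. S \<subseteq> {..<N} - A \<Longrightarrow> S \<noteq> {} \<Longrightarrow> 2 * card S \<le> card ({..<N} - A) \<Longrightarrow>
      \<alpha> / 2 * real (card S) < real (card {(u, v). u \<in> S \<and> v \<in> {..<N} - A - S \<and> {u, v} \<in> E})"
proof -
  \<comment> \<open>The ratio is \<alpha> / 2, while \<open>small\<close> tolerates \<alpha>; this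
    slack is spent when passing to the complement of A and S.\<close>
  define \<S> where "\<S> = {S. S \<subseteq> {..<N} \<and> real (card S) \<le> real N / 2
      \<and> real (card (cut N E S)) \<le> \<alpha> / 2 * real (card S)}"
  have "finite \<S>" by (rule finite_subset[of _ "Pow {..<N}"]) (auto simp: \<S>_def)
  moreover have "{} \<in> \<S>" by (simp add: \<S>_def cut_def)
  ultimately obtain A where A: "A \<in> \<S>" and A_max: "\<And>S. S \<in> \<S> \<Longrightarrow> card S \<le> card A"
    using finite_imageI[of \<S> card] Max_in[of "card ` \<S>"] Max_ge[of "card ` \<S>"]
    by (metis (no_types, lifting) empty_iff image_iff image_is_empty)
  have AN: "A \<subseteq> {..<N}" and finA: "finite A" using A finite_subset by (auto simp: \<S>_def)
  have small_A: "real (card A) < b"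
  proof (cases "A = {}")
    case True then show ?thesis using b by simp
  next
    case False
    have "\<alpha> / 2 * real (card A) \<le> \<alpha> * real (card A)" using \<alpha> by (intro mult_right_mono) auto
    then show ?thesis using A False by (intro small) (auto simp: \<S>_def)
  qed
  have "\<alpha> / 2 * real (card S) < real (card {(u, v). u \<in> S \<and> v \<in> {..<N} - A - S \<and> {u, v} \<in> E})"
    if S: "S \<subseteq> {..<N} - A" "S \<noteq> {}" "2 * card S \<le> card ({..<N} - A)" for S
  proof (rule ccontr)
    let ?F = "{(u, v). u \<in> S \<and> v \<in> {..<N} - A - S \<and> {u, v} \<in> E}"
    assume "\<not> \<alpha> / 2 * real (card S) < real (card ?F)"
    then have F: "real (card ?F) \<le> \<alpha> / 2 * real (card S)" by simp
    have finS: "finite S" using S finite_subset by blast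
    have AS: "A \<union> S \<subseteq> {..<N}" using AN S by auto
    have card_AS: "card (A \<union> S) = card A + card S" using S finA finS by (intro card_Un_disjoint) auto
    have card_V: "card ({..<N} - A) = N - card A" using AN finA by (simp add: card_Diff_subset)
    have cA: "card A \<le> N" using card_mono[OF _ AN] by simp
    have "?F \<subseteq> {..<N} \<times> {..<N}" using S by auto
    then have "finite ?F" by (rule finite_subset) simp
    \<comment> \<open>A pair leaving the union either leaves A or runs from S into the rest, so the
      union inherits the ratio \<alpha> / 2.\<close>
    then have "card (cut N E (A \<union> S)) \<le> card (cut N E A \<union> ?F)"
      using finite_cut by (intro card_mono) (auto simp: cut_def)
    also have "\<dots> \<le> card (cut N E A) + card ?F" by (rule card_Un_le)
    finally have "real (card (cut N E (A \<union> S))) \<le> real (card (cut N E A)) + real (card ?F)" by linarith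
    also have "\<dots> \<le> \<alpha> / 2 * real (card (A \<union> S))"
      using A F by (simp add: \<S>_def card_AS distrib_left)
    finally have cut_AS: "real (card (cut N E (A \<union> S))) \<le> \<alpha> / 2 * real (card (A \<union> S))" .
    show False
    proof (cases "real (card (A \<union> S)) \<le> real N / 2")
      case True
      then have "A \<union> S \<in> \<S>" using AS cut_AS by (simp add: \<S>_def)
      from A_max[OF this] show False using S finS by (simp add: card_AS card_gt_0_iff)
    next
      case False
      \<comment> \<open>The union has at most (N + |A|) / 2 < 5 N / 8 nodes. Its complement T then
        has at least 3 N / 8, so the union is at most twice as large as T and T has cut ratio at
        most \<alpha>; but T exceeds b \<le> N / 4.\<close>
      let ?T = "{..<N} - (A \<union> S)"
      have card_T: "real (card ?T) = real N - real (card (A \<union> S))"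
        using AS card_mono[OF _ AS] finite_subset[OF AS] by (simp add: card_Diff_subset of_nat_diff)
      have T_ge: "real (card ?T) \<ge> 3 / 8 * real N"
        using S(3) small_A b cA unfolding card_T card_AS card_V by linarith
      then have "?T \<noteq> {}" using N by force
      have "real (card (cut N E ?T)) \<le> \<alpha> / 2 * real (card (A \<union> S))"
        using cut_AS by (simp only: card_cut_complement[OF AS])
      also have "\<dots> \<le> \<alpha> / 2 * (2 * real (card ?T))"
        using \<alpha> T_ge card_T by (intro mult_left_mono) auto
      finally have cut_T: "real (card (cut N E ?T)) \<le> \<alpha> * real (card ?T)" by simp
      have "real (card ?T) \<le> real N / 2" using False card_T by linarith
      then have "real (card ?T) < b" using \<open>?T \<noteq> {}\<close> cut_T by (intro small) auto
      then show False using T_ge b N by linarith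
    qed
  qed
  then show ?thesis using that AN small_A by blast
qed

text \<open>The nodes of \<open>A\<close> are reinserted by subdividing distinct edges of the remaining expander. This keeps
  all its degrees and needs no explicit family of bounded-degree expanders.\<close>

lemma subdivision_is_expander:
  assumes d: "3 \<le> d" and N: "0 < N" and \<alpha>: "0 < \<alpha>" "\<alpha> \<le> 1"
    and A: "A \<subseteq> {..<N}" "real (card A) < real N / 4"
    and expand: "\<And>S. S \<subseteq> {..<N} - A \<Longrightarrow> S \<noteq> {} \<Longrightarrow> 2 * card S \<le> card ({..<N} - A) \<Longrightarrow>
      \<alpha> / 2 * real (card S) < real (card {(u, v). u \<in> S \<and> v \<in> {..<N} - A - S \<and> {u, v} \<in> E})"
  obtains E' where "bounded_graph N d E'" "card ((E - E') \<union> (E' - E)) \<le> 2 * d * card A"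
    "expansion N E' \<ge> ereal (\<alpha> / (8 * (real d)\<^sup>2))"
proof -
  define V where "V = {..<N} - A"
  define E0 where "E0 = {e \<in> E. e \<subseteq> V}"
  have finA: "finite A" using A finite_subset by blast
  have finE0: "finite E0" using finite_E by (simp add: E0_def)
  have card_V: "real (card V) = real N - real (card A)"
    using A finA card_mono[OF _ A(1)] by (simp add: V_def card_Diff_subset of_nat_diff)
  have finV: "finite V" by (simp add: V_def)
  \<comment> \<open>Enough edges to subdivide: expansion of singletons puts every node of V on an
    edge inside V, so |V| \<le> 2 |E0|, while |V| > 3 |A|.\<close>
  have "card A \<le> card E0"
  proof (cases "A = {}")
    case False
    then have "1 \<le> card A" using finA by (simp add: card_gt_0_iff Suc_le_eq)
    then have V2: "2 \<le> card V" using A card_V by linarith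
    have "V \<subseteq> \<Union>E0"
    proof
      fix v assume v: "v \<in> V"
      have "{(u, w). u \<in> {v} \<and> w \<in> {..<N} - A - {v} \<and> {u, w} \<in> E} \<noteq> {}"
      proof
        assume empty: "{(u, w). u \<in> {v} \<and> w \<in> {..<N} - A - {v} \<and> {u, w} \<in> E} = {}"
        show False using expand[of "{v}"] v V2 \<alpha> unfolding empty by (simp add: V_def)
      qed
      then obtain w where "w \<in> V" "{v, w} \<in> E" by (auto simp: V_def)
      then show "v \<in> \<Union>E0" using v by (auto simp: E0_def)
    qed
    moreover have "finite (\<Union>E0)" using finE0 finV by (auto simp: E0_def intro: finite_subset)
    ultimately have "card V \<le> card (\<Union>E0)" by (intro card_mono)
    also have "\<dots> \<le> (\<Sum>e\<in>E0. card e)"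
      using card_UN_le[OF finE0, of id] by simp
    also have "\<dots> = (\<Sum>e\<in>E0. 2)"
      using graph by (intro sum.cong) (auto simp: E0_def bounded_graph_def)
    finally show ?thesis using A card_V by simp
  qed simp
  \<comment> \<open>\<sigma> assigns to each removed node its own edge; this edge is replaced by a
    path of length two through the node.\<close>
  then obtain \<sigma> where \<sigma>: "\<sigma> ` A \<subseteq> E0" "inj_on \<sigma> A"
    using card_le_inj[OF finA finE0] by blast
  have \<sigma>E: "\<sigma> a \<in> E" "\<sigma> a \<subseteq> V" "card (\<sigma> a) = 2" if "a \<in> A" for a
    using \<sigma>(1) that graph by (auto simp: E0_def bounded_graph_def)
  define New where "New = (\<Union>a\<in>A. (\<lambda>u. {a, u}) ` \<sigma> a)"
  define E' where "E' = (E0 - \<sigma> ` A) \<union> New"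
  have NewI: "{a, u} \<in> E'" if "a \<in> A" "u \<in> \<sigma> a" for a u
    using that by (auto simp: E'_def New_def)
  have E'_iff: "{x, y} \<in> E' \<longleftrightarrow> ({x, y} \<in> E0 \<and> {x, y} \<notin> \<sigma> ` A) \<or> (x \<in> A \<and> y \<in> \<sigma> x) \<or> (y \<in> A \<and> x \<in> \<sigma> y)" for x y
    by (auto simp: E'_def New_def doubleton_eq_iff)
  have VA: "x \<notin> A" if "x \<in> V" for x using that by (simp add: V_def)
  have E0V: "x \<in> V" "y \<in> V" if "{x, y} \<in> E0" for x y using that by (auto simp: E0_def)
  have graph': "bounded_graph N d E'"
    unfolding bounded_graph_def
  proof (intro conjI ballI allI impI)
    fix e assume "e \<in> E'"
    then consider "e \<in> E" | a u where "a \<in> A" "u \<in> \<sigma> a" "e = {a, u}"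
      by (auto simp: E'_def New_def E0_def)
    then have "e \<subseteq> {..<N} \<and> card e = 2"
    proof cases
      case 1 then show ?thesis using graph by (simp add: bounded_graph_def)
    next
      case 2
      then have "u \<in> V" using \<sigma>E by blast
      then show ?thesis using 2 A VA by (auto simp: V_def card_insert_if)
    qed
    then show "e \<subseteq> {..<N}" "card e = 2" by auto
  next
    fix v assume "v < N"
    show "node_degree E' v \<le> d"
    proof (cases "v \<in> A")
      case True
      then have "neighbors E' v = \<sigma> v"
        using VA E0V \<sigma>E by (auto simp: neighbors_def E'_iff) blast+
      then show ?thesis using \<sigma>E(3)[OF True] d by (simp add: node_degree_def)
    next
      case False
      \<comment> \<open>Maps each new neighbor of v to the old edge it stands for: a subdividing
        node to the edge that it subdivides. Injectivity shows that the degree of v does not grow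
        beyond its old bound.\<close>
      define \<phi> where "\<phi> w = (if w \<in> A then \<sigma> w else {v, w})" for w
      have nb: "({v, w} \<in> E0 \<and> {v, w} \<notin> \<sigma> ` A) \<or> (w \<in> A \<and> v \<in> \<sigma> w)" if "w \<in> neighbors E' v" for w
        using that False by (auto simp: neighbors_def E'_iff)
      have "inj_on \<phi> (neighbors E' v)"
      proof (rule inj_onI)
        fix w w' assume w: "w \<in> neighbors E' v" "w' \<in> neighbors E' v" "\<phi> w = \<phi> w'"
        show "w = w'"
          using w(3) nb[OF w(1)] nb[OF w(2)] \<sigma>(2)
          by (auto simp: \<phi>_def doubleton_eq_iff inj_on_def split: if_splits)
      qed
      moreover have "\<phi> ` neighbors E' v \<subseteq> {e \<in> E. v \<in> e}"
      proof
        fix e assume "e \<in> \<phi> ` neighbors E' v"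
        then obtain w where w: "w \<in> neighbors E' v" "e = \<phi> w" by auto
        show "e \<in> {e \<in> E. v \<in> e}"
        proof (cases "w \<in> A")
          case True
          then have "v \<in> \<sigma> w" using nb[OF w(1)] VA E0V by blast
          then show ?thesis using True w(2) \<sigma>E(1)[OF True] by (simp add: \<phi>_def)
        next
          case False
          then have "{v, w} \<in> E0" using nb[OF w(1)] by blast
          then show ?thesis using False w(2) by (simp add: \<phi>_def E0_def)
        qed
      qed
      ultimately have "card (neighbors E' v) \<le> card {e \<in> E. v \<in> e}"
        using finite_E by (intro card_inj_on_le) auto
      then show ?thesis using card_incident_edges_le[of v] by (simp add: node_degree_def)
    qed
  qed
  have changes: "card ((E - E') \<union> (E' - E)) \<le> 2 * d * card A"
  proof -
    have "(E - E') \<union> (E' - E) \<subseteq> {e \<in> E. e \<inter> A \<noteq> {}} \<union> \<sigma> ` A \<union> New"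
    proof -
      have "e \<inter> A \<noteq> {}" if "e \<in> E" "e \<notin> E0" for e
        using that graph by (auto simp: E0_def V_def bounded_graph_def)
      then show ?thesis by (auto simp: E'_def E0_def)
    qed
    moreover have "finite New" using finA \<sigma>E(3) card_ge_0_finite by (force simp: New_def)
    ultimately have "card ((E - E') \<union> (E' - E)) \<le> card ({e \<in> E. e \<inter> A \<noteq> {}} \<union> \<sigma> ` A \<union> New)"
      using finite_E finA by (intro card_mono) auto
    also have "\<dots> \<le> card {e \<in> E. e \<inter> A \<noteq> {}} + card (\<sigma> ` A) + card New"
      by (meson add_mono card_Un_le order_refl order_trans)
    also have "\<dots> \<le> d * card A + card A + 2 * card A"
    proof (intro add_mono)
      show "card {e \<in> E. e \<inter> A \<noteq> {}} \<le> d * card A" by (intro card_UN_incident_le finA) auto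
      show "card (\<sigma> ` A) \<le> card A" by (rule card_image_le[OF finA])
      have "card New \<le> (\<Sum>a\<in>A. card ((\<lambda>u. {a, u}) ` \<sigma> a))"
        unfolding New_def by (rule card_UN_le[OF finA])
      also have "\<dots> \<le> (\<Sum>a\<in>A. 2)"
        using \<sigma>E(3) by (intro sum_mono) (metis card_image_le card.infinite zero_neq_numeral)
      finally show "card New \<le> 2 * card A" by simp
    qed
    also have "\<dots> = (d + 3) * card A" by (simp add: algebra_simps)
    \<comment> \<open>The three summands count lost edges at A, subdivided edges and new half edges;
      d \<ge> 3 gives d + 3 \<le> 2 d.\<close>
    also have "\<dots> \<le> (2 * d) * card A" using d by (intro mult_right_mono) auto
    finally show ?thesis by (simp add: mult.assoc)
  qed
  have "\<alpha> * real (card S) \<le> 8 * (real d)\<^sup>2 * real (card (boundary N E' S))"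
    if S: "S \<subseteq> {..<N}" "real (card S) \<le> real N / 2" for S
  proof -
    define X where "X = boundary N E' S"
    define S1 where "S1 = S \<inter> V"
    define F where "F = (\<lambda>(u, v). {u, v}) ` {(u, v). u \<in> S1 \<and> v \<in> V - S1 \<and> {u, v} \<in> E}"
    have finS: "finite S" using S finite_subset by blast
    have finS1: "finite S1" using finS by (simp add: S1_def)
    have finX: "finite X" by (simp add: X_def boundary_def)
    have XI: "v \<in> X" if "u \<in> S" "{u, v} \<in> E'" "v \<notin> S" for u v
      using that graph' by (auto simp: X_def boundary_def bounded_graph_def)
    have S_eq: "S = S1 \<union> (S \<inter> A)" "S1 \<inter> (S \<inter> A) = {}" using S by (auto simp: S1_def V_def)
    have card_S: "card S = card S1 + card (S \<inter> A)"
      by (subst S_eq(1), rule card_Un_disjoint) (use finS S_eq finS1 in auto)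
    have "card (S \<inter> A) = card (\<sigma> ` (S \<inter> A))"
      using \<sigma>(2) by (intro card_image[symmetric]) (auto intro: inj_on_subset)
    also have "\<dots> \<le> d * card (S1 \<union> X)"
    proof (intro card_UN_incident_le)
      \<comment> \<open>An end of the edge subdivided by a node of S is adjacent to that node in E',
        so it lies in S or in the boundary X. Since distinct nodes subdivide distinct edges,
        counting incident edges bounds the number of subdividing nodes in S.\<close>
      show "\<sigma> ` (S \<inter> A) \<subseteq> (\<Union>x\<in>S1 \<union> X. {e \<in> E. x \<in> e})"
      proof
        fix e assume "e \<in> \<sigma> ` (S \<inter> A)"
        then obtain a where a: "a \<in> S" "a \<in> A" "e = \<sigma> a" by auto
        then obtain u where u: "u \<in> \<sigma> a" using \<sigma>E(3)[OF a(2)] by fastforce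
        then have "u \<in> V" using \<sigma>E(2)[OF a(2)] by auto
        then have "u \<in> S1 \<union> X" using XI[OF a(1) NewI[OF a(2) u]] by (auto simp: S1_def)
        then show "e \<in> (\<Union>x\<in>S1 \<union> X. {e \<in> E. x \<in> e})" using u a \<sigma>E(1)[OF a(2)] by auto
      qed
    qed (use finS1 finX in auto)
    also have "\<dots> \<le> d * (card S1 + card X)" by (intro mult_left_mono card_Un_le) simp
    finally have SA: "real (card (S \<inter> A)) \<le> real d * (real (card S1) + real (card X))"
      by (metis of_nat_add of_nat_le_iff of_nat_mult)
    have card_F: "card F = card {(u, v). u \<in> S1 \<and> v \<in> V - S1 \<and> {u, v} \<in> E}"
      unfolding F_def by (intro card_image) (auto simp: inj_on_def doubleton_eq_iff)
    have "card F \<le> (\<Sum>x\<in>X. d)"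
    proof -
      \<comment> \<open>G x contains the cut edges charged to the boundary node x. An edge of E0
        crossing S1 is charged to its outer end if it is intact or its subdividing node lies in S,
        and otherwise to the subdividing node, which then is a boundary node itself.\<close>
      define G where "G x = (if x \<in> A then {\<sigma> x} else {e \<in> E. x \<in> e})" for x
      have "F \<subseteq> (\<Union>x\<in>X. G x)"
      proof
        fix e assume "e \<in> F"
        then obtain u v where uv: "u \<in> S1" "v \<in> V" "v \<notin> S1" "e \<in> E" "e = {u, v}" by (auto simp: F_def)
        have inS: "u \<in> S" "v \<notin> S" "v \<notin> A" and e0: "e \<in> E0" using uv VA by (auto simp: S1_def E0_def)
        show "e \<in> (\<Union>x\<in>X. G x)"
        proof (cases "e \<in> \<sigma> ` A")
          case False
          then have "v \<in> X" using XI[of u v] e0 inS uv by (auto simp: E'_iff)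
          then show ?thesis using uv inS by (auto simp: G_def)
        next
          case True
          then obtain a where a: "a \<in> A" "e = \<sigma> a" by auto
          show ?thesis
          proof (cases "a \<in> S")
            case True
            then have "v \<in> X" using XI[of a v] NewI[of a v] a uv inS by auto
            then show ?thesis using uv inS by (auto simp: G_def)
          next
            case False
            have "u \<in> \<sigma> a" using a uv by auto
            from NewI[OF a(1) this] have "{u, a} \<in> E'" by (simp add: insert_commute)
            then have "a \<in> X" using XI[of u a] False inS by auto
            then show ?thesis using a by (auto simp: G_def)
          qed
        qed
      qed
      then have "card F \<le> card (\<Union>x\<in>X. G x)"
        using finX finite_E by (intro card_mono) (auto simp: G_def)
      also have "\<dots> \<le> (\<Sum>x\<in>X. card (G x))" by (rule card_UN_le[OF finX])
      also have "\<dots> \<le> (\<Sum>x\<in>X. d)"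
        using card_incident_edges_le d by (intro sum_mono) (auto simp: G_def)
      finally show ?thesis .
    qed
    then have FX: "real (card F) \<le> real d * real (card X)"
      by (simp add: mult.commute flip: of_nat_mult)
    have S1_le: "\<alpha> / 4 * real (card S1) \<le> real (card F)"
    proof (cases "2 * card S1 \<le> card V")
      case True
      have "\<alpha> / 2 * real (card S1) \<le> real (card F)"
      proof (cases "S1 = {}")
        case False
        then show ?thesis using expand[of S1] True unfolding card_F by (simp add: S1_def V_def)
      qed simp
      moreover have "\<alpha> / 4 * real (card S1) \<le> \<alpha> / 2 * real (card S1)" using \<alpha> by (intro mult_right_mono) auto
      ultimately show ?thesis by linarith
    next
      case False
      \<comment> \<open>S1 may exceed half of V although S has at most N / 2 nodes. Then its
        complement T in V has more than N / 4 nodes, hence at least |S1| / 2, and has the same cut;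
        this is why the constant drops to \<alpha> / 4.\<close>
      define T where "T = V - S1"
      have card_T: "real (card T) = real (card V) - real (card S1)"
        using finS1 card_mono[OF finV, of S1] by (simp add: T_def S1_def card_Diff_subset of_nat_diff)
      have "card S1 \<le> card S" using finS by (intro card_mono) (auto simp: S1_def)
      then have T_ge: "2 * real (card T) \<ge> real (card S1)" "0 < real (card T)"
        using card_T card_V A S by linarith+
      have swap: "{(u, v). u \<in> T \<and> v \<in> V - T \<and> {u, v} \<in> E}
          = prod.swap ` {(u, v). u \<in> S1 \<and> v \<in> V - S1 \<and> {u, v} \<in> E}"
        by (force simp: T_def S1_def insert_commute)
      have "\<alpha> / 2 * real (card T) < real (card {(u, v). u \<in> T \<and> v \<in> V - T \<and> {u, v} \<in> E})"
        unfolding V_def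
      proof (rule expand)
        show "T \<subseteq> {..<N} - A" by (auto simp: T_def V_def)
        show "T \<noteq> {}" using T_ge(2) by force
        show "2 * card T \<le> card ({..<N} - A)" using False card_T unfolding V_def[symmetric] by linarith
      qed
      also have "\<dots> = real (card F)" unfolding swap card_F by (simp add: card_image)
      finally have "\<alpha> / 2 * real (card T) \<le> real (card F)" by simp
      moreover have "\<alpha> / 4 * real (card S1) \<le> \<alpha> / 2 * real (card T)"
        using mult_left_mono[OF T_ge(1), of "\<alpha> / 4"] \<alpha> by simp
      ultimately show ?thesis by linarith
    qed
    have "\<alpha> * real (card S) \<le> \<alpha> * ((1 + real d) * real (card S1) + real d * real (card X))"
      using SA \<alpha> by (intro mult_left_mono) (auto simp: card_S algebra_simps)
    also have "\<dots> = (1 + real d) * (\<alpha> * real (card S1)) + \<alpha> * (real d * real (card X))"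
      by (simp add: algebra_simps)
    also have "\<dots> \<le> (1 + real d) * (4 * (real d * real (card X))) + 1 * (real d * real (card X))"
      using S1_le FX \<alpha> by (intro add_mono mult_left_mono mult_right_mono) auto
    also have "\<dots> = (5 + 4 * real d) * (real d * real (card X))" by (simp add: algebra_simps)
    also have "\<dots> \<le> (8 * real d) * (real d * real (card X))"
      using d by (intro mult_right_mono) auto
    finally show ?thesis by (simp add: X_def power2_eq_square mult_ac)
  qed
  then have "expansion N E' \<ge> ereal (\<alpha> / (8 * (real d)\<^sup>2))"
    unfolding expansion_def
  proof (intro INF_greatest)
    fix S assume S: "S \<in> {S. S \<subseteq> {..<N} \<and> S \<noteq> {} \<and> real (card S) \<le> real N / 2}"
    then have "0 < card S" using finite_subset by (auto simp: card_gt_0_iff)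
    moreover assume "\<And>S. S \<subseteq> {..<N} \<Longrightarrow> real (card S) \<le> real N / 2 \<Longrightarrow>
      \<alpha> * real (card S) \<le> 8 * (real d)\<^sup>2 * real (card (boundary N E' S))"
    ultimately show "ereal (\<alpha> / (8 * (real d)\<^sup>2)) \<le> ereal (real (card (boundary N E' S)) / real (card S))"
      using S d by (simp add: field_simps)
  qed
  then show ?thesis using that graph' changes by blast
qed

end

section \<open>The quantum walk\<close>

lemma ket_norm_power2: "(ket_norm B \<psi>)\<^sup>2 = (\<Sum>x\<in>B. (cmod (\<psi> x))\<^sup>2)"
  by (simp add: ket_norm_def L2_set_def sum_nonneg)

lemma ket_norm_nonneg [simp]: "0 \<le> ket_norm B \<psi>"
  by (simp add: ket_norm_def)

lemma ket_norm_cong: "(\<And>x. x \<in> B \<Longrightarrow> \<psi> x = \<phi> x) \<Longrightarrow> ket_norm B \<psi> = ket_norm B \<phi>"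
  by (simp add: ket_norm_def cong: L2_set_cong)

lemma ket_norm_eqI: "(ket_norm B \<psi>)\<^sup>2 = (ket_norm B' \<phi>)\<^sup>2 \<Longrightarrow> ket_norm B \<psi> = ket_norm B' \<phi>"
  by (simp add: power2_eq_iff_nonneg)

lemma ket_norm_ket: "finite B \<Longrightarrow> x \<in> B \<Longrightarrow> ket_norm B (ket x) = 1"
proof -
  assume "finite B" "x \<in> B"
  moreover have "(cmod (ket x y))\<^sup>2 = (if y = x then 1 else 0)" for y by (simp add: ket_def)
  ultimately show ?thesis by (simp add: ket_norm_def L2_set_def)
qed

lemma ket_norm_triangle: "ket_norm B (\<lambda>x. \<psi> x + \<phi> x) \<le> ket_norm B \<psi> + ket_norm B \<phi>"
  unfolding ket_norm_def
  by (rule order_trans[OF L2_set_mono L2_set_triangle_ineq]) (auto simp: norm_triangle_ineq)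

lemma ket_norm_scale: "ket_norm B (\<lambda>x. c * \<psi> x) = cmod c * ket_norm B \<psi>"
  by (simp add: ket_norm_def norm_mult L2_set_right_distrib)

lemma ket_norm_sum_le: "ket_norm B (\<lambda>x. \<Sum>l\<in>L. \<psi> l x) \<le> (\<Sum>l\<in>L. ket_norm B (\<psi> l))"
proof (induction L rule: infinite_finite_induct)
  case (insert l L)
  then show ?case using ket_norm_triangle[of B "\<psi> l" "\<lambda>x. \<Sum>l\<in>L. \<psi> l x"] by simp
qed (simp_all add: ket_norm_def L2_set_def)

lemma ket_norm_diff_le: "\<bar>ket_norm B \<psi> - ket_norm B \<phi>\<bar> \<le> ket_norm B (\<lambda>x. \<psi> x - \<phi> x)"
proof -
  have "ket_norm B (\<lambda>x. \<phi> x - \<psi> x) = ket_norm B (\<lambda>x. \<psi> x - \<phi> x)"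
    by (simp add: ket_norm_def norm_minus_commute)
  then show ?thesis
    using ket_norm_triangle[of B "\<lambda>x. \<psi> x - \<phi> x" \<phi>] ket_norm_triangle[of B "\<lambda>x. \<phi> x - \<psi> x" \<psi>] by simp
qed

lemma op_app_cong: "(\<And>x. x \<in> B \<Longrightarrow> \<psi> x = \<phi> x) \<Longrightarrow> op_app B X \<psi> = op_app B X \<phi>"
  by (auto simp: op_app_def fun_eq_iff intro!: sum.cong)

lemma op_app_mult: "op_app B (op_mult B X Y) \<psi> = op_app B X (op_app B Y \<psi>)"
proof
  fix x
  have "op_app B (op_mult B X Y) \<psi> x = (\<Sum>y\<in>B. \<Sum>z\<in>B. X x z * Y z y * \<psi> y)"
    by (simp add: op_app_def op_mult_def sum_distrib_right)
  also have "\<dots> = op_app B X (op_app B Y \<psi>) x"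
    by (subst sum.swap) (simp add: op_app_def sum_distrib_left mult.assoc)
  finally show "op_app B (op_mult B X Y) \<psi> x = op_app B X (op_app B Y \<psi>) x" .
qed

lemma op_app_id: "finite B \<Longrightarrow> x \<in> B \<Longrightarrow> op_app B op_id \<psi> x = \<psi> x"
  by (simp add: op_app_def op_id_def if_distrib[of "\<lambda>c. c * _"] cong: if_cong)

lemma op_adj_adj [simp]: "op_adj (op_adj X) = X"
  by (simp add: op_adj_def)

lemma unitary_on_adj: "unitary_on B U \<Longrightarrow> unitary_on B (op_adj U)"
  by (simp add: unitary_on_def)

lemma unitary_on_app:
  assumes "finite B" "unitary_on B U" "x \<in> B"
  shows "op_app B U (op_app B (op_adj U) \<psi>) x = \<psi> x"
proof -
  have "op_app B (op_mult B U (op_adj U)) \<psi> x = op_app B op_id \<psi> x"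
    using assms unfolding op_app_def unitary_on_def by (intro sum.cong) auto
  then show ?thesis using assms by (simp add: op_app_mult op_app_id)
qed

lemma unitary_on_norm:
  assumes "finite B" "unitary_on B U"
  shows "ket_norm B (op_app B U \<psi>) = ket_norm B \<psi>"
proof -
  have "complex_of_real ((ket_norm B (op_app B U \<psi>))\<^sup>2) = (\<Sum>x\<in>B. op_app B U \<psi> x * cnj (op_app B U \<psi> x))"
    by (simp add: ket_norm_power2 complex_norm_square del: of_real_power)
  also have "\<dots> = (\<Sum>x\<in>B. \<Sum>y\<in>B. cnj (U x y) * cnj (\<psi> y) * op_app B U \<psi> x)"
    by (simp add: op_app_def[of _ _ \<psi>] sum_distrib_left sum_distrib_right mult_ac)
  also have "\<dots> = (\<Sum>y\<in>B. cnj (\<psi> y) * op_app B (op_adj U) (op_app B U \<psi>) y)"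
    by (subst sum.swap)
      (simp add: op_app_def[of _ "op_adj U"], simp add: op_adj_def sum_distrib_left mult_ac)
  also have "\<dots> = (\<Sum>y\<in>B. \<psi> y * cnj (\<psi> y))"
    using unitary_on_app[OF assms(1) unitary_on_adj[OF assms(2)]] by (intro sum.cong) (auto simp: mult.commute)
  also have "\<dots> = complex_of_real ((ket_norm B \<psi>)\<^sup>2)"
    by (simp add: ket_norm_power2 complex_norm_square del: of_real_power)
  finally show ?thesis by (intro ket_norm_eqI) (simp only: of_real_eq_iff)
qed

section \<open>The walk unitary and its flat block\<close>

lemma finite_coin_basis [simp]: "finite (coin_basis N)"
  by (simp add: coin_basis_def)

lemma finite_walk_basis [simp]: "finite (walk_basis N)"
  by (simp add: walk_basis_def)

lemma finite_full_basis [simp]: "finite (full_basis N \<tau>)"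
  by (simp add: full_basis_def)

lemma sum_walk_basis: "(\<Sum>x\<in>walk_basis N. g x) = (\<Sum>i<N. \<Sum>a\<in>coin_basis N. g (i, a))"
  by (simp add: walk_basis_def sum.cartesian_product case_prod_beta)

lemma sum_full_basis: "(\<Sum>x\<in>full_basis N \<tau>. g x) = (\<Sum>x\<in>walk_basis N. \<Sum>l\<le>\<tau>. g (x, l))"
  by (simp add: full_basis_def sum.cartesian_product case_prod_beta)

lemma sum_coin_basis: "(\<Sum>a\<in>coin_basis N. g a) = g None + (\<Sum>k<N. g (Some k))"
  unfolding coin_basis_def by (subst sum.insert) (auto simp: sum.reindex)

lemma op_app_V:
  assumes "i < N"
  shows "op_app (walk_basis N) (V_op coin) \<psi> (i, a) = op_app (coin_basis N) (coin i) (\<lambda>b. \<psi> (i, b)) a"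
proof -
  have "op_app (walk_basis N) (V_op coin) \<psi> (i, a)
      = (\<Sum>j<N. \<Sum>b\<in>coin_basis N. V_op coin (i, a) (j, b) * \<psi> (j, b))"
    by (simp add: op_app_def sum_walk_basis)
  also have "\<dots> = (\<Sum>j<N. if j = i then \<Sum>b\<in>coin_basis N. coin i a b * \<psi> (i, b) else 0)"
    by (intro sum.cong refl) (auto simp: V_op_def)
  finally show ?thesis using assms by (simp add: op_app_def)
qed

lemma op_adj_V: "op_adj (V_op coin) = V_op (\<lambda>i. op_adj (coin i))"
  by (auto simp: op_adj_def V_op_def fun_eq_iff)

lemma V_op_norm:
  assumes "\<And>i. i < N \<Longrightarrow> unitary_on (coin_basis N) (coin i)"
  shows "ket_norm (walk_basis N) (op_app (walk_basis N) (V_op coin) \<psi>) = ket_norm (walk_basis N) \<psi>"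
proof (rule ket_norm_eqI)
  have "(ket_norm (walk_basis N) (op_app (walk_basis N) (V_op coin) \<psi>))\<^sup>2
    = (\<Sum>i<N. (ket_norm (coin_basis N) (op_app (coin_basis N) (coin i) (\<lambda>b. \<psi> (i, b))))\<^sup>2)"
    by (simp add: ket_norm_power2 sum_walk_basis op_app_V)
  also have "\<dots> = (\<Sum>i<N. (ket_norm (coin_basis N) (\<lambda>b. \<psi> (i, b)))\<^sup>2)"
    using assms by (simp add: unitary_on_norm)
  finally show "(ket_norm (walk_basis N) (op_app (walk_basis N) (V_op coin) \<psi>))\<^sup>2 = (ket_norm (walk_basis N) \<psi>)\<^sup>2"
    by (simp add: ket_norm_power2 sum_walk_basis)
qed

lemma V_op_adj_inverse:
  assumes "\<And>i. i < N \<Longrightarrow> unitary_on (coin_basis N) (coin i)" "x \<in> walk_basis N"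
  shows "op_app (walk_basis N) (V_op coin) (op_app (walk_basis N) (op_adj (V_op coin)) \<psi>) x = \<psi> x"
proof -
  obtain i a where x: "x = (i, a)" "i < N" "a \<in> coin_basis N" using assms(2) by (auto simp: walk_basis_def)
  then show ?thesis
    by (simp add: op_adj_V op_app_V unitary_on_app assms(1))
qed

lemma V_op_inverse:
  assumes "\<And>i. i < N \<Longrightarrow> unitary_on (coin_basis N) (coin i)" "x \<in> walk_basis N"
  shows "op_app (walk_basis N) (op_adj (V_op coin)) (op_app (walk_basis N) (V_op coin) \<psi>) x = \<psi> x"
  using V_op_adj_inverse[of N "\<lambda>i. op_adj (coin i)" x \<psi>] assms by (simp add: op_adj_V unitary_on_adj)

text \<open>An involution whose flat block is the walk matrix. \<open>W_op\<close> is its product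
  with the flat reflection, which is an involution too.\<close>

definition coined_swap :: "nat \<Rightarrow> nat set set \<Rightarrow> (nat \<Rightarrow> nat option oper) \<Rightarrow> wbasis oper" where
  "coined_swap N E coin =
     op_mult (walk_basis N) (op_adj (V_op coin)) (op_mult (walk_basis N) (S_op E) (V_op coin))"

definition flat_sign :: "wbasis \<Rightarrow> complex" where
  "flat_sign x = (if snd x = None then 1 else - 1)"

lemma op_app_flat_reflection:
  assumes "x \<in> walk_basis N"
  shows "op_app (walk_basis N) flat_reflection \<psi> x = flat_sign x * \<psi> x"
proof -
  have "op_app (walk_basis N) flat_reflection \<psi> x = (\<Sum>y\<in>walk_basis N. if y = x then flat_sign x * \<psi> x else 0)"
    unfolding op_app_def
    by (intro sum.cong refl) (auto simp: flat_reflection_def op_id_def flat_sign_def)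
  then show ?thesis using assms by simp
qed

lemma ket_norm_flat_reflection:
  "ket_norm (walk_basis N) (op_app (walk_basis N) flat_reflection \<psi>) = ket_norm (walk_basis N) \<psi>"
proof (rule ket_norm_eqI)
  have "cmod (flat_sign x) = 1" for x by (simp add: flat_sign_def)
  then show "(ket_norm (walk_basis N) (op_app (walk_basis N) flat_reflection \<psi>))\<^sup>2 = (ket_norm (walk_basis N) \<psi>)\<^sup>2"
    unfolding ket_norm_power2 by (intro sum.cong refl) (simp add: op_app_flat_reflection norm_mult)
qed

locale quantum_walk = bounded_degree_graph N d E for N d :: nat and E :: "nat set set" +
  fixes coin :: "nat \<Rightarrow> nat option oper"
  assumes coin: "valid_coin N d E coin"
begin

abbreviation "B \<equiv> walk_basis N"

lemma coin_unitary: "i < N \<Longrightarrow> unitary_on (coin_basis N) (coin i)"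
  using coin by (simp add: valid_coin_def)

lemma swap_edge_in: "x \<in> B \<Longrightarrow> swap_edge E x \<in> B"
  using edgeD by (cases x; cases "snd x") (auto simp: walk_basis_def coin_basis_def)

lemma swap_edge_involution [simp]: "swap_edge E (swap_edge E x) = x"
  by (cases x; cases "snd x") (auto simp: insert_commute)

lemma swap_edge_bij: "bij_betw (swap_edge E) B B"
  by (rule bij_betw_byWitness[of _ "swap_edge E"]) (auto simp: swap_edge_in)

lemma op_app_S: "x \<in> B \<Longrightarrow> op_app B (S_op E) \<psi> x = \<psi> (swap_edge E x)"
proof -
  assume x: "x \<in> B"
  have "op_app B (S_op E) \<psi> x = (\<Sum>y\<in>B. if y = swap_edge E x then \<psi> y else 0)"
    unfolding op_app_def by (intro sum.cong refl) (auto simp: S_op_def ket_def)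
  then show ?thesis using swap_edge_in[OF x] by simp
qed

lemma ket_norm_S: "ket_norm B (op_app B (S_op E) \<psi>) = ket_norm B \<psi>"
proof (rule ket_norm_eqI)
  show "(ket_norm B (op_app B (S_op E) \<psi>))\<^sup>2 = (ket_norm B \<psi>)\<^sup>2"
    unfolding ket_norm_power2 using sum.reindex_bij_betw[OF swap_edge_bij, of "\<lambda>x. (cmod (\<psi> x))\<^sup>2"]
    by (simp add: op_app_S)
qed

lemma op_app_coined_swap:
  "op_app B (coined_swap N E coin) \<psi> = op_app B (op_adj (V_op coin)) (op_app B (S_op E) (op_app B (V_op coin) \<psi>))"
  by (simp add: coined_swap_def op_app_mult)

lemma coined_swap_involution:
  assumes "x \<in> B"
  shows "op_app B (coined_swap N E coin) (op_app B (coined_swap N E coin) \<psi>) x = \<psi> x"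
proof -
  let ?V = "op_app B (V_op coin)" and ?V' = "op_app B (op_adj (V_op coin))" and ?S = "op_app B (S_op E)"
  have "?S (?V (?V' (?S (?V \<psi>)))) = ?S (?S (?V \<psi>))"
    by (rule op_app_cong) (rule V_op_adj_inverse[OF coin_unitary])
  then have "?V' (?S (?V (?V' (?S (?V \<psi>))))) = ?V' (?S (?S (?V \<psi>)))" by simp
  also have "\<dots> = ?V' (?V \<psi>)"
    by (rule op_app_cong) (simp add: op_app_S swap_edge_in)
  finally show ?thesis using V_op_inverse[OF coin_unitary assms] by (simp add: op_app_coined_swap)
qed

lemma ket_norm_coined_swap: "ket_norm B (op_app B (coined_swap N E coin) \<psi>) = ket_norm B \<psi>"
  unfolding op_app_coined_swap op_adj_V
  by (simp add: V_op_norm unitary_on_adj coin_unitary ket_norm_S)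

lemma op_app_W:
  "x \<in> B \<Longrightarrow> op_app B (W_op N E coin) \<psi> x = flat_sign x * op_app B (coined_swap N E coin) \<psi> x"
  unfolding W_op_def coined_swap_def[symmetric] by (simp add: op_app_mult op_app_flat_reflection)

lemma ket_norm_W: "ket_norm B (op_app B (W_op N E coin) \<psi>) = ket_norm B \<psi>"
  unfolding W_op_def coined_swap_def[symmetric]
  by (simp add: op_app_mult ket_norm_flat_reflection ket_norm_coined_swap)

lemma ket_norm_W_power: "ket_norm B (op_app B (op_power B (W_op N E coin) l) \<psi>) = ket_norm B \<psi>"
proof (induction l)
  case 0
  show ?case by (rule ket_norm_cong) (simp add: op_app_id)
next
  case (Suc l) then show ?case by (simp add: op_app_mult ket_norm_W)
qed

text \<open>Only |i,k> with nonzero amplitude in V|i,\<flat>> matters. Along an edge the swap pairs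
  sqrt (P(j,i)) with sqrt (P(i,j)), equal by symmetry; |i,i> is fixed and yields the diagonal entry;
  other fixed |i,k> have amplitude zero.\<close>

lemma coined_swap_flat:
  assumes "i < N" "j < N"
  shows "coined_swap N E coin (i, None) (j, None) = complex_of_real (lazy_walk d E i j)"
proof -
  have coin_None: "coin i None None = 0" if "i < N" for i using coin that by (simp add: valid_coin_def)
  have coin_Some: "coin i (Some j) None = complex_of_real (sqrt (lazy_walk d E j i))" if "i < N" "j < N" for i j
    using coin that by (simp add: valid_coin_def)
  have "coined_swap N E coin (i, None) (j, None)
      = op_app B (op_adj (V_op coin)) (op_app B (S_op E) (\<lambda>w. V_op coin w (j, None))) (i, None)"
    by (simp add: coined_swap_def op_mult_def op_app_def)
  also have "\<dots> = (\<Sum>z\<in>B. cnj (V_op coin z (i, None)) * V_op coin (swap_edge E z) (j, None))"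
    unfolding op_app_def[of B "op_adj _"] by (intro sum.cong refl) (simp add: op_adj_def op_app_S)
  also have "\<dots> = (\<Sum>k<N. if k = i then \<Sum>a\<in>coin_basis N. cnj (coin i a None) * V_op coin (swap_edge E (i, a)) (j, None) else 0)"
    unfolding sum_walk_basis by (intro sum.cong refl) (auto simp: V_op_def)
  also have "\<dots> = (\<Sum>k<N. complex_of_real (sqrt (lazy_walk d E k i)) * V_op coin (swap_edge E (i, Some k)) (j, None))"
    using assms by (simp add: sum_coin_basis coin_None coin_Some)
  also have "\<dots> = (\<Sum>k<N. if k = j then complex_of_real (lazy_walk d E i j) else 0)"
  proof (intro sum.cong refl)
    fix k assume k: "k \<in> {..<N}"
    show "complex_of_real (sqrt (lazy_walk d E k i)) * V_op coin (swap_edge E (i, Some k)) (j, None)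
        = (if k = j then complex_of_real (lazy_walk d E i j) else 0)"
    proof (cases "{i, k} \<in> E")
      case True
      have "lazy_walk d E k i = lazy_walk d E i k" by (rule lazy_walk_commute)
      then show ?thesis using True k assms
        by (auto simp: V_op_def coin_Some lazy_walk_nonneg simp flip: of_real_mult)
    next
      case False
      show ?thesis
      proof (cases "k = i")
        case True
        then show ?thesis using False assms lazy_walk_nonneg[of i i]
          by (auto simp: V_op_def coin_Some simp flip: of_real_mult)
      next
        case ki: False
        then have "lazy_walk d E k i = 0" using False by (auto simp: lazy_walk_def)
        moreover have "lazy_walk d E i k = 0" using False ki by (auto simp: lazy_walk_def insert_commute)
        ultimately show ?thesis by auto
      qed
    qed
  qed
  finally show ?thesis using assms by simp
qed

definition flat_ampl :: "nat \<Rightarrow> nat \<Rightarrow> nat \<Rightarrow> complex" where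
  "flat_ampl s l i = op_power B (W_op N E coin) l (i, None) (s, None)"

lemma op_power_column_0: "(\<lambda>x. op_power B X 0 x y) = ket y"
  by (simp add: op_id_def ket_def fun_eq_iff)

lemma op_power_column_Suc: "(\<lambda>x. op_power B X (Suc l) x y) = op_app B X (\<lambda>x. op_power B X l x y)"
  by (simp add: op_mult_def op_app_def)

lemma flat_ampl_0: "flat_ampl s 0 i = of_bool (i = s)"
  by (simp add: flat_ampl_def op_id_def)

text \<open>The identity plus the flat reflection is twice the projection onto the flat
  states.\<close>

lemma sum_flat_sign:
  "(\<Sum>z\<in>B. (1 + flat_sign z) * g z) = 2 * (\<Sum>j<N. g (j, None))"
  by (simp add: sum_walk_basis sum_coin_basis flat_sign_def sum_distrib_left)

lemma flat_ampl_1: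
  assumes "i < N" "s < N"
  shows "flat_ampl s 1 i = complex_of_real (lazy_walk d E i s)"
proof -
  have s: "(s, None) \<in> B" and i: "(i, None) \<in> B" using assms by (auto simp: walk_basis_def coin_basis_def)
  have "flat_ampl s 1 i = op_app B (W_op N E coin) (ket (s, None)) (i, None)"
    unfolding flat_ampl_def One_nat_def using op_power_column_Suc[of "W_op N E coin" 0 "(s, None)"]
    by (simp add: fun_eq_iff op_power_column_0[of "W_op N E coin", simplified])
  also have "\<dots> = op_app B (coined_swap N E coin) (ket (s, None)) (i, None)"
    using i by (simp add: op_app_W flat_sign_def)
  also have "\<dots> = coined_swap N E coin (i, None) (s, None)"
    using s by (simp add: op_app_def ket_def if_distrib cong: if_cong)
  finally show ?thesis using assms by (simp add: coined_swap_flat)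
qed

text \<open>The flat block of \<open>W\<^sup>l\<close> is the \<open>l\<close>-th Chebyshev polynomial of the walk matrix: with
  \<open>W = R U\<close> for the involutions \<open>R\<close> and \<open>U\<close>, the flat rows of \<open>W + W\<^sup>-\<^sup>1 = R U + U R\<close> are those of
  \<open>U (1 + R)\<close>.\<close>

lemma flat_ampl_recurrence:
  assumes "i < N"
  shows "flat_ampl s (Suc (Suc l)) i + flat_ampl s l i
    = 2 * (\<Sum>j<N. complex_of_real (lazy_walk d E i j) * flat_ampl s (Suc l) j)"
proof -
  let ?U = "coined_swap N E coin" and ?W = "W_op N E coin"
  define c where "c l x = op_power B ?W l x (s, None)" for l x
  have c_Suc: "c (Suc l) = op_app B ?W (c l)" for l
    using op_power_column_Suc[of ?W l "(s, None)"] by (simp add: c_def[abs_def])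
  have i: "(i, None) \<in> B" using assms by (auto simp: walk_basis_def coin_basis_def)
  have "c (Suc (Suc l)) (i, None) = op_app B ?U (c (Suc l)) (i, None)"
    unfolding c_Suc[of "Suc l"] using i by (simp add: op_app_W flat_sign_def)
  \<comment> \<open>With W = R U and both factors involutions, the previous state is U R applied to
    the next one.\<close>
  moreover have "c l (i, None) = op_app B ?U (\<lambda>z. flat_sign z * c (Suc l) z) (i, None)"
  proof -
    have "op_app B ?U (\<lambda>z. flat_sign z * c (Suc l) z) = op_app B ?U (op_app B ?U (c l))"
      by (rule op_app_cong) (simp add: c_Suc op_app_W, simp add: flat_sign_def)
    then show ?thesis using coined_swap_involution[OF i] by simp
  qed
  ultimately have "c (Suc (Suc l)) (i, None) + c l (i, None)
      = (\<Sum>z\<in>B. (1 + flat_sign z) * (?U (i, None) z * c (Suc l) z))"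
    by (simp add: op_app_def algebra_simps flip: sum.distrib)
  also have "\<dots> = 2 * (\<Sum>j<N. ?U (i, None) (j, None) * c (Suc l) (j, None))"
    by (rule sum_flat_sign)
  also have "\<dots> = 2 * (\<Sum>j<N. complex_of_real (lazy_walk d E i j) * c (Suc l) (j, None))"
    using assms by (simp add: coined_swap_flat)
  finally show ?thesis by (simp add: flat_ampl_def c_def)
qed

lemma flat_ampl_norm:
  assumes "s < N"
  shows "ket_norm {..<N} (flat_ampl s l) \<le> 1"
proof -
  let ?W = "W_op N E coin"
  have s: "(s, None) \<in> B" using assms by (auto simp: walk_basis_def coin_basis_def)
  have "(ket_norm {..<N} (flat_ampl s l))\<^sup>2 = (\<Sum>x\<in>(\<lambda>i. (i, None)) ` {..<N}. (cmod (op_power B ?W l x (s, None)))\<^sup>2)"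
    by (subst sum.reindex) (auto simp: inj_on_def ket_norm_power2 flat_ampl_def)
  also have "\<dots> \<le> (\<Sum>x\<in>B. (cmod (op_power B ?W l x (s, None)))\<^sup>2)"
    by (intro sum_mono2) (auto simp: walk_basis_def coin_basis_def)
  also have "\<dots> = (ket_norm B (op_app B (op_power B ?W l) (ket (s, None))))\<^sup>2"
    using s by (simp add: ket_norm_power2 op_app_def ket_def if_distrib cong: if_cong)
  also have "\<dots> = 1" using s by (simp add: ket_norm_W_power ket_norm_ket)
  finally show ?thesis by (simp add: power_le_one_iff)
qed

section \<open>The operator combining powers of the walk\<close>

lemma op_app_controlled:
  assumes "l \<le> \<tau>"
  shows "op_app (full_basis N \<tau>) (controlled_powers N W) \<psi> (x, l) = op_app B (op_power B W l) (\<lambda>y. \<psi> (y, l)) x"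
proof -
  have "op_app (full_basis N \<tau>) (controlled_powers N W) \<psi> (x, l)
      = (\<Sum>y\<in>B. \<Sum>m\<le>\<tau>. if m = l then op_power B W l x y * \<psi> (y, l) else 0)"
    unfolding op_app_def sum_full_basis by (intro sum.cong refl) (auto simp: controlled_powers_def)
  then show ?thesis using assms by (simp add: op_app_def)
qed

lemma op_app_tensor_id:
  assumes "x \<in> B"
  shows "op_app (full_basis N \<tau>) (op_tensor op_id Q) \<psi> (x, l) = op_app {..\<tau>} Q (\<lambda>m. \<psi> (x, m)) l"
proof -
  have "op_app (full_basis N \<tau>) (op_tensor op_id Q) \<psi> (x, l)
      = (\<Sum>y\<in>B. if y = x then \<Sum>m\<le>\<tau>. Q l m * \<psi> (x, m) else 0)"
    unfolding op_app_def sum_full_basis by (intro sum.cong refl) (auto simp: op_tensor_def op_id_def)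
  then show ?thesis using assms by (simp add: op_app_def)
qed

lemma op_adj_tensor_id: "op_adj (op_tensor op_id Q) = op_tensor op_id (op_adj Q)"
  by (auto simp: op_adj_def op_tensor_def op_id_def fun_eq_iff)

lemma ket_norm_controlled:
  "ket_norm (full_basis N \<tau>) (op_app (full_basis N \<tau>) (controlled_powers N (W_op N E coin)) \<psi>) = ket_norm (full_basis N \<tau>) \<psi>"
proof (rule ket_norm_eqI)
  have "(ket_norm (full_basis N \<tau>) (op_app (full_basis N \<tau>) (controlled_powers N (W_op N E coin)) \<psi>))\<^sup>2
    = (\<Sum>l\<le>\<tau>. (ket_norm B (op_app B (op_power B (W_op N E coin) l) (\<lambda>y. \<psi> (y, l))))\<^sup>2)"
    unfolding ket_norm_power2 sum_full_basis by (subst sum.swap) (simp add: op_app_controlled)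
  also have "\<dots> = (\<Sum>l\<le>\<tau>. (ket_norm B (\<lambda>y. \<psi> (y, l)))\<^sup>2)" by (simp add: ket_norm_W_power)
  also have "\<dots> = (ket_norm (full_basis N \<tau>) \<psi>)\<^sup>2"
    unfolding ket_norm_power2 sum_full_basis by (subst sum.swap) simp
  finally show "(ket_norm (full_basis N \<tau>) (op_app (full_basis N \<tau>) (controlled_powers N (W_op N E coin)) \<psi>))\<^sup>2
    = (ket_norm (full_basis N \<tau>) \<psi>)\<^sup>2" .
qed

lemma ket_norm_tensor_id:
  assumes "unitary_on {..\<tau>} Q"
  shows "ket_norm (full_basis N \<tau>) (op_app (full_basis N \<tau>) (op_tensor op_id Q) \<psi>) = ket_norm (full_basis N \<tau>) \<psi>"
proof (rule ket_norm_eqI)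
  have "(ket_norm (full_basis N \<tau>) (op_app (full_basis N \<tau>) (op_tensor op_id Q) \<psi>))\<^sup>2
    = (\<Sum>x\<in>B. (ket_norm {..\<tau>} (op_app {..\<tau>} Q (\<lambda>m. \<psi> (x, m))))\<^sup>2)"
    unfolding ket_norm_power2 sum_full_basis by (simp add: op_app_tensor_id)
  also have "\<dots> = (\<Sum>x\<in>B. (ket_norm {..\<tau>} (\<lambda>m. \<psi> (x, m)))\<^sup>2)"
    using assms by (simp add: unitary_on_norm)
  also have "\<dots> = (ket_norm (full_basis N \<tau>) \<psi>)\<^sup>2"
    unfolding ket_norm_power2 sum_full_basis by simp
  finally show "(ket_norm (full_basis N \<tau>) (op_app (full_basis N \<tau>) (op_tensor op_id Q) \<psi>))\<^sup>2
    = (ket_norm (full_basis N \<tau>) \<psi>)\<^sup>2" .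
qed

definition walk_state :: "nat \<Rightarrow> nat oper \<Rightarrow> nat \<Rightarrow> fbasis ket" where
  "walk_state \<tau> Q s = op_app (full_basis N \<tau>) (W_tau N \<tau> (W_op N E coin) Q) (ket ((s, None), 0))"

lemma ket_norm_walk_state:
  assumes "unitary_on {..\<tau>} Q" "s < N"
  shows "ket_norm (full_basis N \<tau>) (walk_state \<tau> Q s) = 1"
  using assms unfolding walk_state_def W_tau_def op_adj_tensor_id
  by (simp add: op_app_mult ket_norm_tensor_id unitary_on_adj ket_norm_controlled)
    (auto simp: ket_norm_ket full_basis_def walk_basis_def coin_basis_def)

text \<open>Linear combination of unitaries: preparing the third register contributes sqrt (q l),
  and returning it to its flat state contributes the same factor again.\<close>

lemma walk_state_flat:
  assumes "\<And>l. l \<le> \<tau> \<Longrightarrow> Q l 0 = complex_of_real (sqrt (q l))" "\<And>l. l \<le> \<tau> \<Longrightarrow> 0 \<le> q l" "s < N" "i < N"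
  shows "walk_state \<tau> Q s ((i, None), 0) = (\<Sum>l\<le>\<tau>. complex_of_real (q l) * flat_ampl s l i)"
proof -
  have s: "(s, None) \<in> B" and i: "(i, None) \<in> B" using assms by (auto simp: walk_basis_def coin_basis_def)
  let ?F = "full_basis N \<tau>" and ?T = "op_tensor op_id Q"
  define \<phi> where "\<phi> = op_app ?F ?T (ket ((s, None), 0))"
  have \<phi>: "\<phi> (x, l) = (if x = (s, None) then Q l 0 else 0)" if "x \<in> B" "l \<le> \<tau>" for x l
    using that unfolding \<phi>_def
    by (simp add: op_app_tensor_id) (auto simp: op_app_def ket_def if_distrib cong: if_cong)
  have "walk_state \<tau> Q s ((i, None), 0) = (\<Sum>l\<le>\<tau>. cnj (Q l 0) * op_app ?F (controlled_powers N (W_op N E coin)) \<phi> ((i, None), l))"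
    unfolding walk_state_def W_tau_def op_adj_tensor_id op_app_mult \<phi>_def[symmetric]
    using i by (simp add: op_app_tensor_id op_app_def[of "{..\<tau>}"]) (simp add: op_adj_def)
  also have "\<dots> = (\<Sum>l\<le>\<tau>. complex_of_real (q l) * flat_ampl s l i)"
  proof (intro sum.cong refl)
    fix l assume l: "l \<in> {..\<tau>}"
    have "op_app ?F (controlled_powers N (W_op N E coin)) \<phi> ((i, None), l)
        = (\<Sum>y\<in>B. op_power B (W_op N E coin) l (i, None) y * \<phi> (y, l))"
      using l by (simp add: op_app_controlled) (simp add: op_app_def)
    also have "\<dots> = (\<Sum>y\<in>B. if y = (s, None) then flat_ampl s l i * Q l 0 else 0)"
      using l by (intro sum.cong refl) (auto simp: \<phi> flat_ampl_def)
    also have "\<dots> = flat_ampl s l i * Q l 0" using s by simp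
    finally show "cnj (Q l 0) * op_app ?F (controlled_powers N (W_op N E coin)) \<phi> ((i, None), l)
        = complex_of_real (q l) * flat_ampl s l i"
      using assms(1,2)[of l] l by (simp add: mult_ac flip: of_real_mult)
  qed
  finally show ?thesis .
qed

lemma op_app_Pi_flat:
  assumes "x \<in> full_basis N \<tau>"
  shows "op_app (full_basis N \<tau>) Pi_flat \<psi> x = (if snd (fst x) = None \<and> snd x = 0 then \<psi> x else 0)"
proof -
  have "op_app (full_basis N \<tau>) Pi_flat \<psi> x
      = (\<Sum>y\<in>full_basis N \<tau>. if y = x then (if snd (fst x) = None \<and> snd x = 0 then \<psi> x else 0) else 0)"
    unfolding op_app_def by (intro sum.cong refl) (auto simp: Pi_flat_def)
  then show ?thesis using assms by simp
qed

lemma ket_norm_Pi_flat: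
  "ket_norm (full_basis N \<tau>) (op_app (full_basis N \<tau>) Pi_flat \<psi>) = ket_norm {..<N} (\<lambda>i. \<psi> ((i, None), 0))"
proof (rule ket_norm_eqI)
  have "(ket_norm (full_basis N \<tau>) (op_app (full_basis N \<tau>) Pi_flat \<psi>))\<^sup>2
      = (\<Sum>x\<in>full_basis N \<tau>. if x \<in> (\<lambda>i. ((i, None), 0)) ` {..<N} then (cmod (\<psi> x))\<^sup>2 else 0)"
    unfolding ket_norm_power2
    by (intro sum.cong refl) (simp add: op_app_Pi_flat, auto simp: full_basis_def walk_basis_def)
  also have "\<dots> = (\<Sum>x\<in>(\<lambda>i. ((i, None), 0)) ` {..<N}. (cmod (\<psi> x))\<^sup>2)"
    by (subst sum.inter_restrict[symmetric])
      (auto intro!: sum.cong simp: full_basis_def walk_basis_def coin_basis_def)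
  also have "\<dots> = (ket_norm {..<N} (\<lambda>i. \<psi> ((i, None), 0)))\<^sup>2"
    by (subst sum.reindex) (auto simp: inj_on_def ket_norm_power2)
  finally show "(ket_norm (full_basis N \<tau>) (op_app (full_basis N \<tau>) Pi_flat \<psi>))\<^sup>2
      = (ket_norm {..<N} (\<lambda>i. \<psi> ((i, None), 0)))\<^sup>2" .
qed

end

lemma projector_Pi_flat: "projector_on (full_basis N \<tau>) Pi_flat"
proof -
  have "op_mult (full_basis N \<tau>) Pi_flat Pi_flat x y = Pi_flat x y" if "x \<in> full_basis N \<tau>" for x y
  proof -
    have "op_mult (full_basis N \<tau>) Pi_flat Pi_flat x y = (\<Sum>z\<in>full_basis N \<tau>. if z = x then Pi_flat x y else 0)"
      unfolding op_mult_def by (intro sum.cong refl) (auto simp: Pi_flat_def)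
    then show ?thesis using that by simp
  qed
  moreover have "op_adj Pi_flat = Pi_flat" by (auto simp: op_adj_def Pi_flat_def fun_eq_iff)
  ultimately show ?thesis by (simp add: projector_on_def)
qed

section \<open>Quantum fast-forwarding\<close>

text \<open>The auxiliary inequality behind Hoeffding's lemma for probability 1/2 and argument 2 x,
  multiplied by exp (- x) after exponentiation.\<close>

lemma cosh_le_exp_half_square:
  fixes x :: real
  assumes "0 \<le> x"
  shows "(exp x + exp (- x)) / 2 \<le> exp (x\<^sup>2 / 2)"
proof -
  define y where "y = (1 + exp (2 * x)) / 2"
  have y: "1 + 1 / 2 * (exp (2 * x) - 1) = y" "0 < y" by (simp_all add: y_def field_simps add_pos_pos)
  have "- (2 * x) * (1 / 2) + ln (1 + 1 / 2 * (exp (2 * x) - 1)) \<le> (2 * x)\<^sup>2 / 8"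
    by (rule Hoeffdings_lemma_aux) (use assms in auto)
  then have "ln y \<le> x + x\<^sup>2 / 2" unfolding y by (simp add: power_mult_distrib)
  then have "y \<le> exp x * exp (x\<^sup>2 / 2)" using y(2) by (metis exp_add exp_le_cancel_iff exp_ln)
  then have "exp (- x) * y \<le> exp (- x) * (exp x * exp (x\<^sup>2 / 2))"
    by (intro mult_left_mono) auto
  moreover have "exp (- x) * exp x = 1" by (simp flip: exp_add)
  moreover have "exp (- x) * exp (2 * x) = exp x" by (simp flip: exp_add)
  ultimately show ?thesis by (simp add: y_def distrib_left add_divide_distrib add.commute flip: mult.assoc)
qed

section \<open>The simple random walk on the integers and its tail\<close>

lemma pmf_srw_Suc: "pmf (srw (Suc t)) x = (pmf (srw t) (x - 1) + pmf (srw t) (x + 1)) / 2"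
proof -
  have "pmf (srw (Suc t)) x = measure_pmf.expectation (srw t) (\<lambda>y. pmf (pmf_of_set {y - 1, y + 1}) x)"
    by (simp add: pmf_bind)
  also have "(\<lambda>y. pmf (pmf_of_set {y - 1, y + 1}) x) = (\<lambda>y. (indicator {x - 1} y + indicator {x + 1} y) / 2)"
    by (rule ext) (auto simp: indicator_def)
  also have "measure_pmf.expectation (srw t) \<dots> = (pmf (srw t) (x - 1) + pmf (srw t) (x + 1)) / 2"
    by (simp add: Bochner_Integration.integral_add measure_pmf.integrable_const_bound[where B = 1] measure_pmf_single)
  finally show ?thesis .
qed

lemma pmf_srw_eq_0: "int t < \<bar>x\<bar> \<Longrightarrow> pmf (srw t) x = 0"
proof (induction t arbitrary: x)
  case (Suc t)
  then show ?case unfolding pmf_srw_Suc by simp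
qed simp

text \<open>The expectation of g at the position after t steps. The generic field serves both real
  tail bounds and complex amplitudes.\<close>

definition srw_sum :: "nat \<Rightarrow> (int \<Rightarrow> 'a) \<Rightarrow> 'a :: real_normed_field" where
  "srw_sum t g = (\<Sum>x\<in>{- int t..int t}. of_real (pmf (srw t) x) * g x)"

lemma srw_sum_superset:
  assumes "finite A" "{- int t..int t} \<subseteq> A"
  shows "(\<Sum>x\<in>A. of_real (pmf (srw t) x) * g x) = srw_sum t g"
  unfolding srw_sum_def
proof (intro sum.mono_neutral_right assms ballI)
  fix x assume "x \<in> A - {- int t..int t}"
  then have "int t < \<bar>x\<bar>" by auto
  then show "of_real (pmf (srw t) x) * g x = 0" by (simp add: pmf_srw_eq_0)
qed

lemma srw_sum_0: "srw_sum 0 g = g 0"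
  by (simp add: srw_sum_def)

text \<open>Index shifts move one step of the walk onto the integrand, so identities follow by
  induction on t.\<close>

lemma srw_sum_Suc: "srw_sum (Suc t) g = srw_sum t (\<lambda>x. (g (x - 1) + g (x + 1)) / 2)"
proof -
  let ?A = "{- int t - 1..int t + 1}"
  have "(\<Sum>x\<in>?A. of_real (pmf (srw t) (x - 1)) * g x) = (\<Sum>x\<in>(\<lambda>x. x - 1) ` ?A. of_real (pmf (srw t) x) * g (x + 1))"
    by (subst sum.reindex) (auto simp: inj_on_def)
  also have "\<dots> = srw_sum t (\<lambda>x. g (x + 1))"
    by (intro srw_sum_superset) auto
  finally have 1: "(\<Sum>x\<in>?A. of_real (pmf (srw t) (x - 1)) * g x) = srw_sum t (\<lambda>x. g (x + 1))" .
  have "(\<Sum>x\<in>?A. of_real (pmf (srw t) (x + 1)) * g x) = (\<Sum>x\<in>(\<lambda>x. x + 1) ` ?A. of_real (pmf (srw t) x) * g (x - 1))"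
    by (subst sum.reindex) (auto simp: inj_on_def)
  also have "\<dots> = srw_sum t (\<lambda>x. g (x - 1))"
    by (intro srw_sum_superset) auto
  finally have 2: "(\<Sum>x\<in>?A. of_real (pmf (srw t) (x + 1)) * g x) = srw_sum t (\<lambda>x. g (x - 1))" .
  have A: "{- int (Suc t)..int (Suc t)} = ?A" by auto
  have "srw_sum (Suc t) g = (\<Sum>x\<in>?A. (of_real (pmf (srw t) (x - 1)) * g x + of_real (pmf (srw t) (x + 1)) * g x) / 2)"
    unfolding srw_sum_def pmf_srw_Suc A by (intro sum.cong refl) (simp add: distrib_right)
  also have "\<dots> = (srw_sum t (\<lambda>x. g (x + 1)) + srw_sum t (\<lambda>x. g (x - 1))) / 2"
    unfolding sum_divide_distrib[symmetric] sum.distrib 1 2 ..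
  also have "\<dots> = srw_sum t (\<lambda>x. (g (x - 1) + g (x + 1)) / 2)"
    unfolding srw_sum_def sum.distrib[symmetric] sum_divide_distrib
    by (intro sum.cong refl) (simp add: distrib_left)
  finally show ?thesis .
qed

lemma srw_abs_eq_sum: "srw_abs t l = (\<Sum>x\<in>{x. \<bar>x\<bar> = int l}. pmf (srw t) x)"
proof -
  have "{x. \<bar>x\<bar> = int l} = {int l, - int l}" by auto
  then show ?thesis unfolding srw_abs_def by (intro measure_measure_pmf_finite) simp
qed

lemma srw_abs_nonneg: "0 \<le> srw_abs t l"
  by (simp add: srw_abs_def)

lemma sum_srw_abs:
  fixes F :: "nat \<Rightarrow> 'a :: real_normed_field"
  assumes "t \<le> L"
  shows "(\<Sum>l\<le>L. of_real (srw_abs t l) * F l) = srw_sum t (\<lambda>x. F (nat \<bar>x\<bar>))"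
proof -
  have "(\<Sum>l\<le>L. of_real (srw_abs t l) * F l)
      = (\<Sum>l\<le>L. \<Sum>x\<in>{x \<in> {- int L..int L}. nat \<bar>x\<bar> = l}. of_real (pmf (srw t) x) * F (nat \<bar>x\<bar>))"
  proof (intro sum.cong refl)
    fix l assume "l \<in> {..L}"
    then have "{x \<in> {- int L..int L}. nat \<bar>x\<bar> = l} = {x. \<bar>x\<bar> = int l}" by auto
    then show "of_real (srw_abs t l) * F l
        = (\<Sum>x\<in>{x \<in> {- int L..int L}. nat \<bar>x\<bar> = l}. of_real (pmf (srw t) x) * F (nat \<bar>x\<bar>))"
      by (simp add: srw_abs_eq_sum sum_distrib_right)
  qed
  also have "\<dots> = (\<Sum>x\<in>{- int L..int L}. of_real (pmf (srw t) x) * F (nat \<bar>x\<bar>))"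
    by (intro sum.group) auto
  also have "\<dots> = srw_sum t (\<lambda>x. F (nat \<bar>x\<bar>))"
    using assms by (intro srw_sum_superset) auto
  finally show ?thesis .
qed

lemma srw_sum_1: "srw_sum t (\<lambda>_. 1) = 1"
  by (induction t) (simp_all add: srw_sum_0 srw_sum_Suc)

lemma srw_sum_exp: "srw_sum t (\<lambda>x. exp (\<theta> * real_of_int x)) = ((exp \<theta> + exp (- \<theta>)) / 2) ^ t"
proof (induction t)
  case (Suc t)
  have "(\<lambda>x. (exp (\<theta> * real_of_int (x - 1)) + exp (\<theta> * real_of_int (x + 1))) / 2)
      = (\<lambda>x. exp (\<theta> * real_of_int x) * ((exp \<theta> + exp (- \<theta>)) / 2))"
  proof
    fix x
    have "exp (\<theta> * real_of_int (x - 1)) = exp (\<theta> * real_of_int x) * exp (- \<theta>)"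
      "exp (\<theta> * real_of_int (x + 1)) = exp (\<theta> * real_of_int x) * exp \<theta>"
      by (simp_all add: right_diff_distrib distrib_left flip: exp_add)
    then show "(exp (\<theta> * real_of_int (x - 1)) + exp (\<theta> * real_of_int (x + 1))) / 2
        = exp (\<theta> * real_of_int x) * ((exp \<theta> + exp (- \<theta>)) / 2)"
      by (simp add: distrib_left add_divide_distrib add.commute)
  qed
  then have "srw_sum (Suc t) (\<lambda>x. exp (\<theta> * real_of_int x))
      = srw_sum t (\<lambda>x. exp (\<theta> * real_of_int x)) * ((exp \<theta> + exp (- \<theta>)) / 2)"
    unfolding srw_sum_Suc by (simp only: srw_sum_def sum_distrib_right mult.assoc)
  then show ?case using Suc by simp
qed (simp add: srw_sum_0)

lemma srw_sum_mono:
  fixes g h :: "int \<Rightarrow> real"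
  shows "(\<And>x. g x \<le> h x) \<Longrightarrow> srw_sum t g \<le> srw_sum t h"
  unfolding srw_sum_def by (intro sum_mono mult_left_mono) auto

text \<open>Chernoff bound: exp (\<theta> x) + exp (- \<theta> x) dominates exp (\<theta> \<tau>)
  wherever |x| > \<tau>, and \<theta> = \<tau> / t minimizes the exponent - \<theta> \<tau> + t
  \<theta>^2 / 2.\<close>

lemma srw_tail:
  assumes "0 < t"
  shows "1 - (\<Sum>l\<le>\<tau>. srw_abs t l) \<le> 2 * exp (- (real \<tau>)\<^sup>2 / (2 * real t))"
proof -
  define \<theta> where "\<theta> = real \<tau> / real t"
  have \<theta>: "0 \<le> \<theta>" by (simp add: \<theta>_def)
  define L where "L = max t \<tau>"
  have "(\<Sum>l\<le>L. srw_abs t l) = 1"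
    using sum_srw_abs[of t L "\<lambda>_. 1 :: real"] srw_sum_1[where 'a = real] by (simp add: L_def)
  moreover have "(\<Sum>l\<le>\<tau>. srw_abs t l) = (\<Sum>l\<le>L. srw_abs t l * of_bool (l \<le> \<tau>))"
  proof -
    have "{..L} \<inter> {l. l \<le> \<tau>} = {..\<tau>}" by (auto simp: L_def)
    then show ?thesis by (simp add: sum_mult_of_bool_eq)
  qed
  moreover have split: "(\<Sum>l\<le>L. srw_abs t l) = (\<Sum>l\<le>L. srw_abs t l * of_bool (l \<le> \<tau>))
      + (\<Sum>l\<le>L. of_real (srw_abs t l) * of_bool (\<tau> < l))"
    unfolding sum.distrib[symmetric] by (intro sum.cong) auto
  ultimately have "1 - (\<Sum>l\<le>\<tau>. srw_abs t l) = (\<Sum>l\<le>L. of_real (srw_abs t l) * of_bool (\<tau> < l))"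
    using split by linarith
  also have "\<dots> = srw_sum t (\<lambda>x. of_bool (\<tau> < nat \<bar>x\<bar>))"
    by (rule sum_srw_abs) (simp add: L_def)
  also have "\<dots> \<le> srw_sum t (\<lambda>x. exp (- \<theta> * real \<tau>) * (exp (\<theta> * real_of_int x) + exp (- \<theta> * real_of_int x)))"
  proof (rule srw_sum_mono)
    fix x :: int
    show "of_bool (\<tau> < nat \<bar>x\<bar>) \<le> exp (- \<theta> * real \<tau>) * (exp (\<theta> * real_of_int x) + exp (- \<theta> * real_of_int x))"
    proof (cases "\<tau> < nat \<bar>x\<bar>")
      case True
      then have "\<theta> * real \<tau> \<le> \<theta> * \<bar>real_of_int x\<bar>" using \<theta> by (intro mult_left_mono) linarith+
      then have "exp (\<theta> * real \<tau>) \<le> exp (\<theta> * real_of_int x) + exp (- \<theta> * real_of_int x)"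
        by (cases "0 \<le> x") (auto intro: add_increasing add_increasing2)
      then have "exp (- \<theta> * real \<tau>) * exp (\<theta> * real \<tau>)
          \<le> exp (- \<theta> * real \<tau>) * (exp (\<theta> * real_of_int x) + exp (- \<theta> * real_of_int x))"
        by (intro mult_left_mono) auto
      then show ?thesis using True by (simp flip: exp_add)
    qed (simp add: add_nonneg_nonneg)
  qed
  also have "\<dots> = exp (- \<theta> * real \<tau>) * (srw_sum t (\<lambda>x. exp (\<theta> * real_of_int x)) + srw_sum t (\<lambda>x. exp (- \<theta> * real_of_int x)))"
    unfolding srw_sum_def sum.distrib[symmetric] sum_distrib_left
    by (intro sum.cong refl) (simp add: algebra_simps)
  also have "\<dots> = exp (- \<theta> * real \<tau>) * (2 * ((exp \<theta> + exp (- \<theta>)) / 2) ^ t)"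
    unfolding srw_sum_exp by (simp add: add.commute)
  also have "\<dots> \<le> exp (- \<theta> * real \<tau>) * (2 * exp (\<theta>\<^sup>2 / 2) ^ t)"
    using cosh_le_exp_half_square[OF \<theta>] by (intro mult_left_mono power_mono) (auto simp: add_nonneg_nonneg)
  also have "\<dots> = 2 * exp (- \<theta> * real \<tau> + real t * (\<theta>\<^sup>2 / 2))"
    by (simp only: exp_add exp_of_nat_mult mult.left_commute)
  also have "- \<theta> * real \<tau> + real t * (\<theta>\<^sup>2 / 2) = - (real \<tau>)\<^sup>2 / (2 * real t)"
    using assms by (simp add: \<theta>_def field_simps power2_eq_square)
  finally show ?thesis .
qed

text \<open>\<open>qff_length\<close> is chosen so that the Gaussian factor is at most the inverse
  of 8 sqrt N / \<eta>, hence at most \<eta> / 8. The case t = 0 is separate because the Gaussian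
  bound divides by t.\<close>

lemma qff_tail:
  assumes "0 < N" "0 < \<eta>" "\<eta> \<le> 1"
  shows "1 - (\<Sum>l\<le>qff_length N t \<eta>. srw_abs t l) \<le> \<eta> / 4"
proof (cases "t = 0")
  case True
  have "srw_abs 0 0 = 1" by (simp add: srw_abs_eq_sum)
  moreover have "srw_abs 0 0 \<le> (\<Sum>l\<le>qff_length N 0 \<eta>. srw_abs 0 l)"
    by (rule member_le_sum) (auto simp: srw_abs_nonneg)
  ultimately show ?thesis using True assms by simp
next
  case False
  define \<tau> where "\<tau> = qff_length N t \<eta>"
  define a where "a = 8 * sqrt (real N) / \<eta>"
  have "1 \<le> sqrt (real N)" using assms by simp
  then have a: "8 / \<eta> \<le> a" using assms by (simp add: a_def divide_right_mono)
  have "8 \<le> 8 / \<eta>" using assms by (simp add: pos_le_divide_eq)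
  then have a1: "1 \<le> a" using a by linarith
  have "sqrt (2 * real t * ln a) \<le> real \<tau>"
    unfolding \<tau>_def qff_length_def a_def by (rule real_nat_ceiling_ge)
  then have "2 * real t * ln a \<le> (real \<tau>)\<^sup>2"
    using a1 by (metis mult_nonneg_nonneg ln_ge_zero of_nat_0_le_iff real_sqrt_ge_0_iff real_sqrt_le_iff
      real_sqrt_abs abs_of_nat zero_le_numeral)
  then have "ln a \<le> (real \<tau>)\<^sup>2 / (2 * real t)"
    using False by (simp add: pos_le_divide_eq mult.commute)
  then have "exp (- (real \<tau>)\<^sup>2 / (2 * real t)) \<le> exp (- ln a)" by simp
  also have "\<dots> = 1 / a" using a1 by (simp add: exp_minus inverse_eq_divide)
  also have "\<dots> \<le> \<eta> / 8"
    using a a1 assms by (simp add: field_simps)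
  finally show ?thesis using srw_tail[of t \<tau>] False by (simp add: \<tau>_def)
qed

section \<open>Powers of the walk as averages of Chebyshev polynomials\<close>

context quantum_walk
begin

text \<open>P^t is the expectation of T_|X|(P) with X the position after t steps: multiplying T_l by
  its argument averages T_(l-1) and T_(l+1), which is exactly one step of the random walk when
  T_(-l) is read as T_l.\<close>

lemma walk_dist_eq_srw_sum:
  assumes "s < N" "i < N"
  shows "complex_of_real (walk_dist N d E t s i) = srw_sum t (\<lambda>x. flat_ampl s (nat \<bar>x\<bar>) i)"
  using assms(2)
proof (induction t arbitrary: i)
  case 0
  then show ?case by (simp add: walk_dist_def srw_sum_0 flat_ampl_0)
next
  case (Suc t)
  have step: "(\<Sum>j<N. complex_of_real (lazy_walk d E i j) * flat_ampl s (nat \<bar>x\<bar>) j)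
      = (flat_ampl s (nat \<bar>x - 1\<bar>) i + flat_ampl s (nat \<bar>x + 1\<bar>) i) / 2" for x
  proof -
    consider "x = 0" | l where "x = int (Suc l)" | l where "x = - int (Suc l)"
      by (metis int_cases2 not0_implies_Suc of_nat_0 neg_0_equal_iff_equal)
    then show ?thesis
    proof cases
      \<comment> \<open>Both neighbors of 0 have absolute value 1, so the claim is T_1(P) = P and
        not an instance of the recurrence.\<close>
      case 1
      then show ?thesis using Suc.prems assms
        by (simp add: flat_ampl_0 flat_ampl_1[unfolded One_nat_def] if_distrib of_bool_def cong: if_cong)
    next
      case (2 l)
      then have eqs: "nat \<bar>x\<bar> = Suc l" "nat \<bar>x - 1\<bar> = l" "nat \<bar>x + 1\<bar> = Suc (Suc l)" by auto
      show ?thesis unfolding eqs using flat_ampl_recurrence[OF Suc.prems, of s l]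
        by (simp add: add.commute)
    next
      case (3 l)
      then have eqs: "nat \<bar>x\<bar> = Suc l" "nat \<bar>x - 1\<bar> = Suc (Suc l)" "nat \<bar>x + 1\<bar> = l" by auto
      show ?thesis unfolding eqs using flat_ampl_recurrence[OF Suc.prems, of s l]
        by simp
    qed
  qed
  have "complex_of_real (walk_dist N d E (Suc t) s i)
      = (\<Sum>j<N. complex_of_real (lazy_walk d E i j) * complex_of_real (walk_dist N d E t s j))"
    by (simp add: walk_dist_def walk_step_def)
  also have "\<dots> = (\<Sum>j<N. complex_of_real (lazy_walk d E i j) * srw_sum t (\<lambda>x. flat_ampl s (nat \<bar>x\<bar>) j))"
    using Suc.IH by simp
  also have "\<dots> = srw_sum t (\<lambda>x. \<Sum>j<N. complex_of_real (lazy_walk d E i j) * flat_ampl s (nat \<bar>x\<bar>) j)"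
    unfolding srw_sum_def sum_distrib_left by (subst sum.swap) (simp add: mult_ac)
  also have "\<dots> = srw_sum (Suc t) (\<lambda>x. flat_ampl s (nat \<bar>x\<bar>) i)"
    unfolding step srw_sum_Suc ..
  finally show ?case .
qed

text \<open>The renormalized weights differ from the true ones by 2 (1 - \<Sigma>) in total: mass 1
  - \<Sigma> is cut off, and the same mass is redistributed below the cutoff. The tail bound makes
  this at most \<eta> / 2, and each flat amplitude vector has norm at most 1.\<close>

lemma walk_state_norm_estimate:
  fixes t :: nat
  assumes "s < N" "valid_prep prep" "0 < \<eta>" "\<eta> \<le> 1"
  defines "\<tau> \<equiv> qff_length N t \<eta>"
  defines "\<psi> \<equiv> walk_state \<tau> (prep t \<tau>) s"
  shows "ket_norm (full_basis N \<tau>) \<psi> = 1"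
    and "\<bar>ket_norm (full_basis N \<tau>) (op_app (full_basis N \<tau>) Pi_flat \<psi>) - L2_set (walk_dist N d E t s) {..<N}\<bar> \<le> \<eta> / 2"
proof -
  define \<Sigma> where "\<Sigma> = (\<Sum>l\<le>\<tau>. srw_abs t l)"
  have tail: "1 - \<Sigma> \<le> \<eta> / 4"
    unfolding \<Sigma>_def \<tau>_def using assms by (intro qff_tail) auto
  then have \<Sigma>_pos: "0 < \<Sigma>" using assms by linarith
  have prep: "unitary_on {..\<tau>} (prep t \<tau>)"
    "\<And>l. l \<le> \<tau> \<Longrightarrow> prep t \<tau> l 0 = complex_of_real (sqrt (srw_abs t l / \<Sigma>))"
    using assms(2) \<Sigma>_pos unfolding valid_prep_def \<Sigma>_def qff_weight_def by fastforce+
  show "ket_norm (full_basis N \<tau>) \<psi> = 1"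
    unfolding \<psi>_def by (rule ket_norm_walk_state[OF prep(1) assms(1)])
  \<comment> \<open>L covers both the support of the walk and the cutoff, so both expansions can be
    summed over the same range.\<close>
  define L where "L = max t \<tau>"
  define c where "c l = (if l \<le> \<tau> then srw_abs t l / \<Sigma> else 0) - srw_abs t l" for l
  have restrict: "(\<Sum>l\<le>L. if l \<le> \<tau> then g l else 0) = (\<Sum>l\<le>\<tau>. g l)" for g :: "nat \<Rightarrow> 'z :: comm_monoid_add"
  proof -
    have "{..L} \<inter> {l. l \<le> \<tau>} = {..\<tau>}" by (auto simp: L_def)
    then show ?thesis by (simp add: sum.If_cases)
  qed
  have total: "(\<Sum>l\<le>L. srw_abs t l) = 1"
    using sum_srw_abs[of t L "\<lambda>_. 1 :: real"] srw_sum_1[where 'a = real] by (simp add: L_def)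
  have "\<Sigma> \<le> 1"
    unfolding \<Sigma>_def total[symmetric] by (intro sum_mono2) (auto simp: L_def srw_abs_nonneg)
  have "(\<Sum>l\<le>L. \<bar>c l\<bar>) = (\<Sum>l\<le>L. srw_abs t l + (if l \<le> \<tau> then srw_abs t l / \<Sigma> - 2 * srw_abs t l else 0))"
  proof (intro sum.cong refl)
    fix l
    have "srw_abs t l \<le> srw_abs t l / \<Sigma>"
      using \<Sigma>_pos \<open>\<Sigma> \<le> 1\<close> srw_abs_nonneg[of t l] by (simp add: pos_le_divide_eq mult_left_le)
    then show "\<bar>c l\<bar> = srw_abs t l + (if l \<le> \<tau> then srw_abs t l / \<Sigma> - 2 * srw_abs t l else 0)"
      using srw_abs_nonneg[of t l] by (simp add: c_def)
  qed
  also have "\<dots> = 1 + (\<Sum>l\<le>\<tau>. srw_abs t l / \<Sigma> - 2 * srw_abs t l)"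
    by (simp add: sum.distrib total restrict)
  also have "\<dots> = 2 * (1 - \<Sigma>)"
    using \<Sigma>_pos by (simp add: sum_subtractf sum_divide_distrib[symmetric] sum_distrib_left[symmetric] \<Sigma>_def[symmetric])
  finally have c_sum: "(\<Sum>l\<le>L. \<bar>c l\<bar>) = 2 * (1 - \<Sigma>)" .
  have flat: "\<psi> ((i, None), 0) = (\<Sum>l\<le>\<tau>. complex_of_real (srw_abs t l / \<Sigma>) * flat_ampl s l i)" if "i < N" for i
    unfolding \<psi>_def using prep(2) \<Sigma>_pos that assms(1)
    by (intro walk_state_flat) (auto simp: srw_abs_nonneg)
  have "ket_norm {..<N} (\<lambda>i. \<psi> ((i, None), 0) - complex_of_real (walk_dist N d E t s i))
      = ket_norm {..<N} (\<lambda>i. \<Sum>l\<le>L. complex_of_real (c l) * flat_ampl s l i)"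
  proof (rule ket_norm_cong)
    fix i assume i: "i \<in> {..<N}"
    have "complex_of_real (walk_dist N d E t s i) = (\<Sum>l\<le>L. complex_of_real (srw_abs t l) * flat_ampl s l i)"
      using i assms sum_srw_abs[of t L "\<lambda>l. flat_ampl s l i"] by (simp add: walk_dist_eq_srw_sum L_def)
    moreover have "\<psi> ((i, None), 0)
        = (\<Sum>l\<le>L. if l \<le> \<tau> then complex_of_real (srw_abs t l / \<Sigma>) * flat_ampl s l i else 0)"
      using i by (simp add: flat restrict)
    ultimately show "\<psi> ((i, None), 0) - complex_of_real (walk_dist N d E t s i)
        = (\<Sum>l\<le>L. complex_of_real (c l) * flat_ampl s l i)"
      by (simp add: sum_subtractf[symmetric]) (intro sum.cong, auto simp: c_def algebra_simps)
  qed
  also have "\<dots> \<le> (\<Sum>l\<le>L. ket_norm {..<N} (\<lambda>i. complex_of_real (c l) * flat_ampl s l i))"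
    by (rule ket_norm_sum_le)
  also have "\<dots> \<le> (\<Sum>l\<le>L. \<bar>c l\<bar>)"
    using flat_ampl_norm[OF assms(1)] by (intro sum_mono) (simp add: ket_norm_scale mult_left_le)
  finally have "ket_norm {..<N} (\<lambda>i. \<psi> ((i, None), 0) - complex_of_real (walk_dist N d E t s i)) \<le> \<eta> / 2"
    using c_sum tail by simp
  moreover have "ket_norm {..<N} (\<lambda>i. complex_of_real (walk_dist N d E t s i)) = L2_set (walk_dist N d E t s) {..<N}"
    by (simp add: ket_norm_def L2_set_def)
  ultimately show "\<bar>ket_norm (full_basis N \<tau>) (op_app (full_basis N \<tau>) Pi_flat \<psi>) - L2_set (walk_dist N d E t s) {..<N}\<bar> \<le> \<eta> / 2"
    using ket_norm_diff_le[of "{..<N}" "\<lambda>i. \<psi> ((i, None), 0)" "\<lambda>i. complex_of_real (walk_dist N d E t s i)"]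
    unfolding ket_norm_Pi_flat by simp
qed

end

section \<open>The tester loop\<close>

lemma edges_of_adjacency_lists:
  assumes graph: "bounded_graph N d E" and nb: "adjacency_lists N d E nb"
  shows "edges_of N d nb = E"
proof
  show "edges_of N d nb \<subseteq> E"
  proof
    fix e assume "e \<in> edges_of N d nb"
    then obtain v w i where e: "e = {v, w}" "v < N" "i < d" "nb v i = Some w" by (auto simp: edges_of_def)
    have i: "i < node_degree E v"
      using nb e unfolding adjacency_lists_def by (metis not_le option.distinct(1))
    have "nb v ` {..<node_degree E v} = Some ` neighbors E v"
      using nb e by (simp add: adjacency_lists_def bij_betw_def)
    then have "Some w \<in> Some ` neighbors E v" using e(4) i by (metis imageI lessThan_iff)
    then show "e \<in> E" using e by (auto simp: neighbors_def)
  qed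
  show "E \<subseteq> edges_of N d nb"
  proof
    fix e assume "e \<in> E"
    then have "card e = 2" "e \<subseteq> {..<N}" using graph by (auto simp: bounded_graph_def)
    then obtain v w where e: "e = {v, w}" "v < N" by (auto simp: card_2_iff)
    then have "Some w \<in> nb v ` {..<node_degree E v}"
      using nb \<open>e \<in> E\<close> by (auto simp: adjacency_lists_def bij_betw_def neighbors_def)
    then obtain i where i: "i < node_degree E v" "nb v i = Some w" by force
    moreover have "node_degree E v \<le> d" using graph e by (simp add: bounded_graph_def)
    ultimately have "i < d" by simp
    then show "e \<in> edges_of N d nb" using e i unfolding edges_of_def by blast
  qed
qed

definition survival :: "nat \<Rightarrow> (nat \<Rightarrow> (real \<times> nat \<times> nat) pmf) \<Rightarrow> real \<Rightarrow> real" where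
  "survival N est b = (\<Sum>s<N. measure_pmf.prob (est s) {(a, q, h). a \<le> b}) / real N"

text \<open>The rounds are independent, and the loop accepts only if each of them survives its
  comparison.\<close>

lemma tester_loop_accept:
  assumes "0 < N"
  shows "pmf (map_pmf fst (tester_loop X N d nb p n)) True
    = survival N (\<lambda>s. norm_estimator X N d nb s (walk_steps p) (precision p) (confidence p))
        (threshold p + precision p) ^ n"
proof (induction n)
  case (Suc n)
  let ?est = "\<lambda>s. norm_estimator X N d nb s (walk_steps p) (precision p) (confidence p)"
  let ?b = "threshold p + precision p"
  let ?acc = "pmf (map_pmf fst (tester_loop X N d nb p n)) True"
  have inner: "pmf (map_pmf fst (if a > ?b then return_pmf (False, q, h + 3)
      else map_pmf (\<lambda>(b, q', h'). (b, q + q', h + 2 + h')) (tester_loop X N d nb p n))) True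
    = indicator {(a, q, h). a \<le> ?b} (a, q, h) * ?acc" for a and q h :: nat
    by (auto simp: map_pmf_comp case_prod_beta indicator_def)
  have one: "pmf (bind_pmf (?est s) (\<lambda>x. map_pmf fst (case x of (a, q, h) \<Rightarrow>
        if a > ?b then return_pmf (False, q, h + 3)
        else map_pmf (\<lambda>(b, q', h'). (b, q + q', h + 2 + h')) (tester_loop X N d nb p n)))) True
    = measure_pmf.prob (?est s) {(a, q, h). a \<le> ?b} * ?acc" for s
  proof -
    have "pmf (bind_pmf (?est s) (\<lambda>x. map_pmf fst (case x of (a, q, h) \<Rightarrow>
        if a > ?b then return_pmf (False, q, h + 3)
        else map_pmf (\<lambda>(b, q', h'). (b, q + q', h + 2 + h')) (tester_loop X N d nb p n)))) True
      = measure_pmf.expectation (?est s) (\<lambda>x. indicator {(a, q, h). a \<le> ?b} x * ?acc)"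
      unfolding pmf_bind
    proof (rule Bochner_Integration.integral_cong[OF refl])
      fix x :: "real \<times> nat \<times> nat"
      show "pmf (map_pmf fst (case x of (a, q, h) \<Rightarrow> if a > ?b then return_pmf (False, q, h + 3)
        else map_pmf (\<lambda>(b, q', h'). (b, q + q', h + 2 + h')) (tester_loop X N d nb p n))) True
        = indicator {(a, q, h). a \<le> ?b} x * ?acc"
        by (cases x) (simp only: prod.case inner)
    qed
    then show ?thesis by simp
  qed
  have "pmf (map_pmf fst (tester_loop X N d nb p (Suc n))) True
    = measure_pmf.expectation (pmf_of_set {..<N}) (\<lambda>s. measure_pmf.prob (?est s) {(a, q, h). a \<le> ?b} * ?acc)"
    unfolding tester_loop.simps map_bind_pmf by (subst pmf_bind) (simp only: one)
  also have "\<dots> = (\<Sum>s<N. measure_pmf.prob (?est s) {(a, q, h). a \<le> ?b} * ?acc) / real N"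
    using assms by (subst integral_pmf_of_set) auto
  also have "\<dots> = survival N ?est ?b * ?acc"
    by (simp add: survival_def sum_distrib_right)
  finally show ?case using Suc by simp
qed simp

lemma survival_ge:
  assumes "0 < N" and est: "\<And>s. s < N \<Longrightarrow> 1 - \<delta> \<le> measure_pmf.prob (est s) {(a, q, h). \<bar>a - v s\<bar> \<le> \<eta>}"
    and "\<And>s. s < N \<Longrightarrow> v s + \<eta> \<le> b"
  shows "1 - \<delta> \<le> survival N est b"
proof -
  have "(\<Sum>s<N. 1 - \<delta>) \<le> (\<Sum>s<N. measure_pmf.prob (est s) {(a, q, h). a \<le> b})"
  proof (rule sum_mono)
    fix s assume s: "s \<in> {..<N}"
    then have "v s + \<eta> \<le> b" using assms by simp
    then have "{(a, q, h). \<bar>a - v s\<bar> \<le> \<eta>} \<subseteq> {(a, q, h). a \<le> b}" by auto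
    then show "1 - \<delta> \<le> measure_pmf.prob (est s) {(a, q, h). a \<le> b}"
      using s by (intro order_trans[OF est measure_pmf.finite_measure_mono]) auto
  qed
  then show ?thesis using assms(1) by (simp add: survival_def pos_le_divide_eq mult.commute)
qed

text \<open>From a heavy start the estimate stays within \<eta> with probability at least 1/2 and
  then exceeds b, so such a start survives with probability at most 1/2.\<close>

lemma survival_le:
  assumes "0 < N" and est: "\<And>s. s < N \<Longrightarrow> 1 - \<delta> \<le> measure_pmf.prob (est s) {(a, q, h). \<bar>a - v s\<bar> \<le> \<eta>}"
    and heavy: "h * real N \<le> real (card {s \<in> {..<N}. b + \<eta> < v s})" and "\<delta> \<le> 1 / 2"
  shows "survival N est b \<le> 1 - h / 2"
proof -
  define H where "H = {s \<in> {..<N}. b + \<eta> < v s}"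
  have "(\<Sum>s<N. measure_pmf.prob (est s) {(a, q, h). a \<le> b}) \<le> (\<Sum>s<N. 1 - of_bool (s \<in> H) * (1 / 2))"
  proof (rule sum_mono)
    fix s assume s: "s \<in> {..<N}"
    show "measure_pmf.prob (est s) {(a, q, h). a \<le> b} \<le> 1 - of_bool (s \<in> H) * (1 / 2)"
    proof (cases "s \<in> H")
      case True
      then have "{(a, q, h). a \<le> b} \<subseteq> UNIV - {(a, q, h). \<bar>a - v s\<bar> \<le> \<eta>}" by (auto simp: H_def)
      then have "measure_pmf.prob (est s) {(a, q, h). a \<le> b} \<le> measure_pmf.prob (est s) (UNIV - {(a, q, h). \<bar>a - v s\<bar> \<le> \<eta>})"
        by (intro measure_pmf.finite_measure_mono) auto
      also have "\<dots> = 1 - measure_pmf.prob (est s) {(a, q, h). \<bar>a - v s\<bar> \<le> \<eta>}"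
        using measure_pmf.prob_compl[of "{(a, q, h). \<bar>a - v s\<bar> \<le> \<eta>}" "est s"] by simp
      finally show ?thesis using est[of s] s True assms(4) by simp
    qed simp
  qed
  also have "\<dots> = real N - real (card H) / 2"
  proof -
    have "{..<N} \<inter> {s. s \<in> H} = H" by (auto simp: H_def)
    then show ?thesis by (simp add: sum_subtractf sum_divide_distrib[symmetric])
  qed
  also have "\<dots> \<le> (1 - h / 2) * real N" using heavy by (simp add: H_def algebra_simps)
  finally show ?thesis using assms(1) by (simp add: survival_def pos_divide_le_eq)
qed

text \<open>An aborting round has overhead 3, a continuing one 2; the final 1 is the output after
  the last round.\<close>

lemma tester_loop_cost:
  assumes "0 < N"
    and cost: "\<And>s a q h. s < N \<Longrightarrow>
      (a, q, h) \<in> set_pmf (norm_estimator X N d nb s (walk_steps p) (precision p) (confidence p)) \<Longrightarrow>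
      real q \<le> Q \<and> real h \<le> H"
    and "0 \<le> Q" "0 \<le> H"
    and "(b, q, h) \<in> set_pmf (tester_loop X N d nb p n)"
  shows "real q \<le> real n * Q \<and> real h \<le> real n * (H + 3) + 1"
  using assms(5)
proof (induction n arbitrary: b q h)
  case (Suc n)
  have "set_pmf (pmf_of_set {..<N}) = {..<N}" using assms(1) by (intro set_pmf_of_set) auto
  then obtain s a q1 h1 where s: "s < N"
    and est: "(a, q1, h1) \<in> set_pmf (norm_estimator X N d nb s (walk_steps p) (precision p) (confidence p))"
    and step: "(b, q, h) \<in> set_pmf (if a > threshold p + precision p then return_pmf (False, q1, h1 + 3)
      else map_pmf (\<lambda>(b, q', h'). (b, q1 + q', h1 + 2 + h')) (tester_loop X N d nb p n))"
    using Suc.prems by (auto simp: set_bind_pmf)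
  have c1: "real q1 \<le> Q" "real h1 \<le> H" using cost[OF s est] by auto
  show ?case
  proof (cases "a > threshold p + precision p")
    case True
    then have eqs: "q = q1" "h = h1 + 3" using step by auto
    have "0 \<le> real n * Q" "0 \<le> real n * (H + 3)" using assms by auto
    moreover have "real (Suc n) * Q = Q + real n * Q" "real (Suc n) * (H + 3) = H + 3 + real n * (H + 3)"
      by (simp_all add: algebra_simps)
    moreover have "real (h1 + 3) = real h1 + 3" by simp
    ultimately show ?thesis using c1 unfolding eqs by linarith
  next
    case False
    then obtain q' h' where t: "(b, q', h') \<in> set_pmf (tester_loop X N d nb p n)"
      and eqs: "q = q1 + q'" "h = h1 + 2 + h'" using step by auto
    show ?thesis using Suc.IH[OF t] c1 unfolding eqs by (simp add: algebra_simps)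
  qed
qed simp

section \<open>Accuracy and cost of the norm estimator\<close>

locale tester_input =
  fixes X :: primitives and N d :: nat and E :: "nat set set" and nb :: access
  assumes X: "valid_primitives X" and N: "1 \<le> N" and d: "1 \<le> d"
    and graph: "bounded_graph N d E" and nb: "adjacency_lists N d E nb"
begin

sublocale quantum_walk N d E "coin_op X N d nb"
  using X N d graph nb by unfold_locales (simp_all add: valid_primitives_def)

lemma norm_estimator_eq:
  "norm_estimator X N d nb s t \<eta> \<delta> =
     (let \<tau> = qff_length N t \<eta>; q = W_tau_queries X N d \<tau>; h = W_tau_time X N d \<tau>
      in map_pmf (\<lambda>(a, r, r'). (a, q + r * (2 * q), h + r * (2 * h + 1) + r'))
           (ampl_est X (full_basis N \<tau>) (walk_state \<tau> (prep_op X t \<tau>) s) Pi_flat (\<eta> / 2) \<delta>))"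
  unfolding norm_estimator_def walk_state_def edges_of_adjacency_lists[OF graph nb] Let_def ..

text \<open>One half of the error \<eta> comes from truncating the random walk, the other from
  amplitude estimation.\<close>

lemma norm_estimator_accurate:
  assumes "s < N" "0 < \<eta>" "\<eta> \<le> 1" "0 < \<delta>" "\<delta> \<le> 1 / 2"
  shows "1 - \<delta> \<le> measure_pmf.prob (norm_estimator X N d nb s t \<eta> \<delta>)
    {(a, q, h). \<bar>a - L2_set (walk_dist N d E t s) {..<N}\<bar> \<le> \<eta>}"
proof -
  define \<tau> where "\<tau> = qff_length N t \<eta>"
  define \<psi> where "\<psi> = walk_state \<tau> (prep_op X t \<tau>) s"
  let ?ae = "ampl_est X (full_basis N \<tau>) \<psi> Pi_flat (\<eta> / 2) \<delta>"
  have "valid_prep (prep_op X)" using X by (simp add: valid_primitives_def)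
  then have \<psi>: "ket_norm (full_basis N \<tau>) \<psi> = 1"
    "\<bar>ket_norm (full_basis N \<tau>) (op_app (full_basis N \<tau>) Pi_flat \<psi>) - L2_set (walk_dist N d E t s) {..<N}\<bar> \<le> \<eta> / 2"
    using walk_state_norm_estimate[of s "prep_op X" \<eta> t] assms unfolding \<psi>_def \<tau>_def by auto
  have "1 - \<delta> \<le> measure_pmf.prob ?ae {(a, r, r'). \<bar>a - ket_norm (full_basis N \<tau>) (op_app (full_basis N \<tau>) Pi_flat \<psi>)\<bar> \<le> \<eta> / 2}"
  proof -
    have "amplitude_estimation (ampl_est X)" using X by (simp add: valid_primitives_def)
    moreover have "finite (full_basis N \<tau>) \<and> ket_norm (full_basis N \<tau>) \<psi> = 1 \<and> projector_on (full_basis N \<tau>) Pi_flat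
        \<and> 0 < \<eta> / 2 \<and> \<eta> / 2 \<le> 1 \<and> 0 < \<delta> \<and> \<delta> \<le> 1 / 2"
      using \<psi>(1) assms projector_Pi_flat by auto
    ultimately show ?thesis unfolding amplitude_estimation_def by blast
  qed
  also have "\<dots> \<le> measure_pmf.prob ?ae {(a, r, r'). \<bar>a - L2_set (walk_dist N d E t s) {..<N}\<bar> \<le> \<eta>}"
  proof (rule measure_pmf.finite_measure_mono)
    have "\<bar>a - L2_set (walk_dist N d E t s) {..<N}\<bar> \<le> \<eta>"
      if "\<bar>a - ket_norm (full_basis N \<tau>) (op_app (full_basis N \<tau>) Pi_flat \<psi>)\<bar> \<le> \<eta> / 2" for a
      using that \<psi>(2) by linarith
    then show "{(a, r, r'). \<bar>a - ket_norm (full_basis N \<tau>) (op_app (full_basis N \<tau>) Pi_flat \<psi>)\<bar> \<le> \<eta> / 2}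
        \<subseteq> {(a, r, r'). \<bar>a - L2_set (walk_dist N d E t s) {..<N}\<bar> \<le> \<eta>}" by auto
  qed simp
  also have "\<dots> = measure_pmf.prob (norm_estimator X N d nb s t \<eta> \<delta>)
      {(a, q, h). \<bar>a - L2_set (walk_dist N d E t s) {..<N}\<bar> \<le> \<eta>}"
    unfolding norm_estimator_eq Let_def \<psi>_def \<tau>_def measure_map_pmf
    by (intro arg_cong[where f = "measure_pmf.prob _"]) auto
  finally show ?thesis .
qed

text \<open>One application creates the state, and each reflection around it takes two more, so R
  bounds 1 + 2 (r + r'). The factor 4 combines this 2 with the estimation error \<eta> / 2.\<close>

lemma norm_estimator_cost:
  assumes C: "\<And>B \<psi> R \<epsilon>\<^sub>0 \<delta>. finite B \<Longrightarrow> ket_norm B \<psi> = 1 \<Longrightarrow> projector_on B R \<Longrightarrow> 0 < \<epsilon>\<^sub>0 \<Longrightarrow> \<epsilon>\<^sub>0 \<le> 1 \<Longrightarrow>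
      0 < \<delta> \<Longrightarrow> \<delta> \<le> 1 / 2 \<Longrightarrow>
      \<forall>(a, r, r') \<in> set_pmf (ampl_est X B \<psi> R \<epsilon>\<^sub>0 \<delta>). real (r + r') \<le> C * ln (1 / \<delta>) / \<epsilon>\<^sub>0"
    and C': "real (walk_queries X N d) \<le> C' * sqrt (real d)" "real (walk_time X N d) \<le> C' * sqrt (real d)"
    and s: "s < N" "0 < \<eta>" "\<eta> \<le> 1" "0 < \<delta>" "\<delta> \<le> 1 / 2"
    and out: "(a, q, h) \<in> set_pmf (norm_estimator X N d nb s t \<eta> \<delta>)"
  defines "R \<equiv> 1 + 4 * (C * ln (1 / \<delta>) / \<eta>)"
  shows "real q \<le> R * (real (qff_length N t \<eta>) * (C' * sqrt (real d)))"
    and "real h \<le> R * (3 + 2 * real (qff_length N t \<eta>) + real (qff_length N t \<eta>) * (C' * sqrt (real d)))"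
proof -
  define \<tau> where "\<tau> = qff_length N t \<eta>"
  define \<psi> where "\<psi> = walk_state \<tau> (prep_op X t \<tau>) s"
  let ?q = "W_tau_queries X N d \<tau>" and ?h = "W_tau_time X N d \<tau>"
  have "valid_prep (prep_op X)" using X by (simp add: valid_primitives_def)
  then have \<psi>: "ket_norm (full_basis N \<tau>) \<psi> = 1"
    using walk_state_norm_estimate(1)[of s "prep_op X" \<eta> t] s unfolding \<psi>_def \<tau>_def by auto
  obtain r r' where r: "(a, r, r') \<in> set_pmf (ampl_est X (full_basis N \<tau>) \<psi> Pi_flat (\<eta> / 2) \<delta>)"
    and q: "q = ?q + r * (2 * ?q)" and h: "h = ?h + r * (2 * ?h + 1) + r'"
    using out by (auto simp: norm_estimator_eq Let_def \<psi>_def \<tau>_def)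
  have "real (r + r') \<le> C * ln (1 / \<delta>) / (\<eta> / 2)"
    using C[OF finite_full_basis \<psi> projector_Pi_flat, of "\<eta> / 2" \<delta>] r s by auto
  then have R: "1 + 2 * real (r + r') \<le> R" by (simp add: R_def)
  have R0: "0 \<le> R" using R by linarith
  have "real q = (1 + 2 * real r) * real ?q" by (simp add: q algebra_simps)
  also have "\<dots> \<le> R * real ?q" using R by (intro mult_right_mono) auto
  also have "\<dots> \<le> R * (real \<tau> * (C' * sqrt (real d)))"
    unfolding W_tau_queries_def of_nat_mult using C'(1) R0 by (intro mult_left_mono) auto
  finally show "real q \<le> R * (real (qff_length N t \<eta>) * (C' * sqrt (real d)))" by (simp add: \<tau>_def)
  have "real h \<le> (1 + 2 * real (r + r')) * (1 + real ?h)" by (simp add: h algebra_simps)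
  also have "\<dots> \<le> R * (1 + real ?h)" using R by (intro mult_right_mono) auto
  also have "\<dots> \<le> R * (3 + 2 * real \<tau> + real \<tau> * (C' * sqrt (real d)))"
  proof (intro mult_left_mono R0)
    have "real \<tau> * real (walk_time X N d) \<le> real \<tau> * (C' * sqrt (real d))"
      using C'(2) by (intro mult_left_mono) auto
    then show "1 + real ?h \<le> 3 + 2 * real \<tau> + real \<tau> * (C' * sqrt (real d))"
      by (simp add: W_tau_time_def)
  qed
  finally show "real h \<le> R * (3 + 2 * real (qff_length N t \<eta>) + real (qff_length N t \<eta>) * (C' * sqrt (real d)))"
    by (simp add: \<tau>_def)
qed

end

section \<open>Parameters\<close>

text \<open>Cheeger's gap \<Upsilon>^2 / (4 d^2) times this number is at least 10 ln N, so on an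
  expander the squared deviation from uniform is at most N^(-10).\<close>

definition steps :: "nat \<Rightarrow> nat \<Rightarrow> real \<Rightarrow> nat" where
  "steps N d \<Upsilon> = nat \<lceil>40 * ((real d)\<^sup>2 / \<Upsilon>\<^sup>2 * ln (real N))\<rceil>"

definition expander_norm :: "nat \<Rightarrow> real" where
  "expander_norm N = sqrt (1 / real N + 1 / real N ^ 10)"

text \<open>The factor 1/1024 makes a norm within twice this value of \<open>expander_norm\<close>
  have a squared excess of at most N^(-\<mu>) / 64 relative to 1/N.\<close>

definition accuracy :: "nat \<Rightarrow> real \<Rightarrow> real" where
  "accuracy N \<mu> = real N powr (- 1 / 2 - \<mu>) / 1024"

text \<open>A graph with degree bound \<open>d\<close> and expansion \<open>\<Upsilon> > d\<close> has a single node, so for \<open>\<Upsilon> > d\<close> and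
  \<open>N \<ge> 2\<close> the tester has to reject: no step is made and the estimated norm is 1. For \<open>N = 1\<close> it has
  to accept.\<close>

definition test_params :: "nat \<Rightarrow> nat \<Rightarrow> real \<Rightarrow> real \<Rightarrow> real \<Rightarrow> tester_params" where
  "test_params N d \<Upsilon> \<epsilon> \<mu> =
    \<lparr>walk_steps = if \<Upsilon> \<le> real d then steps N d \<Upsilon> else 0,
     threshold = if \<Upsilon> \<le> real d then expander_norm N else 0,
     precision = accuracy N \<mu>,
     confidence = \<epsilon> / 99,
     repetitions = if N = 1 then 0 else nat \<lceil>32 / \<epsilon>\<rceil>\<rparr>"

lemma ln_ge_half: "2 \<le> N \<Longrightarrow> 1 / 2 \<le> ln (real N)"
proof -
  assume "2 \<le> N"
  have "1 / 2 \<le> ln (2 :: real)" using ln_2_less_1 ln2_ge_two_thirds by simp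
  also have "\<dots> \<le> ln (real N)" using \<open>2 \<le> N\<close> by simp
  finally show ?thesis .
qed

lemma nat_ceiling_le: "0 \<le> x \<Longrightarrow> real (nat \<lceil>x\<rceil>) \<le> x + 1"
  by linarith

text \<open>Rounding up costs 1, which is absorbed since d^2 / \<Upsilon>^2 * ln N \<ge> 1/2 for N
  \<ge> 2; hence 42 = 40 + 2. For N = 1 both sides vanish.\<close>

lemma steps_le:
  assumes "1 \<le> N" "0 < \<Upsilon>" "\<Upsilon> \<le> real d"
  shows "real (steps N d \<Upsilon>) \<le> 42 * ((real d)\<^sup>2 / \<Upsilon>\<^sup>2 * ln (real N))"
proof (cases "N = 1")
  case True then show ?thesis by (simp add: steps_def)
next
  case False
  have "\<Upsilon>\<^sup>2 \<le> (real d)\<^sup>2" using assms by (intro power_mono) auto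
  then have "1 \<le> (real d)\<^sup>2 / \<Upsilon>\<^sup>2" using assms by (simp add: pos_le_divide_eq)
  moreover have "1 / 2 \<le> ln (real N)" using ln_ge_half[of N] False assms by simp
  ultimately have "1 * (1 / 2) \<le> (real d)\<^sup>2 / \<Upsilon>\<^sup>2 * ln (real N)"
    by (intro mult_mono) auto
  then show ?thesis
    unfolding steps_def using nat_ceiling_le[of "40 * ((real d)\<^sup>2 / \<Upsilon>\<^sup>2 * ln (real N))"] by linarith
qed

lemma accuracy_pos: "1 \<le> N \<Longrightarrow> 0 < accuracy N \<mu>"
  by (simp add: accuracy_def)

lemma accuracy_le_1:
  assumes "1 \<le> N" "0 \<le> \<mu>"
  shows "accuracy N \<mu> \<le> 1"
proof -
  have "real N powr (- 1 / 2 - \<mu>) \<le> real N powr 0" using assms by (intro powr_mono) auto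
  then show ?thesis using assms by (simp add: accuracy_def)
qed

lemma test_params_of_order: "params_of_order test_params"
  unfolding params_of_order_def
\<comment> \<open>42 comes from \<open>steps_le\<close>; the other orders hold with room to
  spare.\<close>
proof (intro exI[of _ 42] allI impI)
  fix N d :: nat and \<Upsilon> \<epsilon> \<mu> :: real
  assume A: "1 \<le> N \<and> 3 \<le> d \<and> 0 < \<Upsilon> \<and> 0 < \<epsilon> \<and> \<epsilon> < 1 \<and> 0 < \<mu> \<and> \<mu> < 1 / 4"
  let ?p = "test_params N d \<Upsilon> \<epsilon> \<mu>"
  have "real (walk_steps ?p) \<le> 42 * ((real d)\<^sup>2 / \<Upsilon>\<^sup>2 * ln (real N))"
    using A steps_le[of N \<Upsilon> d] by (auto simp: test_params_def)
  moreover have "threshold ?p \<le> 42 * real N powr (- 1 / 2)"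
  proof -
    have "real N ^ 1 \<le> real N ^ 10" using A by (intro power_increasing) auto
    then have "1 / real N + 1 / real N ^ 10 \<le> 1 / real N + 1 / real N"
      using A by (intro add_left_mono divide_left_mono) auto
    also have "\<dots> \<le> 4 / real N" by (simp add: divide_right_mono add_divide_distrib[symmetric])
    finally have "expander_norm N \<le> sqrt (4 / real N)" unfolding expander_norm_def by (rule real_sqrt_le_mono)
    also have "\<dots> = 2 * real N powr (- 1 / 2)"
    proof -
      have "real N powr - (1 / 2) = 1 / sqrt (real N)"
        by (simp only: powr_minus powr_half_sqrt of_nat_0_le_iff inverse_eq_divide)
      then show ?thesis by (simp add: real_sqrt_divide)
    qed
    also have "\<dots> \<le> 42 * real N powr (- 1 / 2)" by simp
    finally show ?thesis by (simp add: test_params_def)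
  qed
  moreover have "0 \<le> threshold ?p" by (simp add: test_params_def expander_norm_def)
  moreover have "0 < precision ?p" "precision ?p \<le> 42 * real N powr (- 1 / 2 - \<mu>)"
    using A by (simp_all add: test_params_def accuracy_def)
  moreover have "0 < confidence ?p" "confidence ?p < 1" "confidence ?p \<le> 42 * \<epsilon>"
    using A by (simp_all add: test_params_def)
  moreover have "real (repetitions ?p) \<le> 42 / \<epsilon>"
  proof -
    have "1 \<le> 1 / \<epsilon>" using A by simp
    then have "32 / \<epsilon> + 1 \<le> 42 / \<epsilon>" using A by (simp add: field_simps)
    moreover have "0 \<le> 42 / \<epsilon>" using A by simp
    ultimately show ?thesis
      using order_trans[OF of_int_ceiling_le_add_one[of "32 / \<epsilon>"]] A by (auto simp: test_params_def)
  qed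
  ultimately show "let p = ?p in
           real (walk_steps p) \<le> 42 * ((real d)\<^sup>2 / \<Upsilon>\<^sup>2 * ln (real N)) \<and>
           0 \<le> threshold p \<and> threshold p \<le> 42 * real N powr (- 1 / 2) \<and>
           0 < precision p \<and> precision p \<le> 42 * real N powr (- 1 / 2 - \<mu>) \<and>
           0 < confidence p \<and> confidence p < 1 \<and> confidence p \<le> 42 * \<epsilon> \<and>
           real (repetitions p) \<le> 42 / \<epsilon>"
    by (simp add: Let_def)
qed

text \<open>Everything is measured in r = N^(-1/2) and m = N^(-\<mu>). The term N^(-10) is below m
  r^2 / 256 because 1/N \<le> m and N^(-8) \<le> 1/256.\<close>

lemma light_square_le:
  assumes N: "2 \<le> N" and \<mu>: "0 < \<mu>" "\<mu> < 1 / 4" and x: "0 \<le> x" "x \<le> expander_norm N + 2 * accuracy N \<mu>"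
  shows "x\<^sup>2 \<le> 1 / real N + real N powr - \<mu> / 64 / real N"
proof -
  define r where "r = real N powr (- 1 / 2)"
  define m where "m = real N powr (- \<mu>)"
  have N_inv: "real N powr - 1 = 1 / real N" using N by (simp add: powr_minus_divide)
  have "r\<^sup>2 = real N powr (- 1 / 2 + - 1 / 2)"
    unfolding r_def power2_eq_square by (simp only: powr_add)
  then have rr: "r\<^sup>2 = 1 / real N" using N_inv by simp
  have r0: "0 < r" and m0: "0 < m" using N by (simp_all add: r_def m_def)
  have m1: "m \<le> 1" using N \<mu> powr_mono[of "- \<mu>" 0 "real N"] by (simp add: m_def)
  have acc: "accuracy N \<mu> = r * m / 1024"
    unfolding accuracy_def r_def m_def powr_add[symmetric] by simp
  have Nm: "1 / real N \<le> m"
    using N \<mu> powr_mono[of "- 1" "- \<mu>" "real N"] unfolding N_inv m_def by simp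
  have "(2::real) ^ 8 \<le> real N ^ 8" using N by (intro power_mono) auto
  then have N8: "1 / real N ^ 8 \<le> 1 / 256" using N by (simp add: divide_le_eq)
  have "1 / real N ^ 10 = 1 / real N ^ 8 * (1 / real N) * (1 / real N)"
    by (simp add: numeral_eq_Suc)
  also have "\<dots> \<le> 1 / 256 * m * r\<^sup>2"
    unfolding rr using N8 Nm N by (intro mult_right_mono mult_mono) auto
  finally have N10: "1 / real N ^ 10 \<le> m / 256 * r\<^sup>2" by simp
  have "(expander_norm N)\<^sup>2 = r\<^sup>2 + 1 / real N ^ 10"
    unfolding expander_norm_def rr by (rule real_sqrt_pow2) simp
  then have sq: "(expander_norm N)\<^sup>2 \<le> (1 + m / 256) * r\<^sup>2"
    using N10 by (simp only: distrib_right mult_1_left)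
  also have "\<dots> \<le> (3 / 2)\<^sup>2 * r\<^sup>2" using m1 by (intro mult_right_mono) (auto simp: power2_eq_square)
  also have "\<dots> = (3 / 2 * r)\<^sup>2" by (simp only: power_mult_distrib)
  finally have en: "expander_norm N \<le> 3 / 2 * r" by (rule power2_le_imp_le) (use r0 in simp)
  have "x\<^sup>2 \<le> (expander_norm N + 2 * accuracy N \<mu>)\<^sup>2" using x by (intro power_mono)
  also have "\<dots> = (expander_norm N)\<^sup>2 + 4 * (expander_norm N * (r * m / 1024)) + 4 * (r * m / 1024)\<^sup>2"
    by (simp add: acc power2_eq_square algebra_simps)
  also have "\<dots> \<le> (1 + m / 256) * r\<^sup>2 + 4 * (3 / 2 * r * (r * m / 1024)) + 4 * (m * r\<^sup>2 / 1024)"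
  proof (intro add_mono sq mult_left_mono mult_right_mono en)
    have "m * m \<le> m * 1" using m0 m1 by (intro mult_left_mono) auto
    then have "(m * m) * r\<^sup>2 / 1024 \<le> m * r\<^sup>2 / 1024" by (intro divide_right_mono mult_right_mono) auto
    moreover have "(r * m / 1024)\<^sup>2 \<le> (m * m) * r\<^sup>2 / 1024"
      by (simp add: power_divide power_mult_distrib power2_eq_square mult_ac divide_le_eq)
        (use m0 in \<open>simp add: mult_le_cancel_left1 mult_nonneg_nonneg\<close>)
    ultimately show "(r * m / 1024)\<^sup>2 \<le> m * r\<^sup>2 / 1024" by linarith
  qed (use r0 m0 in auto)
  \<comment> \<open>The three excess terms, from the threshold, the cross term and the squared
    accuracy, add up to 14/1024, below 1/64.\<close>
  also have "\<dots> = r\<^sup>2 + (1 / 256 + 6 / 1024 + 4 / 1024) * m * r\<^sup>2"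
    by (simp add: power2_eq_square algebra_simps)
  also have "\<dots> \<le> r\<^sup>2 + 1 / 64 * m * r\<^sup>2" using m0 by (intro add_left_mono mult_right_mono) auto
  finally show ?thesis using rr by (simp add: m_def)
qed

lemma ln_64_le: "ln (64 :: real) \<le> 5"
proof -
  have "ln (64 :: real) = ln (2 ^ 6)" by simp
  also have "\<dots> = 6 * ln 2" by (subst ln_realpow) auto
  finally show ?thesis using ln2_le_25_over_36 by simp
qed

section \<open>Norms of walk distributions decide between expanders and far graphs\<close>

context bounded_degree_graph
begin

definition heavy_nodes :: "nat \<Rightarrow> real \<Rightarrow> nat set" where
  "heavy_nodes t b = {s \<in> {..<N}. b < L2_set (walk_dist N d E t s) {..<N}}"

text \<open>With y = d^2 / (\<Upsilon>^2 \<mu>), the block length C is at most 211 y, and \<alpha> =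
  1 / (16 * 211 * y) makes 16 C \<alpha> \<le> 1 \<le> d, as excluding \<alpha>-sparse sets demands.
  Subdivision divides \<alpha> by 8 d^2, which gives 27008 = 8 * 3376 and the power d^4.\<close>

lemma few_heavy_nodes_imp_close_to_expander:
  assumes N: "2 \<le> N" and d: "3 \<le> d" and \<Upsilon>: "0 < \<Upsilon>" "\<Upsilon> \<le> real d" and \<epsilon>: "0 < \<epsilon>" "\<epsilon> < 1"
    and \<mu>: "0 < \<mu>" "\<mu> < 1 / 4"
    and heavy: "real (card (heavy_nodes (steps N d \<Upsilon>) (expander_norm N + 2 * accuracy N \<mu>))) < \<epsilon> / 8 * real N"
  obtains E' where "bounded_graph N d E'" "\<not> far N d \<epsilon> E E'"
    "expansion N E' \<ge> ereal (1 / (27008 * real d ^ 4) * \<mu> * \<Upsilon>\<^sup>2)"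
proof -
  define H where "H = heavy_nodes (steps N d \<Upsilon>) (expander_norm N + 2 * accuracy N \<mu>)"
  define t where "t = steps N d \<Upsilon>"
  define k where "k = nat \<lfloor>\<mu> * ln (real N) / ln 64\<rfloor>"
  define C where "C = nat \<lceil>real t / real (Suc k)\<rceil>"
  define y where "y = (real d)\<^sup>2 / (\<Upsilon>\<^sup>2 * \<mu>)"
  define \<alpha> where "\<alpha> = \<mu> * \<Upsilon>\<^sup>2 / (3376 * (real d)\<^sup>2)"
  have ln64: "0 < ln (64 :: real)" by simp
  have lnN: "0 < ln (real N)" using N by simp
  have \<Upsilon>d: "\<Upsilon>\<^sup>2 \<le> (real d)\<^sup>2" using \<Upsilon> by (intro power_mono) auto
  have d2: "0 < (real d)\<^sup>2" using d by simp
  have "1 \<le> (real d)\<^sup>2 / \<Upsilon>\<^sup>2" using \<Upsilon>d \<Upsilon> by (simp add: pos_le_divide_eq)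
  moreover have "1 \<le> 1 / \<mu>" using \<mu> by simp
  ultimately have "1 * 1 \<le> (real d)\<^sup>2 / \<Upsilon>\<^sup>2 * (1 / \<mu>)" by (intro mult_mono) auto
  then have y1: "1 \<le> y" by (simp add: y_def)
  have k_gt: "\<mu> * ln (real N) / ln 64 \<le> real (Suc k)" unfolding k_def by linarith
  have k_le: "real k \<le> \<mu> * ln (real N) / ln 64" unfolding k_def using \<mu> lnN by simp
  have tC: "t \<le> C * Suc k"
  proof -
    have "real t / real (Suc k) \<le> real C" unfolding C_def by (rule real_nat_ceiling_ge)
    then have "real t \<le> real C * real (Suc k)" by (subst (asm) pos_divide_le_eq) auto
    then show ?thesis by (simp only: of_nat_mult[symmetric] of_nat_le_iff)
  qed
  \<comment> \<open>k is rounded down, so 64^(-k) is at least N^(-\<mu>); the extra factor 1/64 in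
    the excess supplies the exponent k + 1.\<close>
  have \<theta>: "real N powr - \<mu> / 64 \<le> (1 / 64) ^ Suc k"
  proof -
    have "real k * ln 64 \<le> \<mu> * ln (real N)" using k_le ln64 by (simp add: pos_le_divide_eq)
    then have "exp (- (\<mu> * ln (real N))) \<le> exp (- (real k * ln 64))" by simp
    also have "\<dots> = (1 / 64) ^ k"
      by (simp add: exp_minus exp_of_nat_mult power_one_over inverse_eq_divide)
    finally show ?thesis using N by (simp add: powr_def)
  qed
  \<comment> \<open>The factors ln N cancel; 42 * ln 64 \<le> 210, and rounding up adds 1 \<le>
    y.\<close>
  have C_le: "real C \<le> 211 * y"
  proof -
    have "real t / real (Suc k) \<le> 42 * ((real d)\<^sup>2 / \<Upsilon>\<^sup>2 * ln (real N)) / (\<mu> * ln (real N) / ln 64)"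
      using k_gt steps_le[of N \<Upsilon> d] N \<Upsilon> \<mu> lnN unfolding t_def by (intro frac_le) auto
    also have "\<dots> = 42 * ln 64 * y" using lnN \<mu> \<Upsilon> by (simp add: y_def field_simps)
    also have "\<dots> \<le> 210 * y" using ln_64_le y1 by (intro mult_right_mono) auto
    finally show ?thesis unfolding C_def using nat_ceiling_le[of "real t / real (Suc k)"] y1 by linarith
  qed
  have \<alpha>_pos: "0 < \<alpha>" using \<mu> \<Upsilon> d2 by (simp add: \<alpha>_def)
  have \<alpha>_le: "\<alpha> \<le> 1"
  proof -
    have "\<mu> * \<Upsilon>\<^sup>2 \<le> 1 * (real d)\<^sup>2" using \<mu> \<Upsilon>d by (intro mult_mono) auto
    also have "\<dots> \<le> 3376 * (real d)\<^sup>2" using d2 by simp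
    finally show ?thesis using d2 by (simp add: \<alpha>_def divide_le_eq)
  qed
  have C\<alpha>: "16 * real C * \<alpha> \<le> real d"
  proof -
    have "16 * real C * \<alpha> \<le> 16 * (211 * y) * \<alpha>" using C_le \<alpha>_pos by (intro mult_right_mono mult_left_mono) auto
    also have "\<dots> = 1" using \<mu> \<Upsilon> d2 by (simp add: y_def \<alpha>_def field_simps)
    finally show ?thesis using d by simp
  qed
  have HN: "H \<subseteq> {..<N}" by (auto simp: H_def heavy_nodes_def)
  have small: "real (card S) < \<epsilon> * real N / 4"
    if S: "S \<subseteq> {..<N}" "S \<noteq> {}" "real (card S) \<le> real N / 2" "real (card (cut N E S)) \<le> \<alpha> * real (card S)" for S
  proof (rule ccontr)
    assume "\<not> real (card S) < \<epsilon> * real N / 4"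
    \<comment> \<open>Hence the nodes of S outside H, whose walks mix, still form at least half of
      S.\<close>
    then have "2 * card H \<le> card S" using heavy unfolding H_def[symmetric] by linarith
    moreover have "card S - card H \<le> card (S - H)"
      using finite_subset[OF HN] by (intro diff_card_le_card_Diff) auto
    ultimately have half: "card S \<le> 2 * card (S - H)" by linarith
    have "real d * real (card S) < 16 * real C * real (card (cut N E S))"
    proof (rule cut_large_if_walks_mix[OF S(1,2,3) _ half _ _ \<theta> tC])
      fix s assume s: "s \<in> S - H"
      then have "L2_set (walk_dist N d E t s) {..<N} \<le> expander_norm N + 2 * accuracy N \<mu>"
        using S(1) by (auto simp: H_def heavy_nodes_def t_def)
      then show "(L2_set (walk_dist N d E t s) {..<N})\<^sup>2 \<le> 1 / real N + real N powr - \<mu> / 64 / real N"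
        using light_square_le[OF N \<mu>] by simp
    qed auto
    also have "\<dots> \<le> 16 * real C * (\<alpha> * real (card S))" using S(4) by (intro mult_left_mono) auto
    also have "\<dots> \<le> real d * real (card S)"
      using mult_right_mono[OF C\<alpha>, of "real (card S)"] by (simp add: mult.assoc)
    finally show False by simp
  qed
  have b: "0 < \<epsilon> * real N / 4" "\<epsilon> * real N / 4 \<le> real N / 4" using \<epsilon> N by auto
  obtain A where A: "A \<subseteq> {..<N}" "real (card A) < \<epsilon> * real N / 4"
    "\<And>S. S \<subseteq> {..<N} - A \<Longrightarrow> S \<noteq> {} \<Longrightarrow> 2 * card S \<le> card ({..<N} - A) \<Longrightarrow>
      \<alpha> / 2 * real (card S) < real (card {(u, v). u \<in> S \<and> v \<in> {..<N} - A - S \<and> {u, v} \<in> E})"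
    using edge_expanding_part[OF \<alpha>_pos _ small b] N by auto
  have "real (card A) < real N / 4" using A(2) b(2) by linarith
  then obtain E' where E': "bounded_graph N d E'" "card ((E - E') \<union> (E' - E)) \<le> 2 * d * card A"
    "expansion N E' \<ge> ereal (\<alpha> / (8 * (real d)\<^sup>2))"
    using subdivision_is_expander[OF d _ \<alpha>_pos \<alpha>_le A(1) _ A(3)] N by auto
  have "\<alpha> / (8 * (real d)\<^sup>2) = 1 / (27008 * real d ^ 4) * \<mu> * \<Upsilon>\<^sup>2"
    by (simp add: \<alpha>_def power4_eq_xxxx power2_eq_square)
  moreover have "\<not> far N d \<epsilon> E E'"
  proof -
    have "real (card ((E - E') \<union> (E' - E))) \<le> 2 * real d * real (card A)"
      using E'(2) by (metis of_nat_le_iff of_nat_mult of_nat_numeral)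
    also have "\<dots> \<le> 2 * real d * (\<epsilon> * real N / 4)" using A(2) by (intro mult_left_mono) auto
    also have "\<dots> < \<epsilon> * real N * real d" using \<epsilon> N d by simp
    finally show ?thesis by (simp add: far_def)
  qed
  ultimately show ?thesis using that E' by simp
qed

text \<open>A singleton is admissible for N \<ge> 2 and has at most d cut edges, so the expansion
  cannot exceed d. The norm bound is (1 - x)^t \<le> exp (- x t) with x Cheeger's gap.\<close>

lemma expander_all_light:
  assumes N: "2 \<le> N" and \<Upsilon>: "0 < \<Upsilon>" and ex: "ereal \<Upsilon> \<le> expansion N E" and s: "s < N"
  shows "\<Upsilon> \<le> real d" and "L2_set (walk_dist N d E (steps N d \<Upsilon>) s) {..<N} \<le> expander_norm N"
proof -
  have "\<Upsilon> * real (card {0::nat}) \<le> real (card (cut N E {0}))"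
    using expansion_cut[OF ex, of "{0}"] N by simp
  also have "cut N E {0} = Pair 0 ` neighbors E 0"
    by (auto simp: cut_def neighbors_def dest: edgeD)
  also have "card (Pair 0 ` neighbors E 0) = node_degree E 0"
    unfolding node_degree_def by (intro card_image) (auto simp: inj_on_def)
  finally show "\<Upsilon> \<le> real d" using degree_le[of 0] by simp
  define x where "x = \<Upsilon>\<^sup>2 / (4 * (real d)\<^sup>2)"
  define t where "t = steps N d \<Upsilon>"
  have d0: "0 < real d" using d_pos by simp
  have "\<Upsilon>\<^sup>2 \<le> (2 * real d)\<^sup>2" using \<Upsilon> \<open>\<Upsilon> \<le> real d\<close> by (intro power_mono) auto
  then have x: "0 \<le> x" "x \<le> 1" using d0 by (simp_all add: x_def power_mult_distrib)
  have "40 * ((real d)\<^sup>2 / \<Upsilon>\<^sup>2 * ln (real N)) \<le> real t"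
    unfolding t_def steps_def by (rule real_nat_ceiling_ge)
  then have "x * (40 * ((real d)\<^sup>2 / \<Upsilon>\<^sup>2 * ln (real N))) \<le> x * real t" using x by (intro mult_left_mono)
  also have "x * (40 * ((real d)\<^sup>2 / \<Upsilon>\<^sup>2 * ln (real N))) = 10 * ln (real N)"
    using d0 \<Upsilon> by (simp add: x_def field_simps)
  finally have xt: "10 * ln (real N) \<le> x * real t" .
  have "(1 - x) ^ t \<le> exp (- x) ^ t"
    using x exp_ge_add_one_self[of "- x"] by (intro power_mono) auto
  also have "\<dots> = exp (- (x * real t))" by (simp add: exp_of_nat_mult[symmetric] mult.commute)
  also have "\<dots> \<le> exp (- (real 10 * ln (real N)))" using xt by simp
  also have "\<dots> = 1 / real N ^ 10"
    using N unfolding exp_minus exp_of_nat_mult by (simp add: inverse_eq_divide)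
  finally have "(L2_set (walk_dist N d E t s) {..<N})\<^sup>2 \<le> 1 / real N + 1 / real N ^ 10"
    using expander_walk_dist_norm[OF ex _ _ s, of t] \<Upsilon> \<open>\<Upsilon> \<le> real d\<close> by (simp add: x_def)
  then show "L2_set (walk_dist N d E (steps N d \<Upsilon>) s) {..<N} \<le> expander_norm N"
    unfolding expander_norm_def t_def by (rule real_le_rsqrt)
qed

end

section \<open>Correctness of the tester\<close>

lemma single_node_graph:
  assumes "bounded_graph 1 d E"
  shows "E = {}" "expansion 1 E = \<infinity>"
proof -
  show "E = {}"
  proof (rule ccontr)
    assume "E \<noteq> {}"
    then obtain e where "e \<in> E" by blast
    then have "e \<subseteq> {0}" "card e = 2" using assms by (auto simp: bounded_graph_def)
    then show False using card_mono[of "{0}" e] by simp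
  qed
  have "\<not> real (card S) \<le> real 1 / 2" if "S \<subseteq> {..<1}" "S \<noteq> {}" for S :: "nat set"
  proof -
    have "S = {0}" using that by auto
    then show ?thesis by simp
  qed
  then have "{S :: nat set. S \<subseteq> {..<1} \<and> S \<noteq> {} \<and> real (card S) \<le> real 1 / 2} = {}" by blast
  then show "expansion 1 E = \<infinity>" unfolding expansion_def by (simp only: image_empty Inf_empty top_ereal_def)
qed

lemma test_params_correct:
  assumes X: "valid_primitives X" and d3: "3 \<le> d" and \<Upsilon>: "0 < \<Upsilon>" and \<epsilon>: "0 < \<epsilon>" "\<epsilon> < 1" and \<mu>: "0 < \<mu>" "\<mu> < 1 / 4"
  shows "expansion_tester (1 / (27008 * real d ^ 4)) d
    (\<lambda>N nb. map_pmf fst (expansion_test X (test_params N d \<Upsilon> \<epsilon> \<mu>) N d nb)) \<Upsilon> \<epsilon> \<mu>"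
  unfolding expansion_tester_def
proof (intro allI impI)
  fix N E nb
  assume asm: "1 \<le> N \<and> bounded_graph N d E \<and> adjacency_lists N d E nb"
  define p where "p = test_params N d \<Upsilon> \<epsilon> \<mu>"
  define A where "A = map_pmf fst (expansion_test X p N d nb)"
  define c where "c = 1 / (27008 * real d ^ 4) * \<mu> * \<Upsilon>\<^sup>2"
  have "(ereal \<Upsilon> \<le> expansion N E \<longrightarrow> 2 / 3 \<le> pmf A True) \<and>
    ((\<forall>E'. bounded_graph N d E' \<and> ereal c \<le> expansion N E' \<longrightarrow> far N d \<epsilon> E E') \<longrightarrow> 2 / 3 \<le> pmf A False)"
  proof (cases "N = 1")
    case True
    have "pmf A True = 1"
      using True by (simp add: A_def p_def expansion_test_def test_params_def)
    \<comment> \<open>With a single node the reject condition is void: the graph itself has infinite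
      expansion and is not far from itself.\<close>
    moreover have "\<not> far N d \<epsilon> E E" using True \<epsilon> d3 by (simp add: far_def not_le)
    moreover have "bounded_graph N d E" "expansion N E = \<infinity>"
      using asm single_node_graph[of d E] True by blast+
    ultimately show ?thesis by auto
  next
    case False
    then have N2: "2 \<le> N" using asm by simp
    interpret tester_input X N d E nb
      using X asm d3 by unfold_locales auto
    define est where "est s = norm_estimator X N d nb s (walk_steps p) (precision p) (confidence p)" for s
    define v where "v s = L2_set (walk_dist N d E (walk_steps p) s) {..<N}" for s
    define \<rho> where "\<rho> = survival N est (threshold p + precision p)"
    define T where "T = nat \<lceil>32 / \<epsilon>\<rceil>"
    have T_ge: "32 / \<epsilon> \<le> real T" unfolding T_def by (rule real_nat_ceiling_ge)
    have T_le: "real T \<le> 33 / \<epsilon>"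
    proof -
      have "1 \<le> 1 / \<epsilon>" using \<epsilon> by simp
      then have "32 / \<epsilon> + 1 \<le> 33 / \<epsilon>" using \<epsilon> by (simp add: field_simps)
      moreover have "real T \<le> 32 / \<epsilon> + 1" unfolding T_def using \<epsilon> by (intro nat_ceiling_le) auto
      ultimately show ?thesis by linarith
    qed
    have acc: "pmf A True = \<rho> ^ T"
      using tester_loop_accept[of N X d nb p] N2 False
      by (simp add: A_def expansion_test_def \<rho>_def est_def[abs_def] p_def test_params_def T_def)
    have est: "1 - \<epsilon> / 99 \<le> measure_pmf.prob (est s) {(a, q, h). \<bar>a - v s\<bar> \<le> accuracy N \<mu>}" if "s < N" for s
      using norm_estimator_accurate[OF that, of "accuracy N \<mu>" "\<epsilon> / 99" "walk_steps p"]
        accuracy_pos[of N \<mu>] accuracy_le_1[of N \<mu>] N2 \<mu> \<epsilon>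
      by (simp add: est_def v_def p_def test_params_def)
    have "2 / 3 \<le> \<rho> ^ T" if ex: "ereal \<Upsilon> \<le> expansion N E"
    proof -
      have le: "\<Upsilon> \<le> real d" using expander_all_light(1)[OF N2 \<Upsilon> ex, of 0] N2 by simp
      have "1 - \<epsilon> / 99 \<le> \<rho>"
        unfolding \<rho>_def
      proof (rule survival_ge)
        fix s assume "s < N"
        then show "v s + accuracy N \<mu> \<le> threshold p + precision p"
          using expander_all_light(2)[OF N2 \<Upsilon> ex, of s] le by (simp add: v_def p_def test_params_def)
      qed (use N2 est in auto)
      then have "(1 - \<epsilon> / 99) ^ T \<le> \<rho> ^ T" using \<epsilon> by (intro power_mono) auto
      \<comment> \<open>Bernoulli's inequality in place of a union bound: at most 33 / \<epsilon>
        rounds, each failing with probability at most \<epsilon> / 99, lose at most 1/3.\<close>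
      moreover have "1 - real T * (\<epsilon> / 99) \<le> (1 - \<epsilon> / 99) ^ T"
        using Bernoulli_inequality[of "- (\<epsilon> / 99)" T] \<epsilon> by simp
      moreover have "real T * (\<epsilon> / 99) \<le> 33 / \<epsilon> * (\<epsilon> / 99)" using T_le \<epsilon> by (intro mult_right_mono) auto
      moreover have "33 / \<epsilon> * (\<epsilon> / 99) = 1 / 3" using \<epsilon> by simp
      ultimately show ?thesis by linarith
    qed
    moreover have "\<rho> ^ T \<le> 1 / 3"
      if far: "\<forall>E'. bounded_graph N d E' \<and> ereal c \<le> expansion N E' \<longrightarrow> far N d \<epsilon> E E'"
    proof -
      have heavy: "\<epsilon> / 8 * real N \<le> real (card {s \<in> {..<N}. threshold p + precision p + accuracy N \<mu> < v s})"
      proof (cases "\<Upsilon> \<le> real d")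
        case True
        show ?thesis
        proof (rule ccontr)
          assume "\<not> ?thesis"
          then have "real (card (heavy_nodes (steps N d \<Upsilon>) (expander_norm N + 2 * accuracy N \<mu>))) < \<epsilon> / 8 * real N"
            using True by (simp add: heavy_nodes_def v_def p_def test_params_def not_le add_ac)
          then obtain E' where "bounded_graph N d E'" "\<not> far N d \<epsilon> E E'" "ereal c \<le> expansion N E'"
            using few_heavy_nodes_imp_close_to_expander[OF N2 d3 \<Upsilon> True \<epsilon> \<mu>] unfolding c_def by blast
          then show False using far by blast
        qed
      next
        case False
        \<comment> \<open>For \<Upsilon> > d no step is made and the threshold is 0, so every start
          is heavy.\<close>
        have "v s = 1" if "s < N" for s
        proof -
          have "{..<N} \<inter> {x. x = s} = {s}" using that by auto
          then have "(\<Sum>x<N. (of_bool (x = s))\<^sup>2) = (1 :: real)" by (simp add: power2_eq_square)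
          then show ?thesis using False by (simp add: v_def p_def test_params_def walk_dist_def L2_set_def)
        qed
        moreover have "accuracy N \<mu> + accuracy N \<mu> < 1"
        proof -
          have "real N powr (- 1 / 2 - \<mu>) \<le> real N powr 0" using N2 \<mu> by (intro powr_mono) auto
          then show ?thesis using N2 by (simp add: accuracy_def)
        qed
        ultimately have "{s \<in> {..<N}. threshold p + precision p + accuracy N \<mu> < v s} = {..<N}"
          using False by (auto simp: p_def test_params_def)
        moreover have "\<epsilon> / 8 * real N \<le> 1 * real N" using \<epsilon> by (intro mult_right_mono) auto
        ultimately show ?thesis by (simp only: card_lessThan mult_1_left)
      qed
      have "\<rho> \<le> 1 - \<epsilon> / 8 / 2"
        unfolding \<rho>_def
        by (rule survival_le[where \<delta> = "\<epsilon> / 99" and v = v and \<eta> = "accuracy N \<mu>"])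
          (use N2 est heavy \<epsilon> in auto)
      also have "\<dots> \<le> exp (- (\<epsilon> / 16))" using exp_ge_add_one_self[of "- (\<epsilon> / 16)"] by simp
      finally have "\<rho> ^ T \<le> exp (- (\<epsilon> / 16)) ^ T"
        by (intro power_mono) (auto simp: \<rho>_def survival_def sum_nonneg)
      also have "\<dots> = exp (- (\<epsilon> / 16 * real T))" by (simp add: exp_of_nat_mult[symmetric] mult.commute)
      \<comment> \<open>A fraction \<epsilon> / 8 of heavy starts, each detected with probability at
        least 1/2, gives \<epsilon> / 16 per round; 32 / \<epsilon> rounds give the exponent
        2.\<close>
      also have "\<dots> \<le> exp (- (2 :: real))"
      proof -
        have "\<epsilon> / 16 * (32 / \<epsilon>) \<le> \<epsilon> / 16 * real T" using T_ge \<epsilon> by (intro mult_left_mono) auto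
        then show ?thesis using \<epsilon> by simp
      qed
      also have "\<dots> \<le> 1 / 3"
        using exp_ge_add_one_self[of "2 :: real"] by (simp add: exp_minus field_simps)
      finally show ?thesis .
    qed
    ultimately show ?thesis
      by (simp add: acc pmf_False_conv_True)
  qed
  then show "(ereal \<Upsilon> \<le> expansion N E \<longrightarrow>
      2 / 3 \<le> pmf (map_pmf fst (expansion_test X (test_params N d \<Upsilon> \<epsilon> \<mu>) N d nb)) True) \<and>
    ((\<forall>E'. bounded_graph N d E' \<and> ereal (1 / (27008 * real d ^ 4) * \<mu> * \<Upsilon>\<^sup>2) \<le> expansion N E' \<longrightarrow> far N d \<epsilon> E E') \<longrightarrow>
      2 / 3 \<le> pmf (map_pmf fst (expansion_test X (test_params N d \<Upsilon> \<epsilon> \<mu>) N d nb)) False)"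
    unfolding A_def p_def c_def .
qed

text \<open>Both t and the logarithm are of order ln N, so the square root is linear in ln N and in
  d / \<Upsilon>: this is the quadratic speedup over t.\<close>

lemma qff_length_steps_le:
  assumes N: "2 \<le> N" and \<Upsilon>: "0 < \<Upsilon>" "\<Upsilon> \<le> real d" and \<mu>: "0 < \<mu>" "\<mu> < 1 / 4"
  shows "real (qff_length N (steps N d \<Upsilon>) (accuracy N \<mu>)) \<le> 38 * (real d / \<Upsilon> * ln (real N))"
proof -
  define y where "y = real d / \<Upsilon> * ln (real N)"
  define t where "t = steps N d \<Upsilon>"
  define l where "l = ln (8 * sqrt (real N) / accuracy N \<mu>)"
  have lnN: "1 / 2 \<le> ln (real N)" by (rule ln_ge_half[OF N])
  have "1 * (1 / 2) \<le> y" unfolding y_def using \<Upsilon> lnN by (intro mult_mono) auto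
  then have y: "1 / 2 \<le> y" by simp
  have "8 * sqrt (real N) / accuracy N \<mu> = 2 ^ 13 * real N powr (1 + \<mu>)"
  proof -
    have "real N powr (1 + \<mu>) * real N powr (- 1 / 2 - \<mu>) = real N powr (1 / 2)"
      by (simp flip: powr_add)
    then show ?thesis using N by (simp add: accuracy_def powr_half_sqrt field_simps)
  qed
  then have "l = ln (2 ^ 13) + ln (real N powr (1 + \<mu>))"
    using N unfolding l_def by (simp only:) (subst ln_mult, auto)
  then have "l = 13 * ln 2 + (1 + \<mu>) * ln (real N)"
    using N ln_realpow[of "2 :: real" 13] by (simp add: ln_powr del: ln_realpow)
  moreover have "ln 2 \<le> ln (real N)" using N by simp
  moreover have "(1 + \<mu>) * ln (real N) \<le> 2 * ln (real N)" using \<mu> lnN by (intro mult_right_mono) auto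
  ultimately have l: "l \<le> 15 * ln (real N)" by linarith
  have "2 * real t * l \<le> (84 * ((real d)\<^sup>2 / \<Upsilon>\<^sup>2 * ln (real N))) * (15 * ln (real N))"
  proof (rule mult_mono[OF _ l])
    show "2 * real t \<le> 84 * ((real d)\<^sup>2 / \<Upsilon>\<^sup>2 * ln (real N))"
      using steps_le[of N \<Upsilon> d] N \<Upsilon> by (simp add: t_def)
    have "8 * 1 / 1 \<le> 8 * sqrt (real N) / accuracy N \<mu>"
      using accuracy_pos[of N \<mu>] accuracy_le_1[of N \<mu>] N \<mu> by (intro frac_le mult_left_mono) auto
    then show "0 \<le> l" unfolding l_def by (intro ln_ge_zero) simp
  qed (use lnN in auto)
  \<comment> \<open>1260 = 84 * 15 is below 36^2, and rounding up adds 1 \<le> 2 y, whence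
    38.\<close>
  also have "\<dots> = 1260 * y\<^sup>2" by (simp add: y_def power_mult_distrib power_divide power2_eq_square)
  also have "\<dots> \<le> (36 * y)\<^sup>2" by (simp add: power_mult_distrib)
  finally have "sqrt (2 * real t * l) \<le> 36 * y" using y by (intro real_le_lsqrt) auto
  then have "real (qff_length N t (accuracy N \<mu>)) \<le> 36 * y + 1"
    unfolding qff_length_def l_def[symmetric] using y by linarith
  then have "real (qff_length N t (accuracy N \<mu>)) \<le> 38 * y" using y by linarith
  then show ?thesis unfolding y_def t_def .
qed

text \<open>The bound is a product: 1/\<epsilon> rounds, N^(1/2+\<mu>) * ln (1/\<epsilon>)
  reflections per estimate, d / \<Upsilon> * ln N walk steps per reflection and sqrt d queries per
  walk step. Additive constants are absorbed because ln (1/\<epsilon>) and ln N are at least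
  1/2.\<close>

lemma test_params_cost:
  assumes X: "valid_primitives X"
  shows "\<exists>K. \<forall>N d E nb. \<forall>\<Upsilon> \<epsilon> \<mu> :: real.
       2 \<le> N \<and> 3 \<le> d \<and> 0 < \<Upsilon> \<and> \<Upsilon> \<le> real d \<and> 0 < \<epsilon> \<and> \<epsilon> \<le> 1 / 2 \<and> 0 < \<mu> \<and> \<mu> < 1 / 4 \<and>
       bounded_graph N d E \<and> adjacency_lists N d E nb \<longrightarrow>
       (\<forall>(accept, queries, runtime) \<in> set_pmf (expansion_test X (test_params N d \<Upsilon> \<epsilon> \<mu>) N d nb).
          let bound = K * (real N powr (1 / 2 + \<mu>) * real d powr (3 / 2) * \<Upsilon> powr (- 1) *
                           \<epsilon> powr (- 1) * ln (1 / \<epsilon>) * ln (real N))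
          in real queries \<le> bound \<and> real runtime \<le> bound)"
proof -
  have "amplitude_estimation (ampl_est X)" using X by (simp add: valid_primitives_def)
  then obtain C1 where C1: "\<forall>B \<psi> R \<epsilon>\<^sub>0 \<delta>. finite B \<and> ket_norm B \<psi> = 1 \<and> projector_on B R \<and>
        0 < \<epsilon>\<^sub>0 \<and> \<epsilon>\<^sub>0 \<le> 1 \<and> 0 < \<delta> \<and> \<delta> \<le> 1 / 2 \<longrightarrow>
          measure_pmf.prob (ampl_est X B \<psi> R \<epsilon>\<^sub>0 \<delta>)
            {(a, r, r'). \<bar>a - ket_norm B (op_app B R \<psi>)\<bar> \<le> \<epsilon>\<^sub>0} \<ge> 1 - \<delta> \<and>
          (\<forall>(a, r, r') \<in> set_pmf (ampl_est X B \<psi> R \<epsilon>\<^sub>0 \<delta>). real (r + r') \<le> C1 * ln (1 / \<delta>) / \<epsilon>\<^sub>0)"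
    unfolding amplitude_estimation_def by (rule exE)
  have "\<exists>C. \<forall>N d. 1 \<le> N \<and> 1 \<le> d \<longrightarrow>
        walk_implementable N d (coin_op X N d) (walk_queries X N d) \<and>
        real (walk_queries X N d) \<le> C * sqrt (real d) \<and> real (walk_time X N d) \<le> C * sqrt (real d)"
    using X unfolding valid_primitives_def by (elim conjE)
  then obtain C2 where C2: "\<forall>N d. 1 \<le> N \<and> 1 \<le> d \<longrightarrow>
        walk_implementable N d (coin_op X N d) (walk_queries X N d) \<and>
        real (walk_queries X N d) \<le> C2 * sqrt (real d) \<and> real (walk_time X N d) \<le> C2 * sqrt (real d)"
    by (rule exE)
  \<comment> \<open>The constants supplied by the primitives may be negative; a nonnegative one is
    needed for monotonicity.\<close>
  define C where "C = max C1 0"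
  define C' where "C' = max C2 0"
  have C0: "0 \<le> C" "0 \<le> C'" by (simp_all add: C_def C'_def)
  have C: "\<forall>(a, r, r') \<in> set_pmf (ampl_est X B \<psi> R \<epsilon>\<^sub>0 \<delta>). real (r + r') \<le> C * ln (1 / \<delta>) / \<epsilon>\<^sub>0"
    if "finite B" "ket_norm B \<psi> = 1" "projector_on B R" "0 < \<epsilon>\<^sub>0" "\<epsilon>\<^sub>0 \<le> 1" "0 < \<delta>" "\<delta> \<le> 1 / 2" for B \<psi> R \<epsilon>\<^sub>0 \<delta>
  proof -
    have "C1 * ln (1 / \<delta>) / \<epsilon>\<^sub>0 \<le> C * ln (1 / \<delta>) / \<epsilon>\<^sub>0"
      using that by (intro divide_right_mono mult_right_mono) (auto simp: C_def)
    moreover have "\<forall>(a, r, r') \<in> set_pmf (ampl_est X B \<psi> R \<epsilon>\<^sub>0 \<delta>). real (r + r') \<le> C1 * ln (1 / \<delta>) / \<epsilon>\<^sub>0"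
      using C1 that by blast
    ultimately show ?thesis by fastforce
  qed
  have C': "real (walk_queries X N d) \<le> C' * sqrt (real d)" "real (walk_time X N d) \<le> C' * sqrt (real d)"
    if "1 \<le> N" "1 \<le> d" for N d
  proof -
    have "C2 * sqrt (real d) \<le> C' * sqrt (real d)" by (intro mult_right_mono) (auto simp: C'_def)
    then show "real (walk_queries X N d) \<le> C' * sqrt (real d)" "real (walk_time X N d) \<le> C' * sqrt (real d)"
      using C2 that by (blast intro: order_trans)+
  qed
  \<comment> \<open>819200 = 4 * 200 * 1024: the factor in R, the bound 200 L on the logarithm of
    the inverse confidence, and the denominator of \<open>accuracy\<close>. In KH, 82 = 6 + 2 * 38;
    in K, 33 bounds \<epsilon> times the rounds, and 16 absorbs the overhead 4 per round since Z
    \<ge> 1/4.\<close>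
  define KR where "KR = 2 + 819200 * C"
  define KH where "KH = KR * (82 + 38 * C')"
  define K where "K = 33 * (KH + 16)"
  have K0: "0 \<le> KR" "0 \<le> KH" "0 \<le> K" using C0 by (simp_all add: KR_def KH_def K_def)
  show ?thesis
    unfolding Let_def
  proof (intro exI[of _ K] allI impI ballI, clarify)
    fix N d E nb b q h and \<Upsilon> \<epsilon> \<mu> :: real
    assume asm: "2 \<le> N" "3 \<le> d" "0 < \<Upsilon>" "\<Upsilon> \<le> real d" "0 < \<epsilon>" "\<epsilon> \<le> 1 / 2" "0 < \<mu>" "\<mu> < 1 / 4"
      "bounded_graph N d E" "adjacency_lists N d E nb"
      and out: "(b, q, h) \<in> set_pmf (expansion_test X (test_params N d \<Upsilon> \<epsilon> \<mu>) N d nb)"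
    interpret tester_input X N d E nb
      using X asm by unfold_locales auto
    define n where "n = real N powr (1 / 2 + \<mu>)"
    define L where "L = ln (1 / \<epsilon>)"
    define y where "y = real d / \<Upsilon> * ln (real N)"
    define \<tau> where "\<tau> = qff_length N (steps N d \<Upsilon>) (accuracy N \<mu>)"
    define R where "R = 1 + 4 * (C * ln (1 / (\<epsilon> / 99)) / accuracy N \<mu>)"
    define Z where "Z = n * L * (y * sqrt (real d))"
    define T where "T = nat \<lceil>32 / \<epsilon>\<rceil>"
    have lnN: "1 / 2 \<le> ln (real N)" by (rule ln_ge_half) (rule asm)
    have "1 * (1 / 2) \<le> y" unfolding y_def using asm lnN by (intro mult_mono) auto
    then have y: "1 / 2 \<le> y" by simp
    have n: "1 \<le> n" using asm by (simp add: n_def ge_one_powr_ge_zero)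
    have "ln (real 2) \<le> L" unfolding L_def using asm by (subst ln_le_cancel_iff) (auto simp: field_simps)
    then have L: "1 / 2 \<le> L" using ln_ge_half[of 2] by linarith
    have sd: "1 \<le> sqrt (real d)" using asm by simp
    have nL: "1 / 2 \<le> n * L" using mult_mono[of 1 n "1 / 2" L] n L by simp
    have ysd: "y \<le> y * sqrt (real d)" using y sd by (simp add: mult_le_cancel_left1)
    have "1 / 2 * (1 / 2) \<le> Z"
      unfolding Z_def using nL order_trans[OF y ysd] by (intro mult_mono) auto
    then have Z: "1 / 4 \<le> Z" by simp
    have \<tau>: "real \<tau> \<le> 38 * y"
      unfolding \<tau>_def y_def using asm by (intro qff_length_steps_le) auto
    have acc: "1 / accuracy N \<mu> = 1024 * n"
    proof -
      have "real N powr (- 1 / 2 - \<mu>) = 1 / n" unfolding n_def powr_minus_divide[symmetric] by simp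
      show ?thesis unfolding accuracy_def \<open>real N powr (- 1 / 2 - \<mu>) = 1 / n\<close> by simp
    qed
    have R_le: "R \<le> KR * (n * L)"
    proof -
      have "ln (1 / (\<epsilon> / 99)) = ln 99 + L"
        unfolding L_def using asm by (simp add: ln_div)
      moreover have "ln (99 :: real) \<le> 98" using ln_le_minus_one[of "99 :: real"] by simp
      ultimately have lnd: "ln (1 / (\<epsilon> / 99)) \<le> 200 * L" using L by linarith
      have "R = 1 + 4 * (C * (ln (1 / (\<epsilon> / 99)) * (1 / accuracy N \<mu>)))" by (simp add: R_def)
      also have "\<dots> \<le> 2 * (n * L) + 4 * (C * (200 * L * (1024 * n)))"
        unfolding acc using nL lnd n C0 by (intro add_mono mult_left_mono mult_right_mono) auto
      also have "\<dots> = KR * (n * L)" by (simp add: KR_def algebra_simps)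
      finally show ?thesis .
    qed
    have R0: "0 \<le> R"
    proof -
      have "0 \<le> ln (1 / (\<epsilon> / 99))" using asm by (intro ln_ge_zero) (simp add: field_simps)
      then show ?thesis using C0 accuracy_pos[of N \<mu>] asm by (simp add: R_def)
    qed
    have \<tau>C': "real \<tau> * (C' * sqrt (real d)) \<le> 38 * y * (C' * sqrt (real d))"
      using \<tau> C0 by (intro mult_right_mono) auto
    have h_le: "3 + 2 * real \<tau> + real \<tau> * (C' * sqrt (real d)) \<le> (82 + 38 * C') * (y * sqrt (real d))"
    proof -
      have "3 + 2 * real \<tau> + real \<tau> * (C' * sqrt (real d)) \<le> 6 * y + 76 * y + 38 * y * (C' * sqrt (real d))"
        using y \<tau> \<tau>C' by (intro add_mono) auto
      also have "\<dots> \<le> 82 * (y * sqrt (real d)) + 38 * y * (C' * sqrt (real d))" using ysd by simp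
      also have "\<dots> = (82 + 38 * C') * (y * sqrt (real d))" by (simp add: algebra_simps)
      finally show ?thesis .
    qed
    have per_run: "R * (3 + 2 * real \<tau> + real \<tau> * (C' * sqrt (real d))) \<le> KH * Z"
    proof -
      have "R * (3 + 2 * real \<tau> + real \<tau> * (C' * sqrt (real d))) \<le> (KR * (n * L)) * ((82 + 38 * C') * (y * sqrt (real d)))"
        using R_le h_le K0 nL C0 by (intro mult_mono) auto
      also have "\<dots> = KH * Z" by (simp add: KH_def Z_def mult_ac)
      finally show ?thesis .
    qed
    have cost: "real q' \<le> KH * Z \<and> real h' \<le> KH * Z"
      if "s < N" "(a, q', h') \<in> set_pmf (norm_estimator X N d nb s (walk_steps (test_params N d \<Upsilon> \<epsilon> \<mu>))
          (precision (test_params N d \<Upsilon> \<epsilon> \<mu>)) (confidence (test_params N d \<Upsilon> \<epsilon> \<mu>)))" for s a q' h'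
    proof -
      have *: "(a, q', h') \<in> set_pmf (norm_estimator X N d nb s (steps N d \<Upsilon>) (accuracy N \<mu>) (\<epsilon> / 99))"
        using that(2) asm by (simp add: test_params_def)
      have bounds: "0 < accuracy N \<mu>" "accuracy N \<mu> \<le> 1" "0 < \<epsilon> / 99" "\<epsilon> / 99 \<le> 1 / 2"
        using asm by (auto intro: accuracy_pos accuracy_le_1)
      note est = norm_estimator_cost[OF C C'[OF N d] that(1) bounds *, folded \<tau>_def R_def]
      have "R * (real \<tau> * (C' * sqrt (real d))) \<le> R * (3 + 2 * real \<tau> + real \<tau> * (C' * sqrt (real d)))"
        using R0 by (intro mult_left_mono) auto
      then show ?thesis using est per_run by linarith
    qed
    have "(b, q, h) \<in> set_pmf (tester_loop X N d nb (test_params N d \<Upsilon> \<epsilon> \<mu>) T)"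
      using out asm by (simp add: expansion_test_def test_params_def T_def)
    then have total: "real q \<le> real T * (KH * Z) \<and> real h \<le> real T * (KH * Z + 3) + 1"
      using K0 Z asm by (intro tester_loop_cost[OF _ cost]) auto
    have "1 \<le> 1 / \<epsilon>" using asm by simp
    then have eps: "32 / \<epsilon> + 1 \<le> 33 / \<epsilon>" "1 \<le> 32 / \<epsilon>" using asm by (simp_all add: field_simps)
    have T1: "1 \<le> real T" using eps(2) real_nat_ceiling_ge[of "32 / \<epsilon>"] unfolding T_def by linarith
    have "real T \<le> 32 / \<epsilon> + 1" unfolding T_def using asm by (intro nat_ceiling_le) auto
    then have T_le: "real T \<le> 33 / \<epsilon>" using eps(1) by linarith
    have "real T * (KH * Z + 3) + 1 \<le> real T * (KH * Z + 3) + real T" using T1 by simp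
    also have "\<dots> = real T * (KH * Z + 4)" by (simp add: algebra_simps)
    also have "\<dots> \<le> real T * (KH * Z + 16 * Z)" using Z by (intro mult_left_mono) auto
    also have "\<dots> \<le> 33 / \<epsilon> * (KH * Z + 16 * Z)" using T_le K0 Z by (intro mult_right_mono) auto
    also have "\<dots> = K * (Z * (1 / \<epsilon>))" by (simp add: K_def algebra_simps)
    finally have T_total: "real T * (KH * Z + 3) + 1 \<le> K * (Z * (1 / \<epsilon>))" .
    have T_q: "real T * (KH * Z) \<le> real T * (KH * Z + 3) + 1" by (simp add: algebra_simps)
    have bound: "real q \<le> K * (Z * (1 / \<epsilon>)) \<and> real h \<le> K * (Z * (1 / \<epsilon>))"
      using total T_total T_q by linarith
    have "Z * (1 / \<epsilon>) = n * real d powr (3 / 2) * \<Upsilon> powr (- 1) * \<epsilon> powr (- 1) * L * ln (real N)"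
    proof -
      have "real d powr (3 / 2) = real d powr (1 + 1 / 2)" by simp
      also have "\<dots> = real d * sqrt (real d)" unfolding powr_add using asm by (simp add: powr_half_sqrt)
      finally have "real d powr (3 / 2) = real d * sqrt (real d)" .
      moreover have "\<Upsilon> powr (- 1) = 1 / \<Upsilon>" "\<epsilon> powr (- 1) = 1 / \<epsilon>"
        using asm by (simp_all add: powr_minus_divide)
      ultimately show ?thesis by (simp add: Z_def y_def)
    qed
    from bound[unfolded this n_def L_def] show "real q \<le> K * (real N powr (1 / 2 + \<mu>) * real d powr (3 / 2) * \<Upsilon> powr (- 1) *
                           \<epsilon> powr (- 1) * ln (1 / \<epsilon>) * ln (real N)) \<and>
       real h \<le> K * (real N powr (1 / 2 + \<mu>) * real d powr (3 / 2) * \<Upsilon> powr (- 1) *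
                           \<epsilon> powr (- 1) * ln (1 / \<epsilon>) * ln (real N))"
      .
  qed
qed

theorem theorem6:
  fixes X :: primitives
  assumes "valid_primitives X"
  shows "\<exists>P :: nat \<Rightarrow> nat \<Rightarrow> real \<Rightarrow> real \<Rightarrow> real \<Rightarrow> tester_params.
    params_of_order P \<and>
    (\<forall>d\<ge>3. \<exists>c>0. \<forall>\<Upsilon> \<epsilon> \<mu> :: real.
       0 < \<Upsilon> \<and> 0 < \<epsilon> \<and> \<epsilon> < 1 \<and> 0 < \<mu> \<and> \<mu> < 1 / 4 \<longrightarrow>
       expansion_tester c d
         (\<lambda>N nb. map_pmf fst (expansion_test X (P N d \<Upsilon> \<epsilon> \<mu>) N d nb)) \<Upsilon> \<epsilon> \<mu>) \<and>
    (\<exists>K. \<forall>N d E nb. \<forall>\<Upsilon> \<epsilon> \<mu> :: real.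
       2 \<le> N \<and> 3 \<le> d \<and> 0 < \<Upsilon> \<and> \<Upsilon> \<le> real d \<and> 0 < \<epsilon> \<and> \<epsilon> \<le> 1 / 2 \<and> 0 < \<mu> \<and> \<mu> < 1 / 4 \<and>
       bounded_graph N d E \<and> adjacency_lists N d E nb \<longrightarrow>
       (\<forall>(accept, queries, runtime) \<in> set_pmf (expansion_test X (P N d \<Upsilon> \<epsilon> \<mu>) N d nb).
          let bound = K * (real N powr (1 / 2 + \<mu>) * real d powr (3 / 2) * \<Upsilon> powr (- 1) *
                           \<epsilon> powr (- 1) * ln (1 / \<epsilon>) * ln (real N))
          in real queries \<le> bound \<and> real runtime \<le> bound))"
proof (intro exI[of _ test_params] conjI allI impI test_params_of_order test_params_cost[OF assms])
  fix d :: nat assume d: "3 \<le> d"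
  show "\<exists>c>0. \<forall>\<Upsilon> \<epsilon> \<mu> :: real.
       0 < \<Upsilon> \<and> 0 < \<epsilon> \<and> \<epsilon> < 1 \<and> 0 < \<mu> \<and> \<mu> < 1 / 4 \<longrightarrow>
       expansion_tester c d
         (\<lambda>N nb. map_pmf fst (expansion_test X (test_params N d \<Upsilon> \<epsilon> \<mu>) N d nb)) \<Upsilon> \<epsilon> \<mu>"
    using d test_params_correct[OF assms d]
    by (intro exI[of _ "1 / (27008 * real d ^ 4)"]) auto
qed

end
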